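(* Let $R$ be a (non-random) unitary operator on the Cameron–Martin space $H$, and let $T$ be the $\mu$-preserving transformation of the Wiener space given by $Tw=\sum_{i=1}^\infty\delta(Re_i)(w)\,e_i$, where $(e_i)_{i\ge1}$ is a complete orthonormal basis of $H$. Then $T$ is mixing if and only if $$\lim_{n\to\infty}(R^nh,h)_H=0\qquad\text{for every }h\in H.$$
   Context: $(C_0([0,1]),H,\mu)$ is the classical Wiener space: $\mu$ is the Wiener measure and $H$ is the (real) Cameron–Martin space of absolutely continuous functions $h$ on $[0,1]$ with $h(0)=0$ and $h'\in L^2([0,1])$, with $(h,k)_H=\int_0^1h'(s)k'(s)\,ds$. For $h\in H$, $\delta h=\int_0^1h'(s)\,dw_s$ (Wiener integral). The series defining $Tw$ converges almost surely uniformly on $[0,1]$, its sum does not depend ($\mu$-a.s.) on the choice of the orthonormal basis, and $T$ preserves $\mu$. $T$ is mixing if $E[(f\circ T^n)\,f]\to0$ as $n\to\infty$ for every real-valued $f\in L^2(\mu)$ with $E[f]=0$, where $E$ is expectation under $\mu$. *)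

theory Defs
  imports "HOL-Probability.Probability"
begin

text \<open>Functions on \<open>[0,1]\<close> are represented by functions on the reals that vanish outside
  \<open>[0,1]\<close>, so that equality of functions on \<open>[0,1]\<close> is equality in HOL.\<close>

definition wiener_paths :: "(real \<Rightarrow> real) set" where
  "wiener_paths =
    {w. continuous_on {0..1} w \<and> w 0 = 0 \<and> (\<forall>t. t \<notin> {0..1} \<longrightarrow> w t = 0)}"

text \<open>The \<open>\<sigma>\<close>-algebra generated by the evaluations \<open>w \<mapsto> w t\<close> is the Borel
  \<open>\<sigma>\<close>-algebra of the supremum norm. The conditions below determine the measure uniquely.\<close>

definition wiener_measure :: "(real \<Rightarrow> real) measure \<Rightarrow> bool" where
  "wiener_measure M \<longleftrightarrow>
    prob_space M \<and>
    space M = wiener_paths \<and>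
    sets M = sigma_sets wiener_paths
      {{w \<in> wiener_paths. w t \<in> A} | t A. t \<in> {0..1} \<and> A \<in> sets (borel :: real measure)} \<and>
    (\<forall>s t. 0 \<le> s \<and> s < t \<and> t \<le> 1 \<longrightarrow>
      distributed M lborel (\<lambda>w. w t - w s) (\<lambda>x. ennreal (normal_density 0 (sqrt (t - s)) x))) \<and>
    (\<forall>n (t :: nat \<Rightarrow> real). 0 \<le> t 0 \<and> t n \<le> 1 \<and> (\<forall>i<n. t i < t (Suc i)) \<longrightarrow>
      prob_space.indep_vars M (\<lambda>_. borel) (\<lambda>i w. w (t (Suc i)) - w (t i)) {..<n})"

definition square_integrable :: "'a measure \<Rightarrow> ('a \<Rightarrow> real) \<Rightarrow> bool" where
  "square_integrable M f \<longleftrightarrow> f \<in> borel_measurable M \<and> integrable M (\<lambda>x. (f x)\<^sup>2)"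

definition absolutely_continuous_01 :: "(real \<Rightarrow> real) \<Rightarrow> bool" where
  "absolutely_continuous_01 h \<longleftrightarrow>
    (\<forall>\<epsilon>>0. \<exists>\<eta>>0. \<forall>(n::nat) a b.
      (\<forall>i<n. 0 \<le> a i \<and> a i \<le> b i \<and> b i \<le> 1) \<and>
      disjoint_family_on (\<lambda>i. {a i<..<b i}) {..<n} \<and>
      (\<Sum>i<n. b i - a i) < \<eta> \<longrightarrow>
      (\<Sum>i<n. \<bar>h (b i) - h (a i)\<bar>) < \<epsilon>)"

text \<open>An absolutely continuous function is differentiable at almost every point of \<open>[0,1]\<close>;
  the values of \<^term>\<open>deriv h\<close> on the exceptional null set are irrelevant below, since
  \<^term>\<open>deriv h\<close> is only integrated with respect to Lebesgue measure.\<close>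

definition cameron_martin :: "(real \<Rightarrow> real) set" where
  "cameron_martin =
    {h. absolutely_continuous_01 h \<and> h 0 = 0 \<and> (\<forall>t. t \<notin> {0..1} \<longrightarrow> h t = 0) \<and>
        square_integrable (lebesgue_on {0..1}) (deriv h)}"

definition cm_inner :: "(real \<Rightarrow> real) \<Rightarrow> (real \<Rightarrow> real) \<Rightarrow> real" where
  "cm_inner h k = (\<integral>s. deriv h s * deriv k s \<partial>lebesgue_on {0..1})"

definition cm_unitary :: "((real \<Rightarrow> real) \<Rightarrow> (real \<Rightarrow> real)) \<Rightarrow> bool" where
  "cm_unitary R \<longleftrightarrow>
    bij_betw R cameron_martin cameron_martin \<and>
    (\<forall>h\<in>cameron_martin. \<forall>k\<in>cameron_martin. \<forall>a b.
      R (\<lambda>t. a * h t + b * k t) = (\<lambda>t. a * R h t + b * R k t)) \<and>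
    (\<forall>h\<in>cameron_martin. \<forall>k\<in>cameron_martin. cm_inner (R h) (R k) = cm_inner h k)"

definition cm_orthonormal_basis :: "(nat \<Rightarrow> real \<Rightarrow> real) \<Rightarrow> bool" where
  "cm_orthonormal_basis e \<longleftrightarrow>
    (\<forall>i. e i \<in> cameron_martin) \<and>
    (\<forall>i j. cm_inner (e i) (e j) = (if i = j then 1 else 0)) \<and>
    (\<forall>h\<in>cameron_martin.
      (\<lambda>n. let r = (\<lambda>t. h t - (\<Sum>i<n. cm_inner h (e i) * e i t)) in cm_inner r r)
        \<longlonglongrightarrow> 0)"

definition partition_01 :: "nat \<Rightarrow> (nat \<Rightarrow> real) \<Rightarrow> bool" where
  "partition_01 n t \<longleftrightarrow> 0 \<le> t 0 \<and> t n \<le> 1 \<and> (\<forall>i<n. t i < t (Suc i))"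

definition step_function :: "nat \<Rightarrow> (nat \<Rightarrow> real) \<Rightarrow> (nat \<Rightarrow> real) \<Rightarrow> real \<Rightarrow> real" where
  "step_function n t a s = (\<Sum>i<n. a i * indicator {t i<..t (Suc i)} s)"

definition step_integral ::
  "nat \<Rightarrow> (nat \<Rightarrow> real) \<Rightarrow> (nat \<Rightarrow> real) \<Rightarrow> (real \<Rightarrow> real) \<Rightarrow> real" where
  "step_integral n t a w = (\<Sum>i<n. a i * (w (t (Suc i)) - w (t i)))"

text \<open>\<open>X\<close> is a version of \<open>\<integral>\<^sub>0\<^sup>1 g(s) dw\<^sub>s\<close>: the \<open>L\<^sup>2\<close>-limit of the integrals of step functions
  converging to \<open>g\<close> in \<open>L\<^sup>2([0,1])\<close>.\<close>

definition is_wiener_integral ::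
  "(real \<Rightarrow> real) measure \<Rightarrow> (real \<Rightarrow> real) \<Rightarrow> ((real \<Rightarrow> real) \<Rightarrow> real) \<Rightarrow> bool" where
  "is_wiener_integral M g X \<longleftrightarrow>
    square_integrable (lebesgue_on {0..1}) g \<and>
    square_integrable M X \<and>
    (\<exists>n t a. (\<forall>k. partition_01 (n k) (t k)) \<and>
      (\<lambda>k. \<integral>s. (step_function (n k) (t k) (a k) s - g s)\<^sup>2 \<partial>lebesgue_on {0..1})
        \<longlonglongrightarrow> 0 \<and>
      (\<lambda>k. \<integral>w. (step_integral (n k) (t k) (a k) w - X w)\<^sup>2 \<partial>M) \<longlonglongrightarrow> 0)"

text \<open>For \<open>g\<close> in \<open>L\<^sup>2([0,1])\<close> a version exists and is unique up to a null set; one is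
  selected arbitrarily.\<close>

definition wiener_integral ::
  "(real \<Rightarrow> real) measure \<Rightarrow> (real \<Rightarrow> real) \<Rightarrow> (real \<Rightarrow> real) \<Rightarrow> real" where
  "wiener_integral M g = (SOME X. is_wiener_integral M g X)"

definition wiener_delta ::
  "(real \<Rightarrow> real) measure \<Rightarrow> (real \<Rightarrow> real) \<Rightarrow> (real \<Rightarrow> real) \<Rightarrow> real" where
  "wiener_delta M h = wiener_integral M (deriv h)"

text \<open>The series defines \<open>T\<close> only up to a null set, so \<open>T\<close> may be any measurable map that
  almost surely agrees with its uniform sum.\<close>

definition wiener_rotation ::
  "(real \<Rightarrow> real) measure \<Rightarrow> ((real \<Rightarrow> real) \<Rightarrow> (real \<Rightarrow> real)) \<Rightarrow> (nat \<Rightarrow> real \<Rightarrow> real) \<Rightarrow>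
    ((real \<Rightarrow> real) \<Rightarrow> (real \<Rightarrow> real)) \<Rightarrow> bool" where
  "wiener_rotation M R e T \<longleftrightarrow>
    T \<in> measurable M M \<and>
    (AE w in M. uniform_limit {0..1}
      (\<lambda>n t. \<Sum>i<n. wiener_delta M (R (e i)) w * e i t) (T w) sequentially)"

definition mixing :: "'a measure \<Rightarrow> ('a \<Rightarrow> 'a) \<Rightarrow> bool" where
  "mixing M T \<longleftrightarrow>
    (\<forall>f. square_integrable M f \<and> (\<integral>x. f x \<partial>M) = 0 \<longrightarrow>
      (\<lambda>n. \<integral>x. f ((T ^^ n) x) * f x \<partial>M) \<longlonglongrightarrow> 0)"

end

theory Submission
  imports Defs
begin

text \<open>The functionals \<open>\<delta> h\<close> form a Gaussian space isometric to \<open>H\<close>. Expanding the kernel \<open>min s t\<close>, which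
  represents the evaluation at \<open>t\<close>, in the basis \<open>e\<close> shows that \<open>\<delta> h \<circ> T = \<delta> (R h)\<close>; hence \<open>T\<close> preserves
  \<open>\<mu>\<close>, and \<open>E[(\<delta> h \<circ> T\<^sup>n) \<cdot> \<delta> h] = (R\<^sup>n h, h)\<close>, which is the necessity of the condition. Conversely, if
  \<open>(R\<^sup>n h, h) \<longlonglongrightarrow> 0\<close> for all \<open>h\<close>, then \<open>(R\<^sup>n h, k) \<longlonglongrightarrow> 0\<close> for all \<open>h, k\<close>. For the functions \<open>cos (\<delta> h + c)\<close>
  correlations are explicit functions of these inner products, so that they decorrelate under \<open>T\<^sup>n\<close>; and their
  linear span is an algebra which is dense in \<open>L\<^sup>2(\<mu>)\<close>. The identification of the evaluation at \<open>t\<close> with the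
  inner product against the kernel rests on the fundamental theorem of calculus for absolutely continuous
  functions.\<close>

section \<open>Square-integrable functions\<close>

text \<open>Cosines suffice because of cos x cos y = (cos (x - y) + cos (x + y)) / 2: a correlation
  of two of them is a sum of expectations of cosines of members of the same Gaussian space, and
  these depend on second moments alone. With r n the inner product of X o T^n and Y, only exp (r n)
  and exp (- r n) vary with n, and at r = 0 the expression factorizes. This takes the place of a
  chaos decomposition. Two gaps between functions and their classes shape the rest. First,
  composition with T acts on classes only if T does not charge null sets, and T is given by its
  values at times t alone. Hence the action of T is computed for finite combinations of evaluations,
  whose cosines already identify the image measure, and is extended to L2-limits afterwards.
  Secondly, H is described by the pointwise \<open>deriv\<close>, which is linear and represents
  evaluations only up to null sets; this is where differentiability almost everywhere of absolutely
  continuous functions enters.\<close>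

lemma square_integrableI:
  "f \<in> borel_measurable M \<Longrightarrow> integrable M (\<lambda>x. (f x)\<^sup>2) \<Longrightarrow> square_integrable M f"
  by (simp add: square_integrable_def)

lemma square_integrableD:
  assumes "square_integrable M f"
  shows "f \<in> borel_measurable M" "integrable M (\<lambda>x. (f x)\<^sup>2)"
  using assms by (auto simp: square_integrable_def)

lemma square_integrable_mult_integrable:
  assumes "square_integrable M f" "square_integrable M g"
  shows "integrable M (\<lambda>x. f x * g x)"
proof (rule Bochner_Integration.integrable_bound)
  show "integrable M (\<lambda>x. (f x)\<^sup>2 + (g x)\<^sup>2)"
    using assms by (auto simp: square_integrable_def)
  show "(\<lambda>x. f x * g x) \<in> borel_measurable M"
    using assms by (auto simp: square_integrable_def)
  have "\<bar>a * b\<bar> \<le> a\<^sup>2 + b\<^sup>2" for a b :: real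
  proof -
    have "2 * \<bar>a * b\<bar> \<le> a\<^sup>2 + b\<^sup>2"
      using sum_squares_bound[of "\<bar>a\<bar>" "\<bar>b\<bar>"] by (simp add: abs_mult)
    then show ?thesis using abs_ge_zero[of "a * b"] by linarith
  qed
  then show "AE x in M. norm (f x * g x) \<le> norm ((f x)\<^sup>2 + (g x)\<^sup>2)"
    by simp
qed

lemma square_integrable_add:
  assumes "square_integrable M f" "square_integrable M g"
  shows "square_integrable M (\<lambda>x. f x + g x)"
proof (rule square_integrableI)
  show "(\<lambda>x. f x + g x) \<in> borel_measurable M"
    using assms by (auto simp: square_integrable_def)
  have "integrable M (\<lambda>x. (f x)\<^sup>2 + (g x)\<^sup>2 + 2 * (f x * g x))"
    using assms square_integrable_mult_integrable[OF assms] by (auto simp: square_integrable_def)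
  then show "integrable M (\<lambda>x. (f x + g x)\<^sup>2)"
    by (simp add: power2_sum mult.assoc)
qed

lemma square_integrable_cmult:
  "square_integrable M f \<Longrightarrow> square_integrable M (\<lambda>x. c * f x)"
  by (auto simp: square_integrable_def power_mult_distrib)

lemma square_integrable_diff:
  assumes "square_integrable M f" "square_integrable M g"
  shows "square_integrable M (\<lambda>x. f x - g x)"
  using square_integrable_add[OF assms(1) square_integrable_cmult[OF assms(2), of "-1"]] by simp

lemma square_integrable_sum:
  "(\<And>i. i \<in> I \<Longrightarrow> square_integrable M (f i)) \<Longrightarrow> square_integrable M (\<lambda>x. \<Sum>i\<in>I. f i x)"
  by (induction I rule: infinite_finite_induct)
    (auto intro: square_integrable_add simp: square_integrable_def[of _ "\<lambda>_. 0"])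

lemma square_integrable_bounded:
  assumes "finite_measure M" "f \<in> borel_measurable M" "\<And>x. x \<in> space M \<Longrightarrow> \<bar>f x\<bar> \<le> C"
  shows "square_integrable M f"
proof (rule square_integrableI)
  interpret finite_measure M by fact
  show "integrable M (\<lambda>x. (f x)\<^sup>2)"
    using assms(2) by (intro integrable_const_bound[where B="C\<^sup>2"])
      (auto intro!: AE_I2 abs_le_square_iff[THEN iffD1] dest: assms(3))
qed fact

lemma square_integrable_integrable:
  assumes "finite_measure M" "square_integrable M f"
  shows "integrable M f"
proof -
  interpret finite_measure M by fact
  show ?thesis
    using square_integrable_mult_integrable[OF assms(2) square_integrable_bounded[OF assms(1), of "\<lambda>_. 1" 1]]
    by simp
qed

lemma square_integrable_cong_AE:
  assumes "square_integrable M f" "g \<in> borel_measurable M" "AE x in M. f x = g x"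
  shows "square_integrable M g"
proof (rule square_integrableI)
  show "integrable M (\<lambda>x. (g x)\<^sup>2)"
    by (rule integrable_cong_AE_imp[OF square_integrableD(2)[OF assms(1)]])
       (use assms in auto)
qed fact

lemma integral_power2_add:
  assumes "square_integrable M f" "square_integrable M g"
  shows "(\<integral>x. (f x + g x)\<^sup>2 \<partial>M)
    = (\<integral>x. (f x)\<^sup>2 \<partial>M) + 2 * (\<integral>x. f x * g x \<partial>M) + (\<integral>x. (g x)\<^sup>2 \<partial>M)"
proof -
  have "(\<integral>x. (f x + g x)\<^sup>2 \<partial>M) = (\<integral>x. (f x)\<^sup>2 + 2 * (f x * g x) + (g x)\<^sup>2 \<partial>M)"
    by (simp add: power2_sum algebra_simps)
  also have "\<dots> = (\<integral>x. (f x)\<^sup>2 \<partial>M) + 2 * (\<integral>x. f x * g x \<partial>M) + (\<integral>x. (g x)\<^sup>2 \<partial>M)"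
    using square_integrableD[OF assms(1)] square_integrableD[OF assms(2)]
      square_integrable_mult_integrable[OF assms]
    by simp
  finally show ?thesis .
qed

text \<open>The quadratic a + 2 t b + t^2 c is the integral of a square, hence nonnegative; for c >
  0 its minimum, at t = - b / c, is a - b^2 / c.\<close>

lemma Cauchy_Schwarz_integral:
  assumes "square_integrable M f" "square_integrable M g"
  shows "\<bar>\<integral>x. f x * g x \<partial>M\<bar> \<le> sqrt (\<integral>x. (f x)\<^sup>2 \<partial>M) * sqrt (\<integral>x. (g x)\<^sup>2 \<partial>M)"
proof -
  define a b c where "a = (\<integral>x. (f x)\<^sup>2 \<partial>M)" and "b = (\<integral>x. f x * g x \<partial>M)"
    and "c = (\<integral>x. (g x)\<^sup>2 \<partial>M)"
  have ac: "a \<ge> 0" "c \<ge> 0" by (auto simp: a_def c_def)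
  have q: "a + 2 * (t * b) + t\<^sup>2 * c \<ge> 0" for t
  proof -
    have "0 \<le> (\<integral>x. (f x + t * g x)\<^sup>2 \<partial>M)" by simp
    also have "\<dots> = a + 2 * (t * b) + t\<^sup>2 * c"
      unfolding integral_power2_add[OF assms(1) square_integrable_cmult[OF assms(2)]]
      by (simp add: a_def b_def c_def power_mult_distrib mult.left_commute)
    finally show ?thesis .
  qed
  have "b\<^sup>2 \<le> a * c"
  proof (cases "c = 0")
    case True
    have "b = 0"
    proof (rule ccontr)
      assume "b \<noteq> 0"
      \<comment> \<open>For c = 0 the quadratic is affine in t; this t would give it the value
        -1.\<close>
      with q[of "- (a + 1) / (2 * b)"] True show False by (simp add: field_simps)
    qed
    with True ac show ?thesis by simp
  next
    case False
    with ac have "c > 0" by simp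
    have "0 \<le> a + 2 * ((- b / c) * b) + (- b / c)\<^sup>2 * c" by (rule q)
    also have "\<dots> = a - b\<^sup>2 / c" using \<open>c > 0\<close> by (simp add: field_simps power2_eq_square)
    finally show ?thesis using \<open>c > 0\<close> by (simp add: field_simps)
  qed
  then have "sqrt (b\<^sup>2) \<le> sqrt (a * c)" by (rule real_sqrt_le_mono)
  then show ?thesis by (simp add: a_def b_def c_def real_sqrt_mult)
qed

lemma integral_power2_triangle:
  assumes "square_integrable M f" "square_integrable M g"
  shows "sqrt (\<integral>x. (f x + g x)\<^sup>2 \<partial>M) \<le> sqrt (\<integral>x. (f x)\<^sup>2 \<partial>M) + sqrt (\<integral>x. (g x)\<^sup>2 \<partial>M)"
proof (rule real_le_lsqrt)
  show "(\<integral>x. (f x + g x)\<^sup>2 \<partial>M) \<le> (sqrt (\<integral>x. (f x)\<^sup>2 \<partial>M) + sqrt (\<integral>x. (g x)\<^sup>2 \<partial>M))\<^sup>2"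
    using Cauchy_Schwarz_integral[OF assms] integral_power2_add[OF assms]
    by (simp add: power2_sum)
qed auto

text \<open>The parallelogram law with the square of the difference dropped. Working with squares
  keeps roots out of the later estimates.\<close>

lemma integral_power2_add_le:
  assumes "square_integrable M f" "square_integrable M g"
  shows "(\<integral>x. (f x + g x)\<^sup>2 \<partial>M) \<le> 2 * (\<integral>x. (f x)\<^sup>2 \<partial>M) + 2 * (\<integral>x. (g x)\<^sup>2 \<partial>M)"
proof -
  have "0 \<le> (\<integral>x. (f x + (-1) * g x)\<^sup>2 \<partial>M)" by simp
  also have "\<dots> = (\<integral>x. (f x)\<^sup>2 \<partial>M) - 2 * (\<integral>x. f x * g x \<partial>M) + (\<integral>x. (g x)\<^sup>2 \<partial>M)"
    unfolding integral_power2_add[OF assms(1) square_integrable_cmult[OF assms(2)]] by simp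
  finally show ?thesis using integral_power2_add[OF assms] by simp
qed

section \<open>L2-convergence and completeness\<close>

text \<open>The square-integrability clauses carry weight: a non-integrable function has integral 0,
  so the limit alone would say nothing.\<close>

definition L2_tendsto :: "'a measure \<Rightarrow> (nat \<Rightarrow> 'a \<Rightarrow> real) \<Rightarrow> ('a \<Rightarrow> real) \<Rightarrow> bool" where
  "L2_tendsto M X Y \<longleftrightarrow> (\<forall>n. square_integrable M (X n)) \<and> square_integrable M Y \<and>
    (\<lambda>n. \<integral>x. (X n x - Y x)\<^sup>2 \<partial>M) \<longlonglongrightarrow> 0"

lemma L2_tendsto_sqrt:
  "L2_tendsto M X Y \<Longrightarrow> (\<lambda>n. sqrt (\<integral>x. (X n x - Y x)\<^sup>2 \<partial>M)) \<longlonglongrightarrow> 0"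
  using tendsto_real_sqrt[of _ 0] by (auto simp: L2_tendsto_def)

lemma L2_tendsto_cmult:
  assumes "L2_tendsto M X Y"
  shows "L2_tendsto M (\<lambda>n x. c * X n x) (\<lambda>x. c * Y x)"
proof -
  have "(\<lambda>n. c\<^sup>2 * (\<integral>x. (X n x - Y x)\<^sup>2 \<partial>M)) \<longlonglongrightarrow> c\<^sup>2 * 0"
    using assms by (intro tendsto_mult_left) (auto simp: L2_tendsto_def)
  then show ?thesis
    using assms by (auto simp: L2_tendsto_def square_integrable_cmult power_mult_distrib
        right_diff_distrib[symmetric])
qed

lemma L2_tendsto_add:
  assumes "L2_tendsto M X Y" "L2_tendsto M X' Y'"
  shows "L2_tendsto M (\<lambda>n x. X n x + X' n x) (\<lambda>x. Y x + Y' x)"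
proof -
  have sq: "square_integrable M (X n)" "square_integrable M Y"
    "square_integrable M (X' n)" "square_integrable M Y'" for n
    using assms by (auto simp: L2_tendsto_def)
  have "(\<lambda>n. \<integral>x. (X n x + X' n x - (Y x + Y' x))\<^sup>2 \<partial>M) \<longlonglongrightarrow> 0"
  proof (rule Lim_null_comparison)
    show "(\<lambda>n. 2 * (\<integral>x. (X n x - Y x)\<^sup>2 \<partial>M) + 2 * (\<integral>x. (X' n x - Y' x)\<^sup>2 \<partial>M)) \<longlonglongrightarrow> 0"
      using assms by (auto simp: L2_tendsto_def intro!: tendsto_eq_intros)
    have "(\<integral>x. (X n x + X' n x - (Y x + Y' x))\<^sup>2 \<partial>M)
        \<le> 2 * (\<integral>x. (X n x - Y x)\<^sup>2 \<partial>M) + 2 * (\<integral>x. (X' n x - Y' x)\<^sup>2 \<partial>M)" for n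
      using integral_power2_add_le[OF square_integrable_diff[OF sq(1,2)]
          square_integrable_diff[OF sq(3,4)], of n n]
      by (simp add: algebra_simps)
    then show "\<forall>\<^sub>F n in sequentially. norm (\<integral>x. (X n x + X' n x - (Y x + Y' x))\<^sup>2 \<partial>M)
        \<le> 2 * (\<integral>x. (X n x - Y x)\<^sup>2 \<partial>M) + 2 * (\<integral>x. (X' n x - Y' x)\<^sup>2 \<partial>M)" by simp
  qed
  then show ?thesis using sq by (simp add: L2_tendsto_def square_integrable_add)
qed

text \<open>With D = X n - Y and D' = X' n - Y' the error is (D, Y') + (D', Y) + (D, D'), and
  Cauchy-Schwarz bounds each term.\<close>

lemma L2_tendsto_inner:
  assumes "L2_tendsto M X Y" "L2_tendsto M X' Y'"
  shows "(\<lambda>n. \<integral>x. X n x * X' n x \<partial>M) \<longlonglongrightarrow> (\<integral>x. Y x * Y' x \<partial>M)"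
proof -
  have sq: "square_integrable M (X n)" "square_integrable M Y"
    "square_integrable M (X' n)" "square_integrable M Y'" for n
    using assms by (auto simp: L2_tendsto_def)
  note d = square_integrable_diff[OF sq(1,2)] and d' = square_integrable_diff[OF sq(3,4)]
  let ?N = "\<lambda>f. sqrt (\<integral>x. (f x)\<^sup>2 \<partial>M)"
  define D where "D = (\<lambda>n x. X n x - Y x)"
  define D' where "D' = (\<lambda>n x. X' n x - Y' x)"
  have "(\<lambda>n. (\<integral>x. X n x * X' n x \<partial>M) - (\<integral>x. Y x * Y' x \<partial>M)) \<longlonglongrightarrow> 0"
  proof (rule Lim_null_comparison)
    show "(\<lambda>n. ?N (D n) * ?N Y' + ?N (D' n) * ?N Y + ?N (D n) * ?N (D' n)) \<longlonglongrightarrow> 0"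
      using L2_tendsto_sqrt[OF assms(1)] L2_tendsto_sqrt[OF assms(2)]
      unfolding D_def D'_def
      by (intro tendsto_add_zero tendsto_mult_left_zero tendsto_mult_zero)
    show "\<forall>\<^sub>F n in sequentially. norm ((\<integral>x. X n x * X' n x \<partial>M) - (\<integral>x. Y x * Y' x \<partial>M))
       \<le> ?N (D n) * ?N Y' + ?N (D' n) * ?N Y + ?N (D n) * ?N (D' n)"
    proof (intro always_eventually allI)
      fix n
      have sD: "square_integrable M (D n)" "square_integrable M (D' n)"
        using d d' by (simp_all add: D_def D'_def)
      have i: "integrable M (\<lambda>x. D n x * Y' x)" "integrable M (\<lambda>x. D' n x * Y x)"
        "integrable M (\<lambda>x. D n x * D' n x)" "integrable M (\<lambda>x. Y x * Y' x)"
        by (auto intro!: square_integrable_mult_integrable sD sq)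
      have "(\<integral>x. X n x * X' n x \<partial>M) = (\<integral>x. Y x * Y' x + (D n x * Y' x + D' n x * Y x + D n x * D' n x) \<partial>M)"
        by (intro Bochner_Integration.integral_cong) (auto simp: D_def D'_def algebra_simps)
      also have "\<dots> = (\<integral>x. Y x * Y' x \<partial>M) + ((\<integral>x. D n x * Y' x \<partial>M) + (\<integral>x. D' n x * Y x \<partial>M) + (\<integral>x. D n x * D' n x \<partial>M))"
        using i by simp
      finally have "(\<integral>x. X n x * X' n x \<partial>M) - (\<integral>x. Y x * Y' x \<partial>M) = (\<integral>x. D n x * Y' x \<partial>M) + (\<integral>x. D' n x * Y x \<partial>M) + (\<integral>x. D n x * D' n x \<partial>M)"
        by simp
      then show "norm ((\<integral>x. X n x * X' n x \<partial>M) - (\<integral>x. Y x * Y' x \<partial>M))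
       \<le> ?N (D n) * ?N Y' + ?N (D' n) * ?N Y + ?N (D n) * ?N (D' n)"
        using Cauchy_Schwarz_integral[OF sD(1) sq(4)] Cauchy_Schwarz_integral[OF sD(2) sq(2)]
          Cauchy_Schwarz_integral[OF sD(1) sD(2)] by (simp only: real_norm_def)
    qed
  qed
  then show ?thesis by (simp add: LIM_zero_iff)
qed

lemma L2_tendsto_const: "square_integrable M X \<Longrightarrow> L2_tendsto M (\<lambda>_. X) X"
  by (simp add: L2_tendsto_def)

lemma L2_tendsto_norm:
  assumes "L2_tendsto M X Y"
  shows "(\<lambda>n. \<integral>x. (X n x)\<^sup>2 \<partial>M) \<longlonglongrightarrow> (\<integral>x. (Y x)\<^sup>2 \<partial>M)"
  using L2_tendsto_inner[OF assms assms] by (simp add: power2_eq_square)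

lemma L2_tendsto_integral:
  assumes "L2_tendsto M X Y" "finite_measure M"
  shows "(\<lambda>n. \<integral>x. X n x \<partial>M) \<longlonglongrightarrow> (\<integral>x. Y x \<partial>M)"
  using L2_tendsto_inner[OF assms(1) L2_tendsto_const[of M "\<lambda>_. 1"]]
    square_integrable_bounded[OF assms(2), of "\<lambda>_. 1" 1] by simp

text \<open>Fatou's lemma for a sequence bounded in L2 around Z from some index on. With a member of
  the sequence as Z, a Cauchy estimate becomes an estimate of the distance to the limit.\<close>

lemma L2_Fatou:
  assumes sq: "\<And>n. square_integrable M (X n)"
    and meas: "Y \<in> borel_measurable M"
    and lim: "AE x in M. (\<lambda>n. X n x) \<longlonglongrightarrow> Y x"
    and bd: "\<And>n. n \<ge> N \<Longrightarrow> (\<integral>x. (X n x - Z x)\<^sup>2 \<partial>M) \<le> c"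
    and Z: "square_integrable M Z"
  shows "square_integrable M Y" "(\<integral>x. (Y x - Z x)\<^sup>2 \<partial>M) \<le> c"
proof -
  have c: "c \<ge> 0" using bd[of N] by (auto intro: order_trans[rotated])
  have mX[measurable]: "X n \<in> borel_measurable M" for n using sq by (auto simp: square_integrable_def)
  have mZ[measurable]: "Z \<in> borel_measurable M" using Z by (auto simp: square_integrable_def)
  note [measurable] = meas
  have "(\<integral>\<^sup>+x. ennreal ((Y x - Z x)\<^sup>2) \<partial>M) = (\<integral>\<^sup>+x. liminf (\<lambda>n. ennreal ((X n x - Z x)\<^sup>2)) \<partial>M)"
  proof (rule nn_integral_cong_AE, use lim in eventually_elim)
    fix x assume "(\<lambda>n. X n x) \<longlonglongrightarrow> Y x"
    then have "(\<lambda>n. ennreal ((X n x - Z x)\<^sup>2)) \<longlonglongrightarrow> ennreal ((Y x - Z x)\<^sup>2)"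
      by (intro tendsto_ennrealI tendsto_intros)
    then show "ennreal ((Y x - Z x)\<^sup>2) = liminf (\<lambda>n. ennreal ((X n x - Z x)\<^sup>2))"
      by (intro lim_imp_Liminf[symmetric]) auto
  qed
  also have "\<dots> \<le> liminf (\<lambda>n. \<integral>\<^sup>+x. ennreal ((X n x - Z x)\<^sup>2) \<partial>M)"
    by (rule nn_integral_liminf) auto
  also have "\<dots> \<le> liminf (\<lambda>n. ennreal c)"
  proof (rule Liminf_mono)
    show "\<forall>\<^sub>F n in sequentially. (\<integral>\<^sup>+x. ennreal ((X n x - Z x)\<^sup>2) \<partial>M) \<le> ennreal c"
    proof (intro eventually_sequentiallyI[of N])
      fix n assume "n \<ge> N"
      then show "(\<integral>\<^sup>+x. ennreal ((X n x - Z x)\<^sup>2) \<partial>M) \<le> ennreal c"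
        using bd[of n] square_integrableD(2)[OF square_integrable_diff[OF sq Z]]
        by (subst nn_integral_eq_integral) (auto intro: ennreal_leI)
    qed
  qed
  also have "\<dots> = ennreal c" by (simp add: Liminf_const)
  finally have le: "(\<integral>\<^sup>+x. ennreal ((Y x - Z x)\<^sup>2) \<partial>M) \<le> ennreal c" .
  have int: "integrable M (\<lambda>x. (Y x - Z x)\<^sup>2)"
    by (rule integrableI_bounded) (use le in \<open>auto simp: top.not_eq_extremum[symmetric] top_unique\<close>)
  then have "square_integrable M (\<lambda>x. Y x - Z x)" by (intro square_integrableI) auto
  from square_integrable_add[OF this Z] show "square_integrable M Y" by simp
  show "(\<integral>x. (Y x - Z x)\<^sup>2 \<partial>M) \<le> c"
    using le c int by (subst (asm) nn_integral_eq_integral) (auto simp: ennreal_le_iff)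
qed

text \<open>Joins two modes of convergence: the series for T converges almost surely, whereas the
  isometry controls it in L2. Fatou's lemma along one index, the other being fixed, identifies the
  limits.\<close>

lemma L2_tendsto_AE_limit:
  assumes sq: "\<And>n. square_integrable M (X n)"
    and meas: "Y \<in> borel_measurable M"
    and lim: "AE x in M. (\<lambda>n. X n x) \<longlonglongrightarrow> Y x"
    and cauchy: "\<And>e. e > 0 \<Longrightarrow> \<exists>N. \<forall>m\<ge>N. \<forall>n\<ge>N. (\<integral>x. (X m x - X n x)\<^sup>2 \<partial>M) \<le> e"
  shows "L2_tendsto M X Y"
proof -
  obtain N where N: "\<forall>m\<ge>N. \<forall>n\<ge>N. (\<integral>x. (X m x - X n x)\<^sup>2 \<partial>M) \<le> 1" using cauchy[of 1] by auto
  have Y: "square_integrable M Y"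
    by (rule L2_Fatou(1)[OF sq meas lim, of N "X N" 1]) (use N sq in auto)
  have "(\<lambda>n. \<integral>x. (X n x - Y x)\<^sup>2 \<partial>M) \<longlonglongrightarrow> 0"
  proof (rule LIMSEQ_I)
    fix r :: real assume "r > 0"
    then obtain N where N: "\<forall>m\<ge>N. \<forall>n\<ge>N. (\<integral>x. (X m x - X n x)\<^sup>2 \<partial>M) \<le> r / 2"
      using cauchy[of "r/2"] by auto
    have "(\<integral>x. (X n x - Y x)\<^sup>2 \<partial>M) \<le> r / 2" if "n \<ge> N" for n
      using L2_Fatou(2)[OF sq meas lim, of N "X n" "r/2"] N that sq by (simp add: power2_commute)
    then show "\<exists>no. \<forall>n\<ge>no. norm ((\<integral>x. (X n x - Y x)\<^sup>2 \<partial>M) - 0) < r"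
      using \<open>r > 0\<close> by (intro exI[of _ N]) fastforce
  qed
  then show ?thesis using sq Y by (simp add: L2_tendsto_def)
qed

lemma L2_complete:
  assumes fin: "finite_measure M"
    and sq: "\<And>n. square_integrable M (X n)"
    and cauchy: "\<And>e. e > 0 \<Longrightarrow> \<exists>N. \<forall>m\<ge>N. \<forall>n\<ge>N. (\<integral>x. (X m x - X n x)\<^sup>2 \<partial>M) \<le> e"
  shows "\<exists>Y. L2_tendsto M X Y"
proof -
  interpret finite_measure M by fact
  \<comment> \<open>Squared distances of at most (1/4)^k are distances of at most (1/2)^k, so that
    the increments along the subsequence have summable L1 norms.\<close>
  have "\<forall>k. \<exists>N. \<forall>m\<ge>N. \<forall>n\<ge>N. (\<integral>x. (X m x - X n x)\<^sup>2 \<partial>M) \<le> (1/4) ^ k"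
    using cauchy by auto
  then obtain N where N: "\<And>k m n. m \<ge> N k \<Longrightarrow> n \<ge> N k \<Longrightarrow> (\<integral>x. (X m x - X n x)\<^sup>2 \<partial>M) \<le> (1/4) ^ k"
    by metis
  \<comment> \<open>\<open>max (Suc p)\<close> makes the indices strictly increasing, whence also r
    k \<ge> k.\<close>
  define r where "r = rec_nat (N 0) (\<lambda>k p. max (Suc p) (N (Suc k)))"
  have rN: "r k \<ge> N k" for k by (cases k) (auto simp: r_def)
  have "r k < r (Suc k)" for k by (simp add: r_def less_max_iff_disj)
  then have "strict_mono r" by (simp add: strict_mono_Suc_iff)
  then have rk: "r k \<ge> k" for k by (rule seq_suble)
  define D where "D = (\<lambda>k x. X (r (Suc k)) x - X (r k) x)"
  have sD: "square_integrable M (D k)" for k unfolding D_def by (intro square_integrable_diff sq)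
  have D1: "(\<integral>x. \<bar>D k x\<bar> \<partial>M) \<le> (1/2)^k * sqrt (measure M (space M))" for k
  proof -
    have "square_integrable M (\<lambda>x. \<bar>D k x\<bar>)"
      using sD[of k] by (auto simp: square_integrable_def)
    moreover have "square_integrable M (\<lambda>_. 1)"
      by (rule square_integrable_bounded[OF fin, of _ 1]) auto
    ultimately have "(\<integral>x. \<bar>D k x\<bar> \<partial>M) \<le> sqrt (\<integral>x. (D k x)\<^sup>2 \<partial>M) * sqrt (measure M (space M))"
      using Cauchy_Schwarz_integral[of M "\<lambda>x. \<bar>D k x\<bar>" "\<lambda>_. 1"] by auto
    also have "sqrt (\<integral>x. (D k x)\<^sup>2 \<partial>M) \<le> sqrt ((1/4)^k)"
      unfolding D_def using N[of k "r (Suc k)" "r k"] rN[of k] \<open>\<And>k. r k < r (Suc k)\<close>[of k]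
      by (intro real_sqrt_le_mono) auto
    also have "sqrt ((1/4::real)^k) = (1/2)^k" by (simp add: real_sqrt_power real_sqrt_divide)
    finally show ?thesis by (simp add: mult_right_mono)
  qed
  have iD: "integrable M (D k)" for k by (rule square_integrable_integrable[OF fin sD])
  have "AE x in M. summable (\<lambda>k. norm (D k x))"
  proof -
    have "(\<integral>\<^sup>+x. (\<Sum>k. ennreal \<bar>D k x\<bar>) \<partial>M) = (\<Sum>k. \<integral>\<^sup>+x. ennreal \<bar>D k x\<bar> \<partial>M)"
      using square_integrableD(1)[OF sD] by (intro nn_integral_suminf) auto
    also have "\<dots> \<le> (\<Sum>k. ennreal ((1/2)^k * sqrt (measure M (space M))))"
    proof (intro suminf_le)
      fix k show "(\<integral>\<^sup>+x. ennreal \<bar>D k x\<bar> \<partial>M) \<le> ennreal ((1/2)^k * sqrt (measure M (space M)))"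
        using D1[of k] iD[of k] by (subst nn_integral_eq_integral) (auto intro: ennreal_leI)
    qed auto
    also have "\<dots> < \<infinity>"
      by (subst suminf_ennreal2) (auto intro!: summable_mult2 summable_geometric)
    finally have fin: "(\<integral>\<^sup>+x. (\<Sum>k. ennreal \<bar>D k x\<bar>) \<partial>M) \<noteq> \<infinity>" by simp
    have "AE x in M. (\<Sum>k. ennreal \<bar>D k x\<bar>) \<noteq> \<infinity>"
      using square_integrableD(1)[OF sD] by (intro nn_integral_PInf_AE fin) auto
    then show ?thesis
      by eventually_elim (auto intro!: summable_suminf_not_top)
  qed
  then have conv: "AE x in M. convergent (\<lambda>k. X (r k) x)"
  proof eventually_elim
    case (elim x)
    then have "summable (\<lambda>k. D k x)" by (rule summable_norm_cancel)
    then have "(\<lambda>n. \<Sum>k<n. D k x) \<longlonglongrightarrow> suminf (\<lambda>k. D k x)" by (rule summable_LIMSEQ)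
    moreover have "(\<Sum>k<n. D k x) = X (r n) x - X (r 0) x" for n
      unfolding D_def by (rule sum_lessThan_telescope)
    ultimately have "(\<lambda>n. X (r n) x - X (r 0) x + X (r 0) x) \<longlonglongrightarrow> suminf (\<lambda>k. D k x) + X (r 0) x"
      by (intro tendsto_add) auto
    then show ?case by (auto simp: convergent_def)
  qed
  \<comment> \<open>On the null set where the subsequence diverges, \<open>lim\<close> has some
    unspecified value.\<close>
  define Y where "Y x = lim (\<lambda>k. X (r k) x)" for x
  have mY: "Y \<in> borel_measurable M"
    unfolding Y_def using square_integrableD(1)[OF sq] by (intro borel_measurable_lim_metric) auto
  have lY: "AE x in M. (\<lambda>k. X (r k) x) \<longlonglongrightarrow> Y x"
    using conv by eventually_elim (simp add: Y_def convergent_LIMSEQ_iff)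
  have "L2_tendsto M (\<lambda>k. X (r k)) Y"
  proof (rule L2_tendsto_AE_limit[OF sq mY lY])
    fix e :: real assume "e > 0"
    from cauchy[OF this] rk
    show "\<exists>N. \<forall>m\<ge>N. \<forall>n\<ge>N. (\<integral>x. (X (r m) x - X (r n) x)\<^sup>2 \<partial>M) \<le> e"
      by (meson order_trans)
  qed
  then have sY: "square_integrable M Y" and rY: "(\<lambda>k. \<integral>x. (X (r k) x - Y x)\<^sup>2 \<partial>M) \<longlonglongrightarrow> 0"
    by (auto simp: L2_tendsto_def)
  have "(\<lambda>n. \<integral>x. (X n x - Y x)\<^sup>2 \<partial>M) \<longlonglongrightarrow> 0"
  proof (rule LIMSEQ_I)
    fix e :: real assume e: "e > 0"
    obtain K where K: "\<forall>m\<ge>K. \<forall>n\<ge>K. (\<integral>x. (X m x - X n x)\<^sup>2 \<partial>M) \<le> e / 8"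
      using cauchy[of "e/8"] e by auto
    obtain K' where K': "\<forall>k\<ge>K'. norm ((\<integral>x. (X (r k) x - Y x)\<^sup>2 \<partial>M) - 0) < e / 8"
      using LIMSEQ_D[OF rY, of "e/8"] e by auto
    define k where "k = max K K'"
    have "norm ((\<integral>x. (X n x - Y x)\<^sup>2 \<partial>M) - 0) < e" if "n \<ge> K" for n
    proof -
      have "r k \<ge> K" "k \<ge> K'" using rk[of k] by (auto simp: k_def)
      then have "(\<integral>x. (X n x - X (r k) x)\<^sup>2 \<partial>M) \<le> e / 8" "(\<integral>x. (X (r k) x - Y x)\<^sup>2 \<partial>M) < e / 8"
        using K K' that by auto
      moreover have "(\<integral>x. (X n x - Y x)\<^sup>2 \<partial>M)
          \<le> 2 * (\<integral>x. (X n x - X (r k) x)\<^sup>2 \<partial>M) + 2 * (\<integral>x. (X (r k) x - Y x)\<^sup>2 \<partial>M)"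
        using integral_power2_add_le[OF square_integrable_diff[OF sq sq] square_integrable_diff[OF sq sY], of n "r k" "r k"]
        by simp
      ultimately show ?thesis using e by simp
    qed
    then show "\<exists>no. \<forall>n\<ge>no. norm ((\<integral>x. (X n x - Y x)\<^sup>2 \<partial>M) - 0) < e" by blast
  qed
  then show ?thesis using sq sY by (auto simp: L2_tendsto_def)
qed

section \<open>Density of algebras of bounded functions\<close>

text \<open>Approximation takes place simultaneously for two measures: with equal measures this is density, with
  different ones it shows that two measures which agree on the algebra coincide.\<close>

locale L2_dense_algebra =
  fixes M N :: "'a measure" and A :: "('a \<Rightarrow> real) set"
  assumes finite_M: "finite_measure M" and finite_N: "finite_measure N"
    and sets_N: "sets N = sets M"
    and A_measurable: "a \<in> A \<Longrightarrow> a \<in> borel_measurable M"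
    and A_bounded: "a \<in> A \<Longrightarrow> \<exists>C. \<forall>x\<in>space M. \<bar>a x\<bar> \<le> C"
    and A_add: "a \<in> A \<Longrightarrow> b \<in> A \<Longrightarrow> (\<lambda>x. a x + b x) \<in> A"
    and A_cmult: "a \<in> A \<Longrightarrow> (\<lambda>x. c * a x) \<in> A"
    and A_mult: "a \<in> A \<Longrightarrow> b \<in> A \<Longrightarrow> (\<lambda>x. a x * b x) \<in> A"
    and A_one: "(\<lambda>_. 1) \<in> A"
begin

definition sq :: "('a \<Rightarrow> real) \<Rightarrow> bool" where
  "sq f \<longleftrightarrow> square_integrable M f \<and> square_integrable N f"

definition Q :: "('a \<Rightarrow> real) \<Rightarrow> real" where
  "Q f = (\<integral>x. (f x)\<^sup>2 \<partial>M) + (\<integral>x. (f x)\<^sup>2 \<partial>N)"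

definition approx :: "('a \<Rightarrow> real) \<Rightarrow> bool" where
  "approx f \<longleftrightarrow> (\<forall>e>0. \<exists>a\<in>A. Q (\<lambda>x. f x - a x) < e)"

lemma space_N: "space N = space M"
  using sets_N by (rule sets_eq_imp_space_eq)

lemma measurable_N: "f \<in> borel_measurable N \<longleftrightarrow> f \<in> borel_measurable M"
  using sets_N by (simp cong: measurable_cong_sets)

lemma sq_measurable: "sq f \<Longrightarrow> f \<in> borel_measurable M"
  by (simp add: sq_def square_integrable_def)

lemma sq_bounded:
  assumes "f \<in> borel_measurable M" "\<And>x. x \<in> space M \<Longrightarrow> \<bar>f x\<bar> \<le> C"
  shows "sq f"
  using square_integrable_bounded[OF finite_M, of f C] square_integrable_bounded[OF finite_N, of f C]
    assms by (auto simp: sq_def space_N measurable_N)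

lemma sq_A: "a \<in> A \<Longrightarrow> sq a"
  using A_bounded[of a] A_measurable[of a] sq_bounded by blast

lemma sq_add: "sq f \<Longrightarrow> sq g \<Longrightarrow> sq (\<lambda>x. f x + g x)"
  and sq_diff: "sq f \<Longrightarrow> sq g \<Longrightarrow> sq (\<lambda>x. f x - g x)"
  and sq_cmult: "sq f \<Longrightarrow> sq (\<lambda>x. c * f x)"
  by (simp_all add: sq_def square_integrable_add square_integrable_diff square_integrable_cmult)

lemma Q_nonneg: "Q f \<ge> 0"
  by (simp add: Q_def)

lemma Q_add_le: "sq f \<Longrightarrow> sq g \<Longrightarrow> Q (\<lambda>x. f x + g x) \<le> 2 * Q f + 2 * Q g"
  unfolding Q_def sq_def using integral_power2_add_le[of M f g] integral_power2_add_le[of N f g]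
  by simp

lemma Q_cmult: "Q (\<lambda>x. c * f x) = c\<^sup>2 * Q f"
  by (simp add: Q_def power_mult_distrib distrib_left)

lemma Q_mult_le:
  assumes "f \<in> borel_measurable M" "\<And>x. x \<in> space M \<Longrightarrow> \<bar>f x\<bar> \<le> C" "sq g"
  shows "Q (\<lambda>x. f x * g x) \<le> C\<^sup>2 * Q g"
proof -
  have *: "(\<integral>x. (f x * g x)\<^sup>2 \<partial>P) \<le> C\<^sup>2 * (\<integral>x. (g x)\<^sup>2 \<partial>P)"
    if P: "square_integrable P g" "f \<in> borel_measurable P" "space P = space M" for P
  proof -
    have le: "(f x * g x)\<^sup>2 \<le> C\<^sup>2 * (g x)\<^sup>2" if "x \<in> space P" for x
      using assms(2)[of x] that P(3)
      by (auto simp: power_mult_distrib intro!: mult_right_mono abs_le_square_iff[THEN iffD1])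
    have "integrable P (\<lambda>x. (f x * g x)\<^sup>2)"
    proof (rule Bochner_Integration.integrable_bound)
      show "integrable P (\<lambda>x. C\<^sup>2 * (g x)\<^sup>2)" using P by (auto simp: square_integrable_def)
      show "(\<lambda>x. (f x * g x)\<^sup>2) \<in> borel_measurable P" using P by (auto simp: square_integrable_def)
    qed (use le in \<open>auto intro!: AE_I2\<close>)
    then have "(\<integral>x. (f x * g x)\<^sup>2 \<partial>P) \<le> (\<integral>x. C\<^sup>2 * (g x)\<^sup>2 \<partial>P)"
      using P le by (intro integral_mono) (auto simp: square_integrable_def)
    then show ?thesis by simp
  qed
  show ?thesis
    unfolding Q_def distrib_left using assms *[of M] *[of N]
    by (auto simp: sq_def measurable_N space_N intro!: add_mono)
qed

lemma approx_A: "a \<in> A \<Longrightarrow> approx a"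
  unfolding approx_def by (auto intro!: bexI[of _ a] simp: Q_def)

lemma approx_add:
  assumes "approx f" "approx g" "sq f" "sq g"
  shows "approx (\<lambda>x. f x + g x)"
  unfolding approx_def
proof (intro allI impI)
  fix e :: real assume "e > 0"
  then obtain a b where ab: "a \<in> A" "Q (\<lambda>x. f x - a x) < e / 4" "b \<in> A" "Q (\<lambda>x. g x - b x) < e / 4"
    using assms(1,2) unfolding approx_def by (metis zero_less_divide_iff zero_less_numeral)
  have "Q (\<lambda>x. (f x - a x) + (g x - b x)) < e"
    using Q_add_le[of "\<lambda>x. f x - a x" "\<lambda>x. g x - b x"] ab assms by (auto simp: sq_diff sq_A)
  then show "\<exists>a\<in>A. Q (\<lambda>x. f x + g x - a x) < e"
    using A_add[OF ab(1,3)] by (intro bexI[of _ "\<lambda>x. a x + b x"]) (simp_all add: algebra_simps)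
qed

lemma approx_cmult:
  assumes "approx f"
  shows "approx (\<lambda>x. c * f x)"
  unfolding approx_def
proof (intro allI impI)
  fix e :: real assume e: "e > 0"
  then have "e / (c\<^sup>2 + 1) > 0" by (auto intro!: divide_pos_pos add_nonneg_pos)
  then obtain a where a: "a \<in> A" "Q (\<lambda>x. f x - a x) < e / (c\<^sup>2 + 1)"
    using assms unfolding approx_def by blast
  have "(c\<^sup>2 + 1) * Q (\<lambda>x. f x - a x) < e"
    using a(2) by (subst (asm) pos_less_divide_eq) (auto intro: add_nonneg_pos simp: mult.commute)
  then have "Q (\<lambda>x. c * (f x - a x)) < e"
    unfolding Q_cmult using Q_nonneg[of "\<lambda>x. f x - a x"] by (simp add: distrib_right)
  then show "\<exists>a\<in>A. Q (\<lambda>x. c * f x - a x) < e"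
    using A_cmult[OF a(1)] by (intro bexI[of _ "\<lambda>x. c * a x"]) (simp_all add: algebra_simps)
qed

lemma approx_limit:
  assumes "sq f" "\<And>e. e > 0 \<Longrightarrow> \<exists>g. sq g \<and> approx g \<and> Q (\<lambda>x. f x - g x) < e"
  shows "approx f"
  unfolding approx_def
proof (intro allI impI)
  fix e :: real assume e: "e > 0"
  obtain g where g: "sq g" "approx g" "Q (\<lambda>x. f x - g x) < e / 4" using assms(2)[of "e/4"] e by auto
  obtain a where a: "a \<in> A" "Q (\<lambda>x. g x - a x) < e / 4" using g(2) e unfolding approx_def
    by (metis zero_less_divide_iff zero_less_numeral)
  have "Q (\<lambda>x. (f x - g x) + (g x - a x)) < e"
    using Q_add_le[of "\<lambda>x. f x - g x" "\<lambda>x. g x - a x"] a g assms by (auto simp: sq_diff sq_A)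
  then show "\<exists>a\<in>A. Q (\<lambda>x. f x - a x) < e"
    using a(1) by (intro bexI[of _ a]) (simp_all add: algebra_simps)
qed

text \<open>Dominated convergence in both measures at once; the later passages to pointwise limits
  go through it.\<close>

lemma approx_dominated:
  assumes "sq h" "\<And>n. g n \<in> borel_measurable M" "\<And>n. approx (g n)"
    and "\<And>n x. x \<in> space M \<Longrightarrow> \<bar>g n x\<bar> \<le> h x"
    and lim: "\<And>x. x \<in> space M \<Longrightarrow> (\<lambda>n. g n x) \<longlonglongrightarrow> f x"
  shows "approx f" "sq f"
proof -
  have mf: "f \<in> borel_measurable M"
    by (rule borel_measurable_LIMSEQ_real[OF lim assms(2)])
  have fh: "\<bar>f x\<bar> \<le> h x" if "x \<in> space M" for x
    using that assms(4) by (intro tendsto_upperbound[OF tendsto_rabs[OF lim]]) auto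
  have *: "square_integrable P u"
    if P: "square_integrable P h" and mu: "u \<in> borel_measurable P"
      and uh: "\<And>x. x \<in> space P \<Longrightarrow> \<bar>u x\<bar> \<le> h x" for P u
  proof (rule square_integrableI)
    have "(u x)\<^sup>2 \<le> (h x)\<^sup>2" if "x \<in> space P" for x
      using power_mono[OF uh[OF that], of 2] by simp
    then show "integrable P (\<lambda>x. (u x)\<^sup>2)"
      using mu by (intro Bochner_Integration.integrable_bound[OF square_integrableD(2)[OF P]])
        (auto intro!: AE_I2)
  qed fact
  show sf: "sq f"
    using assms(1) mf fh by (auto simp: sq_def measurable_N space_N intro!: *)
  have sg: "sq (g n)" for n
    using assms(1,2,4) by (auto simp: sq_def measurable_N space_N intro!: *)
  have conv: "(\<lambda>n. \<integral>x. (f x - g n x)\<^sup>2 \<partial>P) \<longlonglongrightarrow> 0"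
    if P: "square_integrable P h" "f \<in> borel_measurable P" "\<And>n. g n \<in> borel_measurable P"
      "space P = space M" for P
  proof -
    have "(\<lambda>n. \<integral>x. (f x - g n x)\<^sup>2 \<partial>P) \<longlonglongrightarrow> (\<integral>x. 0 \<partial>P)"
    \<comment> \<open>The limit inherits the bound h, so a difference is at most 2 h and its square
      at most 4 h^2.\<close>
    proof (rule integral_dominated_convergence[where w="\<lambda>x. 4 * (h x)\<^sup>2"])
      show "AE x in P. (\<lambda>n. (f x - g n x)\<^sup>2) \<longlonglongrightarrow> 0"
      proof (rule AE_I2)
        fix x assume "x \<in> space P"
        then have "(\<lambda>n. g n x) \<longlonglongrightarrow> f x" using lim P(4) by simp
        then have "(\<lambda>n. (f x - g n x)\<^sup>2) \<longlonglongrightarrow> (f x - f x)\<^sup>2" by (intro tendsto_intros)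
        then show "(\<lambda>n. (f x - g n x)\<^sup>2) \<longlonglongrightarrow> 0" by simp
      qed
      show "AE x in P. norm ((f x - g n x)\<^sup>2) \<le> 4 * (h x)\<^sup>2" for n
      proof (rule AE_I2)
        fix x assume "x \<in> space P"
        then have "\<bar>f x - g n x\<bar> \<le> 2 * h x" using fh[of x] assms(4)[of x n] P(4) by simp
        then have "\<bar>f x - g n x\<bar>\<^sup>2 \<le> (2 * h x)\<^sup>2" by (intro power_mono) auto
        then show "norm ((f x - g n x)\<^sup>2) \<le> 4 * (h x)\<^sup>2" by (simp add: power_mult_distrib)
      qed
    qed (use P in \<open>auto simp: square_integrable_def\<close>)
    then show ?thesis by simp
  qed
  have "(\<lambda>n. Q (\<lambda>x. f x - g n x)) \<longlonglongrightarrow> 0 + 0"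
    unfolding Q_def using assms(1,2) mf
    by (intro tendsto_add conv) (auto simp: sq_def measurable_N space_N)
  then have Q0: "(\<lambda>n. Q (\<lambda>x. f x - g n x)) \<longlonglongrightarrow> 0" by simp
  show "approx f"
  proof (rule approx_limit[OF sf])
    fix e :: real assume "e > 0"
    from order_tendstoD(2)[OF Q0 this] obtain n where "Q (\<lambda>x. f x - g n x) < e"
      by (auto simp: eventually_sequentially)
    then show "\<exists>g. sq g \<and> approx g \<and> Q (\<lambda>x. f x - g x) < e" using sg assms(3) by blast
  qed
qed

text \<open>f g - a b = g (f - a) + a (g - b), with bounded multipliers g and a. The approximation b
  has to be chosen after a, since its tolerance depends on the bound \<open>C'\<close> of a.\<close>

lemma approx_mult:
  assumes f: "f \<in> borel_measurable M" "\<And>x. x \<in> space M \<Longrightarrow> \<bar>f x\<bar> \<le> C" "approx f"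
    and g: "g \<in> borel_measurable M" "\<And>x. x \<in> space M \<Longrightarrow> \<bar>g x\<bar> \<le> D" "approx g"
  shows "approx (\<lambda>x. f x * g x)"
proof (rule approx_limit)
  have sf: "sq f" and sg: "sq g" using sq_bounded f g by blast+
  have "\<bar>f x * g x\<bar> \<le> C * D" if "x \<in> space M" for x
    using f(2)[OF that] g(2)[OF that] by (auto simp: abs_mult intro!: mult_mono intro: order_trans[rotated])
  then show "sq (\<lambda>x. f x * g x)" using f g by (intro sq_bounded) auto
  \<comment> \<open>The summand 1 keeps the tolerances positive and finite when a bound is
    0.\<close>
  have pos: "x / (c\<^sup>2 + 1) > 0" if "x > 0" for x c :: real
    using that by (auto intro!: divide_pos_pos add_nonneg_pos)
  have sm: "c\<^sup>2 * q < x" if "q < x / (c\<^sup>2 + 1)" "q \<ge> 0" for x c q :: real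
  proof -
    have "(c\<^sup>2 + 1) * q < x"
      using that(1) by (subst (asm) pos_less_divide_eq) (auto intro: add_nonneg_pos simp: mult.commute)
    then show ?thesis using that(2) by (simp add: distrib_right)
  qed
  fix e :: real assume e: "e > 0"
  obtain a where a: "a \<in> A" "Q (\<lambda>x. f x - a x) < (e/4) / (D\<^sup>2 + 1)"
    using f(3) pos[of "e/4" D] e unfolding approx_def by fastforce
  obtain C' where C': "\<And>x. x \<in> space M \<Longrightarrow> \<bar>a x\<bar> \<le> C'" using A_bounded[OF a(1)] by blast
  obtain b where b: "b \<in> A" "Q (\<lambda>x. g x - b x) < (e/4) / (C'\<^sup>2 + 1)"
    using g(3) pos[of "e/4" C'] e unfolding approx_def by fastforce
  have 1: "Q (\<lambda>x. g x * (f x - a x)) < e / 4"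
    using Q_mult_le[OF g(1,2) sq_diff[OF sf sq_A[OF a(1)]]] sm[OF a(2) Q_nonneg] by simp
  have 2: "Q (\<lambda>x. a x * (g x - b x)) < e / 4"
    using Q_mult_le[OF A_measurable[OF a(1)] C' sq_diff[OF sg sq_A[OF b(1)]]] sm[OF b(2) Q_nonneg] by simp
  have s1: "sq (\<lambda>x. g x * f x)" using \<open>sq (\<lambda>x. f x * g x)\<close> by (simp add: mult.commute)
  obtain D' where D': "\<And>x. x \<in> space M \<Longrightarrow> \<bar>b x\<bar> \<le> D'" using A_bounded[OF b(1)] by blast
  have bd: "sq (\<lambda>x. u x * v x)" if u: "u \<in> borel_measurable M" "\<And>x. x \<in> space M \<Longrightarrow> \<bar>u x\<bar> \<le> K"
    and v: "v \<in> borel_measurable M" "\<And>x. x \<in> space M \<Longrightarrow> \<bar>v x\<bar> \<le> K'" for u v K K'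
  proof (rule sq_bounded[where C="K * K'"])
    show "\<bar>u x * v x\<bar> \<le> K * K'" if "x \<in> space M" for x
      using u(2)[OF that] v(2)[OF that] by (auto simp: abs_mult intro!: mult_mono intro: order_trans[rotated])
  qed (use u v in auto)
  have s2: "sq (\<lambda>x. g x * (f x - a x))" unfolding right_diff_distrib
    by (intro sq_diff s1 bd[OF g(1,2) A_measurable[OF a(1)] C'])
  have s3: "sq (\<lambda>x. a x * (g x - b x))" unfolding right_diff_distrib
    by (intro sq_diff bd[OF A_measurable[OF a(1)] C' g(1,2)] bd[OF A_measurable[OF a(1)] C' A_measurable[OF b(1)] D'])
  have "Q (\<lambda>x. g x * (f x - a x) + a x * (g x - b x)) < e"
    using Q_add_le[OF s2 s3] 1 2 by simp
  then have "Q (\<lambda>x. f x * g x - a x * b x) < e" by (simp add: algebra_simps)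
  moreover have "(\<lambda>x. a x * b x) \<in> A" by (rule A_mult[OF a(1) b(1)])
  ultimately show "\<exists>g'. sq g' \<and> approx g' \<and> Q (\<lambda>x. f x * g x - g' x) < e"
    using approx_A sq_A by (intro exI[of _ "\<lambda>x. a x * b x"]) auto
qed

text \<open>Since products are available, the sets with approximable indicator are closed under
  intersections; complements come from the constant 1, countable unions as limits of finite ones.
  Induction over \<open>sigma_sets\<close> therefore works for an arbitrary generator.\<close>

lemma approx_indicator_sigma:
  assumes G: "G \<subseteq> sets M" "\<And>S. S \<in> G \<Longrightarrow> approx (indicator S)"
    and S: "S \<in> sigma_sets (space M) G"
  shows "S \<in> sets M \<and> approx (indicator S)"
proof -
  have ind_bd: "\<bar>indicator S x :: real\<bar> \<le> 1" for S :: "'a set" and x by (simp add: indicator_def)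
  have int: "S \<inter> S' \<in> sets M \<and> approx (indicator (S \<inter> S'))"
    if "S \<in> sets M \<and> approx (indicator S)" "S' \<in> sets M \<and> approx (indicator S')" for S S'
    using approx_mult[of "indicator S" 1 "indicator S'" 1] that ind_bd
    by (auto simp: indicator_inter_arith[abs_def])
  have compl: "space M - S \<in> sets M \<and> approx (indicator (space M - S))"
    if "S \<in> sets M \<and> approx (indicator S)" for S
  proof -
    have "approx (\<lambda>x. 1 + (-1) * indicator S x)"
      using that ind_bd approx_A[OF A_one] sq_A[OF A_one]
      by (intro approx_add approx_cmult sq_cmult sq_bounded[of "indicator S" 1]) auto
    then have "approx (\<lambda>x. 1 - indicator S x)" by simp
    moreover have "Q (\<lambda>x. 1 - indicator S x - a x) = Q (\<lambda>x. indicator (space M - S) x - a x)" for a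
      unfolding Q_def by (intro arg_cong2[where f="(+)"] Bochner_Integration.integral_cong)
        (auto simp: indicator_def space_N)
    ultimately show ?thesis using that by (auto simp: approx_def)
  qed
  have empty: "{} \<in> sets M \<and> approx (indicator {})"
    using approx_A[OF A_cmult[OF A_one, of 0]] by (simp add: indicator_def[abs_def])
  show ?thesis using S
  proof induction
    case (Basic a) then show ?case using G by auto
  next
    case Empty then show ?case by (rule empty)
  next
    case (Compl a) then show ?case by (intro compl)
  next
    case (Union B)
    define U where "U n = (\<Union>i<n. B i)" for n :: nat
    have U: "U n \<in> sets M \<and> approx (indicator (U n))" for n
    proof (induction n)
      case 0
      have "U 0 = {}" by (simp add: U_def)
      then show ?case using empty by (simp only: simp_thms)
    next
      case (Suc n)
      \<comment> \<open>De Morgan reduces finite unions to complements and products of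
        indicators.\<close>
      have "U (Suc n) = space M - ((space M - U n) \<inter> (space M - B n))"
        using sets.sets_into_space[of "B n" M] sets.sets_into_space[of "U n" M] Union.IH[of n] Suc
        by (auto simp: U_def lessThan_Suc)
      then show ?case using compl[OF int[OF compl[OF Suc] compl[OF Union.IH[of n]]]] by simp
    qed
    have "approx (indicator (\<Union>i. B i))"
    proof (rule approx_dominated(1)[where h="\<lambda>_. 1" and g="\<lambda>n. indicator (U n)"])
      show "(\<lambda>n. indicator (U n) x) \<longlonglongrightarrow> (indicator (\<Union>i. B i) x :: real)" for x
        using LIMSEQ_indicator_UN[of B x] by (simp add: U_def)
    qed (use U ind_bd A_one sq_A in \<open>auto intro!: borel_measurable_indicator\<close>)
    then show ?case using Union.IH by auto
  qed
qed

lemma approx_simple: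
  assumes "\<And>S. S \<in> sets M \<Longrightarrow> approx (indicator S)" "simple_function M f"
  shows "approx f"
proof -
  have ind_bd: "\<bar>indicator S x :: real\<bar> \<le> 1" for S :: "'a set" and x by (simp add: indicator_def)
  have fin: "finite (f ` space M)" using assms(2) by (simp add: simple_function_def)
  have S: "f -` {y} \<inter> space M \<in> sets M" if "y \<in> f ` space M" for y
    using assms(2) that by (auto simp: simple_function_def)
  have "approx (\<lambda>x. \<Sum>y\<in>I. y * indicator (f -` {y} \<inter> space M) x) \<and> sq (\<lambda>x. \<Sum>y\<in>I. y * indicator (f -` {y} \<inter> space M) x)"
    if "finite I" "I \<subseteq> f ` space M" for I
    using that
  proof (induction I rule: finite_induct)
    case empty
    then show ?case using approx_A[OF A_cmult[OF A_one, of 0]] sq_A[OF A_cmult[OF A_one, of 0]] by simp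
  next
    case (insert y I)
    then have y: "sq (\<lambda>x. y * indicator (f -` {y} \<inter> space M) x)"
      "approx (\<lambda>x. y * indicator (f -` {y} \<inter> space M) x)"
      using S[of y] assms(1) ind_bd by (auto intro!: sq_cmult approx_cmult sq_bounded[where C=1])
    show ?case unfolding sum.insert[OF insert(1,2)]
      using insert.IH insert.prems y by (intro conjI approx_add sq_add) blast+
  qed
  from this[OF fin] have *: "approx (\<lambda>x. \<Sum>y\<in>f ` space M. y * indicator (f -` {y} \<inter> space M) x)" by simp
  have eq: "(\<Sum>y\<in>f ` space M. y * indicator (f -` {y} \<inter> space M) x) = f x" if "x \<in> space M" for x
    using that fin by (simp add: indicator_def if_distrib[of "\<lambda>a. _ * a"] sum.delta' cong: if_cong)
  have "Q (\<lambda>x. (\<Sum>y\<in>f ` space M. y * indicator (f -` {y} \<inter> space M) x) - a x) = Q (\<lambda>x. f x - a x)" for a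
    unfolding Q_def by (intro arg_cong2[where f="(+)"] Bochner_Integration.integral_cong)
        (auto simp: eq space_N)
  with * show ?thesis by (simp add: approx_def)
qed

theorem approx_square_integrable:
  assumes G: "sets M = sigma_sets (space M) G" "\<And>S. S \<in> G \<Longrightarrow> approx (indicator S)"
    and f: "sq f"
  shows "approx f"
proof -
  have "G \<subseteq> sets M" using G(1) by auto
  then have ind: "approx (indicator S)" if "S \<in> sets M" for S
    using approx_indicator_sigma[OF _ G(2)] that G(1) by blast
  \<comment> \<open>These simple functions satisfy |s i| \<le> 2 |f|, which supplies the dominating
    function.\<close>
  obtain s where s: "\<forall>i. simple_function M (s i)" "\<forall>x\<in>space M. (\<lambda>i. s i x) \<longlonglongrightarrow> f x"
    "\<forall>i. \<forall>x\<in>space M. dist (s i x) 0 \<le> 2 * dist (f x) 0"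
    using borel_measurable_implies_sequence_metric[OF sq_measurable[OF f], of 0] by blast
  show ?thesis
  proof (rule approx_dominated(1)[where h="\<lambda>x. 2 * \<bar>f x\<bar>" and g=s])
    show "sq (\<lambda>x. 2 * \<bar>f x\<bar>)" using f by (auto simp: sq_def square_integrable_def power_mult_distrib)
  qed (use s ind in \<open>auto intro: approx_simple borel_measurable_simple_function\<close>)
qed

end

section \<open>Mixing for transformations of Gaussian spaces\<close>

text \<open>The phase \<open>c\<close> covers sines, and closure under products is derived from the
  addition theorem instead of being a rule. An induction thus meets only single cosines and linear
  operations.\<close>

inductive_set trig_span :: "('a \<Rightarrow> real) set \<Rightarrow> ('a \<Rightarrow> real) set" for V where
  cos: "X \<in> V \<Longrightarrow> (\<lambda>w. cos (X w + c)) \<in> trig_span V"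
| add: "f \<in> trig_span V \<Longrightarrow> g \<in> trig_span V \<Longrightarrow> (\<lambda>w. f w + g w) \<in> trig_span V"
| cmult: "f \<in> trig_span V \<Longrightarrow> (\<lambda>w. a * f w) \<in> trig_span V"

locale trig_dense =
  fixes M N :: "'a measure" and V :: "('a \<Rightarrow> real) set"
  assumes finite_M: "finite_measure M" and finite_N: "finite_measure N"
    and sets_N: "sets N = sets M"
    and V_measurable: "X \<in> V \<Longrightarrow> X \<in> borel_measurable M"
    and V_zero: "(\<lambda>_. 0) \<in> V"
    and V_add: "X \<in> V \<Longrightarrow> Y \<in> V \<Longrightarrow> (\<lambda>w. X w + Y w) \<in> V"
    and V_cmult: "X \<in> V \<Longrightarrow> (\<lambda>w. c * X w) \<in> V"
begin

lemma V_diff: "X \<in> V \<Longrightarrow> Y \<in> V \<Longrightarrow> (\<lambda>w. X w - Y w) \<in> V"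
  using V_add[OF _ V_cmult[of Y "-1"], of X] by simp

lemma trig_span_mult:
  assumes "f \<in> trig_span V" "g \<in> trig_span V"
  shows "(\<lambda>w. f w * g w) \<in> trig_span V"
  using assms(1)
proof induction
  case (cos X c)
  show ?case using assms(2)
  proof induction
    case (cos Y d)
    have "(\<lambda>w. (1/2) * cos ((X w - Y w) + (c - d)) + (1/2) * cos ((X w + Y w) + (c + d))) \<in> trig_span V"
      by (intro trig_span.intros V_add V_diff \<open>X \<in> V\<close> cos)
    then show ?case by (simp add: cos_times_cos algebra_simps add_divide_distrib)
  next
    case (add f g) then show ?case by (simp add: distrib_left trig_span.add)
  next
    case (cmult f a) then show ?case using trig_span.cmult by (simp add: mult.left_commute)
  qed
next
  case (add f g) then show ?case by (simp add: distrib_right trig_span.add)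
next
  case (cmult f a) then show ?case using trig_span.cmult by (simp add: mult.assoc)
qed

lemma trig_span_one: "(\<lambda>_. 1) \<in> trig_span V"
  using trig_span.cos[OF V_zero, of 0] by simp

lemma trig_span_measurable: "f \<in> trig_span V \<Longrightarrow> f \<in> borel_measurable M"
  by (induction rule: trig_span.induct) (auto dest: V_measurable)

lemma trig_span_bounded: "f \<in> trig_span V \<Longrightarrow> \<exists>C. \<forall>x. \<bar>f x\<bar> \<le> C"
proof (induction rule: trig_span.induct)
  case (cos X c) then show ?case by (intro exI[of _ 1]) simp
next
  case (add f g)
  then obtain C D where "\<forall>x. \<bar>f x\<bar> \<le> C" "\<forall>x. \<bar>g x\<bar> \<le> D" by blast
  then show ?case by (intro exI[of _ "C + D"]) (meson abs_triangle_ineq add_mono order_trans)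
next
  case (cmult f a)
  then obtain C where "\<forall>x. \<bar>f x\<bar> \<le> C" by blast
  then show ?case by (intro exI[of _ "\<bar>a\<bar> * C"]) (auto simp: abs_mult intro!: mult_left_mono)
qed

sublocale L2_dense_algebra M N "trig_span V"
proof (rule L2_dense_algebra.intro)
  show "\<exists>C. \<forall>x\<in>space M. \<bar>a x\<bar> \<le> C" if "a \<in> trig_span V" for a
    using trig_span_bounded[OF that] by blast
qed (fact finite_M finite_N sets_N trig_span_measurable trig_span_mult trig_span_one
    trig_span.add trig_span.cmult)+

text \<open>Polynomials in \<open>sin X\<close> belong to the algebra, hence continuous functions of \<open>n sin (X / n)\<close> are
  approximable, and these converge to functions of \<open>X\<close>.\<close>

lemma approx_continuous_sin:
  assumes X: "X \<in> V" and f: "continuous_on {-1..1} (f :: real \<Rightarrow> real)"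
  shows "approx (\<lambda>w. f (sin (X w)))"
proof -
  have sin: "(\<lambda>w. sin (X w)) \<in> trig_span V"
  proof -
    have "cos (x + (- (pi / 2))) = sin x" for x :: real unfolding cos_add by simp
    with trig_span.cos[OF X, of "- (pi / 2)"] show ?thesis by (simp only:)
  qed
  have poly: "(\<lambda>w. p (sin (X w))) \<in> trig_span V" if "real_polynomial_function p" for p
    using that
  proof induction
    case (linear p)
    have "p x = p 1 * x" for x
      using linear_scale[OF bounded_linear.linear[OF linear], of x 1] by (simp add: mult.commute)
    then have "(\<lambda>w. p (sin (X w))) = (\<lambda>w. p 1 * sin (X w))" by (intro ext)
    then show ?case using trig_span.cmult[OF sin, of "p 1"] by (simp only:)
  next
    case (const c)
    then show ?case using trig_span.cmult[OF trig_span_one, of c] by simp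
  qed (auto intro: trig_span.add trig_span_mult)
  have "\<forall>n. \<exists>p. real_polynomial_function p \<and> (\<forall>x\<in>{-1..1}. \<bar>f x - p x\<bar> < inverse (real (Suc n)))"
  proof
    fix n
    have pos: "inverse (real (Suc n)) > 0" by simp
    show "\<exists>p. real_polynomial_function p \<and> (\<forall>x\<in>{-1..1}. \<bar>f x - p x\<bar> < inverse (real (Suc n)))"
      by (rule Stone_Weierstrass_real_polynomial_function[OF compact_Icc f pos]) auto
  qed
  then obtain p where p: "\<And>n. real_polynomial_function (p n)"
    "\<And>n x. x \<in> {-1..1} \<Longrightarrow> \<bar>f x - p n x\<bar> < inverse (real (Suc n))"
    by metis
  have "\<exists>C. \<forall>x\<in>{-1..1}. \<bar>f x\<bar> \<le> C"
    using compact_imp_bounded[OF compact_continuous_image[OF f compact_Icc]]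
    by (simp add: bounded_iff)
  then obtain C where C: "\<And>x. x \<in> {-1..1} \<Longrightarrow> \<bar>f x\<bar> \<le> C" by blast
  show ?thesis
  proof (rule approx_dominated(1)[where h="\<lambda>_. C + 1" and g="\<lambda>n w. p n (sin (X w))"])
    show "sq (\<lambda>_. C + 1)" using sq_A[OF trig_span.cmult[OF trig_span_one, of "C + 1"]] by simp
    show "(\<lambda>w. p n (sin (X w))) \<in> borel_measurable M" for n using poly[OF p(1)] trig_span_measurable by blast
    show "approx (\<lambda>w. p n (sin (X w)))" for n by (rule approx_A[OF poly[OF p(1)]])
    show "\<bar>p n (sin (X w))\<bar> \<le> C + 1" for n w
    proof -
      have "inverse (real (Suc n)) \<le> 1" by (simp add: field_simps)
      then show ?thesis using p(2)[of "sin (X w)" n] C[of "sin (X w)"] by simp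
    qed
    show "(\<lambda>n. p n (sin (X w))) \<longlonglongrightarrow> f (sin (X w))" for w
    proof (rule LIM_zero_cancel, rule Lim_null_comparison)
      show "\<forall>\<^sub>F n in sequentially. norm (p n (sin (X w)) - f (sin (X w))) \<le> inverse (real (Suc n))"
        using p(2)[of "sin (X w)"] by (intro always_eventually allI) (simp add: abs_minus_commute less_imp_le)
      show "(\<lambda>n. inverse (real (Suc n))) \<longlonglongrightarrow> 0" by (rule LIMSEQ_inverse_real_of_nat)
    qed
  qed
qed

lemma approx_continuous:
  assumes X: "X \<in> V" and f: "continuous_on UNIV (f :: real \<Rightarrow> real)" "\<And>x. \<bar>f x\<bar> \<le> C"
  shows "approx (\<lambda>w. f (X w))"
proof (rule approx_dominated(1)[where h="\<lambda>_. C" and g="\<lambda>n w. f (real (Suc n) * sin (inverse (real (Suc n)) * X w))"])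
  show "sq (\<lambda>_. C)" using sq_A[OF trig_span.cmult[OF trig_span_one, of "C"]] by simp
  have [measurable]: "f \<in> borel_measurable borel" by (rule borel_measurable_continuous_onI[OF f(1)])
  have [measurable]: "X \<in> borel_measurable M" by (rule V_measurable[OF X])
  show "(\<lambda>w. f (real (Suc n) * sin (inverse (real (Suc n)) * X w))) \<in> borel_measurable M" for n
    by measurable
  show "approx (\<lambda>w. f (real (Suc n) * sin (inverse (real (Suc n)) * X w)))" for n
    by (rule approx_continuous_sin[OF V_cmult[OF X], of "\<lambda>y. f (real (Suc n) * y)"])
      (intro continuous_on_compose2[OF f(1)] continuous_intros subset_UNIV)
  show "(\<lambda>n. f (real (Suc n) * sin (inverse (real (Suc n)) * X w))) \<longlonglongrightarrow> f (X w)" for w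
  proof -
    \<comment> \<open>n sin (X / n) is the difference quotient at 0 of h \<mapsto> sin (X w h),
      taken at h = 1/n.\<close>
    have 1: "((\<lambda>h. sin (X w * h) / h) \<longlongrightarrow> X w) (at 0)"
    proof -
      have "((\<lambda>h. sin (X w * h)) has_real_derivative X w) (at 0)"
        by (auto intro!: derivative_eq_intros)
      then show ?thesis by (simp add: DERIV_def)
    qed
    have 2: "filterlim (\<lambda>n. inverse (real (Suc n))) (at 0) sequentially"
      using LIMSEQ_inverse_real_of_nat by (simp add: filterlim_at)
    have "(\<lambda>n. sin (X w * inverse (real (Suc n))) / inverse (real (Suc n))) \<longlonglongrightarrow> X w"
      by (rule filterlim_compose[OF 1 2])
    then have "(\<lambda>n. real (Suc n) * sin (inverse (real (Suc n)) * X w)) \<longlonglongrightarrow> X w"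
      by (simp add: mult.commute divide_inverse del: of_nat_Suc)
    moreover have "isCont f (X w)" using f(1) by (simp add: continuous_on_eq_continuous_at)
    ultimately show ?thesis by (rule isCont_tendsto_compose[rotated])
  qed
qed (use f(2) in auto)

text \<open>The ramps vanish for X w \<le> a and are eventually 1 for X w > a, so that their limit
  is the indicator of the strict inequality.\<close>

lemma approx_indicator_greater:
  assumes X: "X \<in> V"
  shows "approx (indicator {w\<in>space M. X w > a})"
proof (rule approx_dominated(1)[where h="\<lambda>_. 1" and g="\<lambda>n w. min 1 (real n * max 0 (X w - a))"])
  show "sq (\<lambda>_. 1)" by (rule sq_A[OF trig_span_one])
  have [measurable]: "X \<in> borel_measurable M" by (rule V_measurable[OF X])
  show "(\<lambda>w. min 1 (real n * max 0 (X w - a))) \<in> borel_measurable M" for n by measurable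
  show "approx (\<lambda>w. min 1 (real n * max 0 (X w - a)))" for n
    by (rule approx_continuous[OF X, of "\<lambda>x. min 1 (real n * max 0 (x - a))" 1])
      (intro continuous_on_min continuous_on_max continuous_intros, simp add: min_def)
  show "(\<lambda>n. min 1 (real n * max 0 (X w - a))) \<longlonglongrightarrow> indicator {w\<in>space M. X w > a} w"
    if "w \<in> space M" for w
  proof (cases "X w > a")
    case True
    obtain k :: nat where k: "1 / (X w - a) < real k" using reals_Archimedean2 by blast
    have "1 \<le> real n * max 0 (X w - a)" if "n \<ge> k" for n
    proof -
      have "1 / (X w - a) < real n" using k that by simp
      then show ?thesis using True by (simp add: field_simps)
    qed
    then have "\<forall>\<^sub>F n in sequentially. min 1 (real n * max 0 (X w - a)) = 1"
      by (intro eventually_sequentiallyI[of k]) auto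
    then show ?thesis using True that by (simp add: tendsto_eventually)
  qed (use that in auto)
qed (auto simp: min_def)

theorem approx_all:
  assumes "sets M = sigma_sets (space M) {{w\<in>space M. X w > a} | X a. X \<in> V}" "sq f"
  shows "approx f"
  by (rule approx_square_integrable[OF assms(1) _ assms(2)]) (auto intro: approx_indicator_greater)

end

section \<open>Correlations under a measure-preserving map of a Gaussian space\<close>

text \<open>\<open>V_cos\<close> is the characteristic function of a centred normal variable in real
  form: c = 0 gives its real part, c = - pi / 2 its imaginary part. As V is a linear space, this
  makes all finite families in V jointly Gaussian.\<close>

locale gaussian_transformation = prob_space M for M :: "'a measure" +
  fixes V :: "('a \<Rightarrow> real) set" and T :: "'a \<Rightarrow> 'a"
  assumes V_square: "X \<in> V \<Longrightarrow> square_integrable M X"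
    and V_zero: "(\<lambda>_. 0) \<in> V"
    and V_add: "X \<in> V \<Longrightarrow> Y \<in> V \<Longrightarrow> (\<lambda>w. X w + Y w) \<in> V"
    and V_cmult: "X \<in> V \<Longrightarrow> (\<lambda>w. c * X w) \<in> V"
    and V_cos: "X \<in> V \<Longrightarrow> (\<integral>w. cos (X w + c) \<partial>M) = cos c * exp (- (\<integral>w. (X w)\<^sup>2 \<partial>M) / 2)"
    and V_generates: "sets M = sigma_sets (space M) {{w\<in>space M. X w > a} | X a. X \<in> V}"
    and T_measurable: "T \<in> measurable M M"
    and T_preserving: "distr M M T = M"
    and V_T: "X \<in> V \<Longrightarrow> (\<lambda>w. X (T w)) \<in> V"
begin

sublocale trig_dense M M V
proof (rule trig_dense.intro)
  show "X \<in> borel_measurable M" if "X \<in> V" for X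
    using V_square[OF that] by (simp add: square_integrable_def)
qed (fact finite_measure_axioms refl V_zero V_add V_cmult)+

lemma Tn_measurable: "T ^^ n \<in> measurable M M"
  using measurable_compose_n[OF T_measurable] by blast

lemma Tn_preserving: "distr M M (T ^^ n) = M"
proof (induction n)
  case 0 then show ?case by (simp add: id_def distr_id)
next
  case (Suc n)
  have "distr M M (T ^^ Suc n) = distr (distr M M (T ^^ n)) M T"
    by (subst distr_distr[OF T_measurable Tn_measurable]) simp
  then show ?case using Suc T_preserving by (simp add: comp_def)
qed

lemma integral_Tn:
  fixes f :: "'a \<Rightarrow> real"
  assumes "f \<in> borel_measurable M"
  shows "(\<integral>w. f ((T ^^ n) w) \<partial>M) = (\<integral>w. f w \<partial>M)"
  using integral_distr[OF Tn_measurable[of n] assms] Tn_preserving[of n] by simp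

lemma V_Tn: "X \<in> V \<Longrightarrow> (\<lambda>w. X ((T ^^ n) w)) \<in> V"
proof (induction n arbitrary: X)
  case (Suc n)
  then show ?case using Suc.IH[OF V_T[OF Suc.prems]] by (simp del: funpow.simps add: funpow.simps(2))
qed simp

lemma square_integrable_Tn:
  assumes "square_integrable M f"
  shows "square_integrable M (\<lambda>w. f ((T ^^ n) w))"
proof (rule square_integrableI)
  show "(\<lambda>w. f ((T ^^ n) w)) \<in> borel_measurable M"
    using measurable_compose[OF Tn_measurable] square_integrableD[OF assms] by blast
  show "integrable M (\<lambda>w. (f ((T ^^ n) w))\<^sup>2)"
    using integrable_distr[OF Tn_measurable[of n], of "\<lambda>w. (f w)\<^sup>2"] Tn_preserving[of n]
      square_integrableD[OF assms] by simp
qed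

text \<open>For \<open>q = Y - Z\<close> with \<open>Z\<close> an almost nearest point to \<open>Y\<close> in the linear span of
  the orbit of \<open>X\<close>, the inner products of \<open>q\<close> with the orbit are uniformly small, while \<open>Z\<close>
  is a finite combination of members of the orbit.\<close>

lemma decorrelating_inner:
  assumes lim: "\<And>X. X \<in> V \<Longrightarrow> (\<lambda>n. \<integral>w. X ((T ^^ n) w) * X w \<partial>M) \<longlonglongrightarrow> 0"
    and X: "X \<in> V" and Y: "Y \<in> V"
  shows "(\<lambda>n. \<integral>w. X ((T ^^ n) w) * Y w \<partial>M) \<longlonglongrightarrow> 0"
proof -
  \<comment> \<open>In place of the span itself, S collects every Z in V for which the claim holds;
    what matters is that it contains 0 and is stable under adding multiples of the orbit.\<close>
  define S where "S = {Z\<in>V. (\<lambda>n. \<integral>w. X ((T ^^ n) w) * Z w \<partial>M) \<longlonglongrightarrow> 0}"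
  define r where "r Z = (\<integral>w. (Y w - Z w)\<^sup>2 \<partial>M)" for Z
  note sqV = V_square and mult = square_integrable_mult_integrable
  have S_step: "(\<lambda>w. Z w + c * X ((T ^^ m) w)) \<in> S" if Z: "Z \<in> S" for Z c m
  proof -
    have ZV: "Z \<in> V" using Z by (simp add: S_def)
    \<comment> \<open>Invariance removes the m common iterations and leaves the correlation of X
      with itself at lag n.\<close>
    have "(\<lambda>n. \<integral>w. X ((T ^^ (n + m)) w) * X ((T ^^ m) w) \<partial>M) \<longlonglongrightarrow> 0"
    proof -
      have "(\<integral>w. X ((T ^^ (n + m)) w) * X ((T ^^ m) w) \<partial>M) = (\<integral>w. X ((T ^^ n) w) * X w \<partial>M)" for n
        using integral_Tn[of "\<lambda>w. X ((T ^^ n) w) * X w" m]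
          measurable_compose[OF Tn_measurable V_measurable[OF X]] V_measurable[OF X]
        by (simp add: funpow_add)
      then show ?thesis using lim[OF X] by simp
    qed
    then have 1: "(\<lambda>n. \<integral>w. X ((T ^^ n) w) * X ((T ^^ m) w) \<partial>M) \<longlonglongrightarrow> 0"
      by (rule LIMSEQ_offset)
    have "(\<lambda>n. (\<integral>w. X ((T ^^ n) w) * Z w \<partial>M) + c * (\<integral>w. X ((T ^^ n) w) * X ((T ^^ m) w) \<partial>M)) \<longlonglongrightarrow> 0"
      using Z 1 by (auto simp: S_def intro!: tendsto_add_zero tendsto_mult_right_zero)
    moreover have "(\<integral>w. X ((T ^^ n) w) * (Z w + c * X ((T ^^ m) w)) \<partial>M) =
      (\<integral>w. X ((T ^^ n) w) * Z w \<partial>M) + c * (\<integral>w. X ((T ^^ n) w) * X ((T ^^ m) w) \<partial>M)" for n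
    proof -
      have "(\<integral>w. X ((T ^^ n) w) * (Z w + c * X ((T ^^ m) w)) \<partial>M) =
        (\<integral>w. X ((T ^^ n) w) * Z w + c * (X ((T ^^ n) w) * X ((T ^^ m) w)) \<partial>M)"
        by (simp add: algebra_simps)
      then show ?thesis using mult[OF sqV[OF V_Tn[OF X]] sqV[OF ZV], of n]
        mult[OF sqV[OF V_Tn[OF X]] sqV[OF V_Tn[OF X]], of n m] by simp
    qed
    ultimately show ?thesis using V_add[OF ZV V_cmult[OF V_Tn[OF X]], of c m] by (simp add: S_def)
  qed
  have S0: "(\<lambda>_. 0) \<in> S" by (simp add: S_def V_zero)
  have bdd: "bdd_below (r ` S)" by (rule bdd_belowI[of _ 0]) (auto simp: r_def)
  define d where "d = Inf (r ` S)"
  define K where "K = (\<integral>w. (X w)\<^sup>2 \<partial>M)"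
  have K: "K \<ge> 0" by (simp add: K_def)
  show ?thesis
  proof (rule LIMSEQ_I)
    fix \<epsilon> :: real assume e: "\<epsilon> > 0"
    \<comment> \<open>Chosen so that the bound b^2 < \<eta> (K + 1) below becomes |b| < \<epsilon> /
      2; K + 1 instead of K allows for K = 0.\<close>
    define \<eta> where "\<eta> = (\<epsilon> / 2)\<^sup>2 / (K + 1)"
    have eta: "\<eta> > 0" using e K by (auto simp: \<eta>_def intro!: divide_pos_pos)
    obtain Z where Z: "Z \<in> S" "r Z < d + \<eta>"
      using cInf_lessD[of "r ` S" "d + \<eta>"] S0 eta by (auto simp: d_def)
    have ZV: "Z \<in> V" using Z by (simp add: S_def)
    define q where "q w = Y w - Z w" for w
    have qV: "q \<in> V" using V_diff[OF Y ZV] by (simp add: q_def[abs_def])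
    have small: "\<bar>\<integral>w. X ((T ^^ m) w) * q w \<partial>M\<bar> \<le> \<epsilon> / 2" for m
    proof -
      define b where "b = (\<integral>w. X ((T ^^ m) w) * q w \<partial>M)"
      have Km: "(\<integral>w. (X ((T ^^ m) w))\<^sup>2 \<partial>M) = K"
        using integral_Tn[of "\<lambda>w. (X w)\<^sup>2" m] V_measurable[OF X] by (simp add: K_def)
      have d_le: "d \<le> r (\<lambda>w. Z w + c * X ((T ^^ m) w))" for c
        unfolding d_def using bdd S_step[OF Z(1)] by (intro cInf_lower) auto
      have r_eq: "r (\<lambda>w. Z w + c * X ((T ^^ m) w)) = r Z - 2 * c * b + c\<^sup>2 * K" for c
      proof -
        have "r (\<lambda>w. Z w + c * X ((T ^^ m) w)) = (\<integral>w. (q w + (- c) * X ((T ^^ m) w))\<^sup>2 \<partial>M)"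
          by (simp add: r_def q_def algebra_simps)
        also have "\<dots> = (\<integral>w. (q w)\<^sup>2 \<partial>M) + 2 * (\<integral>w. q w * ((- c) * X ((T ^^ m) w)) \<partial>M) + (\<integral>w. ((- c) * X ((T ^^ m) w))\<^sup>2 \<partial>M)"
          by (rule integral_power2_add[OF sqV[OF qV] square_integrable_cmult[OF sqV[OF V_Tn[OF X]]]])
        also have "(\<integral>w. q w * ((- c) * X ((T ^^ m) w)) \<partial>M) = (\<integral>w. (- c) * (X ((T ^^ m) w) * q w) \<partial>M)"
          by (simp add: mult_ac)
        also have "\<dots> = (- c) * b" unfolding b_def by (rule integral_mult_right_zero)
        also have "(\<integral>w. ((- c) * X ((T ^^ m) w))\<^sup>2 \<partial>M) = c\<^sup>2 * K"
          by (simp add: power_mult_distrib Km)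
        finally show ?thesis by (simp add: r_def q_def)
      qed
      \<comment> \<open>As r Z is within \<eta> of the infimum, no step in the direction of the
        orbit lowers r by \<eta> or more.\<close>
      have *: "2 * c * b - c\<^sup>2 * K < \<eta>" for c using d_le[of c] r_eq[of c] Z(2) by linarith
      have "b\<^sup>2 < \<eta> * (K + 1)"
      proof -
        \<comment> \<open>A substitute for the optimal step b / K that makes sense for K = 0
          too.\<close>
        define u where "u = b / (K + 1)"
        have b: "b = u * (K + 1)" using K by (simp add: u_def)
        have "u * b = 2 * u * b - u\<^sup>2 * (K + 1)" by (simp add: b power2_eq_square)
        also have "\<dots> \<le> 2 * u * b - u\<^sup>2 * K" by (intro diff_left_mono mult_left_mono) auto
        also have "\<dots> < \<eta>" by (rule *)
        finally have "u * b * (K + 1) < \<eta> * (K + 1)" using K by (intro mult_strict_right_mono) auto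
        then show ?thesis by (simp add: b power2_eq_square mult_ac)
      qed
      also have "\<eta> * (K + 1) = (\<epsilon> / 2)\<^sup>2" using K by (simp add: \<eta>_def)
      finally have "\<bar>b\<bar>\<^sup>2 < (\<epsilon> / 2)\<^sup>2" by simp
      then have "\<bar>b\<bar> < \<epsilon> / 2" by (rule power2_less_imp_less) (use e in simp)
      then show ?thesis using e by (simp add: b_def)
    qed
    have "(\<lambda>n. \<integral>w. X ((T ^^ n) w) * Z w \<partial>M) \<longlonglongrightarrow> 0" using Z by (simp add: S_def)
    from LIMSEQ_D[OF this, of "\<epsilon> / 2"] e obtain n0 where
      n0: "\<And>n. n \<ge> n0 \<Longrightarrow> \<bar>\<integral>w. X ((T ^^ n) w) * Z w \<partial>M\<bar> < \<epsilon> / 2" by auto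
    have "norm ((\<integral>w. X ((T ^^ n) w) * Y w \<partial>M) - 0) < \<epsilon>" if "n \<ge> n0" for n
    proof -
      have "(\<integral>w. X ((T ^^ n) w) * Y w \<partial>M) = (\<integral>w. X ((T ^^ n) w) * Z w + X ((T ^^ n) w) * q w \<partial>M)"
        by (simp add: q_def algebra_simps)
      also have "\<dots> = (\<integral>w. X ((T ^^ n) w) * Z w \<partial>M) + (\<integral>w. X ((T ^^ n) w) * q w \<partial>M)"
        using mult[OF sqV[OF V_Tn[OF X]] sqV[OF ZV], of n] mult[OF sqV[OF V_Tn[OF X]] sqV[OF qV], of n]
        by simp
      finally show ?thesis using n0[OF that] small[of n] unfolding real_norm_def by linarith
    qed
    then show "\<exists>no. \<forall>n\<ge>no. norm ((\<integral>w. X ((T ^^ n) w) * Y w \<partial>M) - 0) < \<epsilon>" by blast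
  qed
qed

lemma mixing_cos:
  assumes lim: "\<And>X. X \<in> V \<Longrightarrow> (\<lambda>n. \<integral>w. X ((T ^^ n) w) * X w \<partial>M) \<longlonglongrightarrow> 0"
    and X: "X \<in> V" and Y: "Y \<in> V"
  shows "(\<lambda>n. \<integral>w. cos (X ((T ^^ n) w) + c) * cos (Y w + d) \<partial>M)
    \<longlonglongrightarrow> (\<integral>w. cos (X w + c) \<partial>M) * (\<integral>w. cos (Y w + d) \<partial>M)"
proof -
  define a b where "a = (\<integral>w. (X w)\<^sup>2 \<partial>M)" and "b = (\<integral>w. (Y w)\<^sup>2 \<partial>M)"
  define r where "r n = (\<integral>w. X ((T ^^ n) w) * Y w \<partial>M)" for n
  note XV = V_Tn[OF X]
  have Xn: "(\<integral>w. (X ((T ^^ n) w))\<^sup>2 \<partial>M) = a" for n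
    using integral_Tn[of "\<lambda>w. (X w)\<^sup>2" n] V_measurable[OF X] by (simp add: a_def)
  have plus: "(\<integral>w. (X ((T ^^ n) w) + Y w)\<^sup>2 \<partial>M) = a + 2 * r n + b" for n
    using integral_power2_add[OF V_square[OF XV] V_square[OF Y], of n] Xn by (simp add: r_def b_def)
  have minus: "(\<integral>w. (X ((T ^^ n) w) - Y w)\<^sup>2 \<partial>M) = a - 2 * r n + b" for n
    using integral_power2_add[OF V_square[OF XV] square_integrable_cmult[OF V_square[OF Y]], of n "-1"] Xn
    by (simp add: r_def b_def)
  have int: "integrable M (\<lambda>w. cos (Z w + e))" if "Z \<in> V" for Z e
    using V_measurable[OF that] by (intro integrable_const_bound[where B=1]) auto
  have eq: "(\<integral>w. cos (X ((T ^^ n) w) + c) * cos (Y w + d) \<partial>M)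
    = (cos (c - d) * exp (- (a - 2 * r n + b) / 2) + cos (c + d) * exp (- (a + 2 * r n + b) / 2)) / 2" for n
  proof -
    have "(\<integral>w. cos (X ((T ^^ n) w) + c) * cos (Y w + d) \<partial>M)
      = (\<integral>w. (cos ((X ((T ^^ n) w) - Y w) + (c - d)) + cos ((X ((T ^^ n) w) + Y w) + (c + d))) / 2 \<partial>M)"
    proof -
      have "cos (x + c) * cos (y + d) = (cos ((x - y) + (c - d)) + cos ((x + y) + (c + d))) / 2" for x y
      proof -
        have "(x - y) + (c - d) = (x + c) - (y + d)" "(x + y) + (c + d) = (x + c) + (y + d)" by simp_all
        then show ?thesis by (simp only: cos_times_cos)
      qed
      then show ?thesis by (simp only:)
    qed
    also have "\<dots> = ((\<integral>w. cos ((X ((T ^^ n) w) - Y w) + (c - d)) \<partial>M) + (\<integral>w. cos ((X ((T ^^ n) w) + Y w) + (c + d)) \<partial>M)) / 2"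
      using int[OF V_diff[OF XV Y]] int[OF V_add[OF XV Y]] by simp
    finally show ?thesis unfolding V_cos[OF V_diff[OF XV Y]] V_cos[OF V_add[OF XV Y]] plus minus .
  qed
  have "r \<longlonglongrightarrow> 0" unfolding r_def by (rule decorrelating_inner[OF lim X Y])
  then have "(\<lambda>n. \<integral>w. cos (X ((T ^^ n) w) + c) * cos (Y w + d) \<partial>M)
    \<longlonglongrightarrow> (cos (c - d) * exp (- (a - 2 * 0 + b) / 2) + cos (c + d) * exp (- (a + 2 * 0 + b) / 2)) / 2"
    unfolding eq by (intro tendsto_intros) auto
  \<comment> \<open>At r = 0 both exponentials are exp (- (a + b) / 2), and cos (c - d) + cos (c +
    d) = 2 cos c cos d.\<close>
  also have "(cos (c - d) * exp (- (a - 2 * 0 + b) / 2) + cos (c + d) * exp (- (a + 2 * 0 + b) / 2)) / 2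
     = (cos c * exp (- a / 2)) * (cos d * exp (- b / 2))"
  proof -
    have "exp (- (a + b) / 2) = exp (- a / 2) * exp (- b / 2)"
      by (simp add: exp_add[symmetric] add_divide_distrib)
    then show ?thesis by (simp add: cos_diff cos_add algebra_simps)
  qed
  finally show ?thesis by (simp add: V_cos X Y a_def b_def)
qed

text \<open>Both sides are bilinear in f and g, which reduces the claim to single cosines.\<close>

lemma mixing_trig_span:
  assumes lim: "\<And>X. X \<in> V \<Longrightarrow> (\<lambda>n. \<integral>w. X ((T ^^ n) w) * X w \<partial>M) \<longlonglongrightarrow> 0"
    and f: "f \<in> trig_span V" and g: "g \<in> trig_span V"
  shows "(\<lambda>n. \<integral>w. f ((T ^^ n) w) * g w \<partial>M) \<longlonglongrightarrow> (\<integral>w. f w \<partial>M) * (\<integral>w. g w \<partial>M)"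
proof -
  have sq: "square_integrable M h" if "h \<in> trig_span V" for h
    using sq_A[OF that] by (simp add: sq_def)
  have int: "integrable M h" if "h \<in> trig_span V" for h
    by (rule square_integrable_integrable[OF finite_M sq[OF that]])
  have int2: "integrable M (\<lambda>w. h ((T ^^ n) w) * k w)" if "h \<in> trig_span V" "k \<in> trig_span V" for h k n
    by (rule square_integrable_mult_integrable[OF square_integrable_Tn[OF sq[OF that(1)]] sq[OF that(2)]])
  show ?thesis using f
  proof induction
    case (cos X c)
    define F where "F w = cos (X w + c)" for w
    have F: "F \<in> trig_span V" unfolding F_def[abs_def] by (rule trig_span.cos[OF cos])
    have "(\<lambda>n. \<integral>w. F ((T ^^ n) w) * g w \<partial>M) \<longlonglongrightarrow> (\<integral>w. F w \<partial>M) * (\<integral>w. g w \<partial>M)"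
      using g
    proof induction
      case (cos Y d)
      show ?case unfolding F_def by (rule mixing_cos[OF lim \<open>X \<in> V\<close> cos])
    next
      case (add g h)
      have "(\<integral>w. F ((T ^^ n) w) * (g w + h w) \<partial>M)
        = (\<integral>w. F ((T ^^ n) w) * g w \<partial>M) + (\<integral>w. F ((T ^^ n) w) * h w \<partial>M)" for n
        unfolding distrib_left by (intro Bochner_Integration.integral_add int2 F add.hyps)
      moreover have "(\<integral>w. g w + h w \<partial>M) = (\<integral>w. g w \<partial>M) + (\<integral>w. h w \<partial>M)"
        by (intro Bochner_Integration.integral_add int add.hyps)
      ultimately show ?case using tendsto_add[OF add.IH] by (simp only: distrib_left)
    next
      case (cmult g a)
      have "(\<integral>w. F ((T ^^ n) w) * (a * g w) \<partial>M) = a * (\<integral>w. F ((T ^^ n) w) * g w \<partial>M)" for n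
        unfolding mult.left_commute[of _ a] by simp
      then show ?case using tendsto_mult_left[OF cmult.IH, of a] by (simp add: mult.left_commute)
    qed
    then show ?case by (simp only: F_def)
  next
    case (add f h)
    have "(\<integral>w. (f ((T ^^ n) w) + h ((T ^^ n) w)) * g w \<partial>M)
      = (\<integral>w. f ((T ^^ n) w) * g w \<partial>M) + (\<integral>w. h ((T ^^ n) w) * g w \<partial>M)" for n
      unfolding distrib_right by (intro Bochner_Integration.integral_add int2 g add.hyps)
    moreover have "(\<integral>w. f w + h w \<partial>M) = (\<integral>w. f w \<partial>M) + (\<integral>w. h w \<partial>M)"
      by (intro Bochner_Integration.integral_add int add.hyps)
    ultimately show ?case using tendsto_add[OF add.IH] by (simp only: distrib_right)
  next
    case (cmult f a)
    then show ?case using tendsto_mult_left[OF cmult.IH, of a] by (simp add: mult.assoc)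
  qed
qed

text \<open>Write f = a + g with a trigonometric and g small in L2. The limit is known for the
  correlation of a with itself; the terms with g are small uniformly in n, because composition with
  T^n preserves L2 norms.\<close>

theorem mixing_if_decorrelating:
  assumes lim: "\<And>X. X \<in> V \<Longrightarrow> (\<lambda>n. \<integral>w. X ((T ^^ n) w) * X w \<partial>M) \<longlonglongrightarrow> 0"
  shows "mixing M T"
  unfolding mixing_def
proof (intro allI impI, elim conjE)
  fix f assume f: "square_integrable M f" and mean: "(\<integral>x. f x \<partial>M) = 0"
  have "approx f" by (rule approx_all[OF V_generates]) (simp add: sq_def f)
  define F where "F = sqrt (\<integral>w. (f w)\<^sup>2 \<partial>M)"
  have F: "F \<ge> 0" by (simp add: F_def)
  show "(\<lambda>n. \<integral>x. f ((T ^^ n) x) * f x \<partial>M) \<longlonglongrightarrow> 0"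
  proof (rule LIMSEQ_I)
    fix e :: real assume e: "e > 0"
    \<comment> \<open>The errors below add up to less than \<delta> (2 F + 3). The cap 1 serves the
      bounds F + 1 for the norm of a and \<delta>^2 < 2 \<delta>.\<close>
    define \<delta> where "\<delta> = min 1 (e / (2 * F + 4))"
    have d: "\<delta> > 0" "\<delta> \<le> 1" "\<delta> * (2 * F + 4) \<le> e"
    proof -
      have "2 * F + 4 > 0" using F by simp
      then show "\<delta> > 0" "\<delta> \<le> 1" using e by (simp_all add: \<delta>_def)
      have "\<delta> \<le> e / (2 * F + 4)" by (simp add: \<delta>_def)
      then show "\<delta> * (2 * F + 4) \<le> e" using \<open>2 * F + 4 > 0\<close> by (simp add: pos_le_divide_eq)
    qed
    obtain a where a: "a \<in> trig_span V" "Q (\<lambda>x. f x - a x) < \<delta>\<^sup>2"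
      using \<open>approx f\<close> d(1) unfolding approx_def by (meson zero_less_power)
    have sa: "square_integrable M a" using sq_A[OF a(1)] by (simp add: sq_def)
    define g where "g w = f w - a w" for w
    have sg: "square_integrable M g" unfolding g_def[abs_def] by (rule square_integrable_diff[OF f sa])
    have "(\<integral>w. (g w)\<^sup>2 \<partial>M) \<le> \<delta>\<^sup>2"
    proof -
      have "0 \<le> (\<integral>w. (g w)\<^sup>2 \<partial>M)" by simp
      then show ?thesis using a(2) unfolding Q_def g_def by linarith
    qed
    then have g: "sqrt (\<integral>w. (g w)\<^sup>2 \<partial>M) \<le> \<delta>"
      using d(1) by (intro real_le_lsqrt) auto
    have Tn: "(\<integral>w. (h ((T ^^ n) w))\<^sup>2 \<partial>M) = (\<integral>w. (h w)\<^sup>2 \<partial>M)" if "square_integrable M h" for h n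
      using integral_Tn[of "\<lambda>w. (h w)\<^sup>2" n] square_integrableD(1)[OF that] by simp
    have "sqrt (\<integral>w. (a w)\<^sup>2 \<partial>M) \<le> F + \<delta>"
    proof -
      have "f w + (-1) * g w = a w" for w by (simp add: g_def)
      moreover have "((-1) * g w)\<^sup>2 = (g w)\<^sup>2" for w by (simp add: power_mult_distrib)
      ultimately show ?thesis
        using integral_power2_triangle[OF f square_integrable_cmult[OF sg, of "-1"]] g
        unfolding F_def by simp
    qed
    then have A: "sqrt (\<integral>w. (a w)\<^sup>2 \<partial>M) \<le> F + 1" using d by simp
    have t1: "\<bar>\<integral>w. g ((T ^^ n) w) * f w \<partial>M\<bar> \<le> \<delta> * F" for n
      using Cauchy_Schwarz_integral[OF square_integrable_Tn[OF sg] f, of n] Tn[OF sg, of n]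
        mult_right_mono[OF g F] by (simp add: F_def)
    have t2: "\<bar>\<integral>w. a ((T ^^ n) w) * g w \<partial>M\<bar> \<le> (F + 1) * \<delta>" for n
      using Cauchy_Schwarz_integral[OF square_integrable_Tn[OF sa] sg, of n] Tn[OF sa, of n]
        mult_mono[OF A g] F by simp
    \<comment> \<open>The approximation a need not be centred, but f is; so the limit (E a)^2 of its
      correlations is at most \<delta>^2.\<close>
    have mean_a: "\<bar>\<integral>w. a w \<partial>M\<bar> \<le> \<delta>"
    proof -
      have "(\<integral>w. a w \<partial>M) = - (\<integral>w. g w \<partial>M)"
        using mean square_integrable_integrable[OF finite_M f] square_integrable_integrable[OF finite_M sa]
        by (simp add: g_def)
      moreover have "\<bar>\<integral>w. g w * 1 \<partial>M\<bar> \<le> sqrt (\<integral>w. (g w)\<^sup>2 \<partial>M) * sqrt (\<integral>w. 1\<^sup>2 \<partial>M)"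
        by (rule Cauchy_Schwarz_integral[OF sg square_integrable_bounded[OF finite_M, of _ 1]]) auto
      ultimately show ?thesis using g by (simp add: prob_space)
    qed
    have "(\<integral>w. a w \<partial>M) * (\<integral>w. a w \<partial>M) \<le> \<delta> * \<delta>"
      using mult_mono[OF mean_a mean_a] d by (simp add: abs_mult_self_eq)
    also have "\<dots> < 2 * \<delta>" using d mult_left_le[of \<delta> \<delta>] by simp
    finally have lt: "(\<integral>w. a w \<partial>M) * (\<integral>w. a w \<partial>M) < 2 * \<delta>" .
    have ge: "- (2 * \<delta>) < (\<integral>w. a w \<partial>M) * (\<integral>w. a w \<partial>M)"
      using d zero_le_square[of "\<integral>w. a w \<partial>M"] by linarith
    have L: "(\<lambda>n. \<integral>w. a ((T ^^ n) w) * a w \<partial>M) \<longlonglongrightarrow> (\<integral>w. a w \<partial>M) * (\<integral>w. a w \<partial>M)"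
      by (rule mixing_trig_span[OF lim a(1) a(1)])
    have "\<forall>\<^sub>F n in sequentially. \<bar>\<integral>w. a ((T ^^ n) w) * a w \<partial>M\<bar> < 2 * \<delta>"
      using order_tendstoD(1)[OF L ge] order_tendstoD(2)[OF L lt]
      by eventually_elim (simp add: abs_less_iff)
    then obtain n0 where n0: "\<And>n. n \<ge> n0 \<Longrightarrow> \<bar>\<integral>w. a ((T ^^ n) w) * a w \<partial>M\<bar> < 2 * \<delta>"
      by (auto simp: eventually_sequentially)
    have "norm ((\<integral>x. f ((T ^^ n) x) * f x \<partial>M) - 0) < e" if "n \<ge> n0" for n
    proof -
      note i = square_integrable_mult_integrable
      have "(\<integral>x. f ((T ^^ n) x) * f x \<partial>M)
        = (\<integral>w. g ((T ^^ n) w) * f w + (a ((T ^^ n) w) * g w + a ((T ^^ n) w) * a w) \<partial>M)"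
        by (simp add: g_def algebra_simps)
      also have "\<dots> = (\<integral>w. g ((T ^^ n) w) * f w \<partial>M) + ((\<integral>w. a ((T ^^ n) w) * g w \<partial>M) + (\<integral>w. a ((T ^^ n) w) * a w \<partial>M))"
        using i[OF square_integrable_Tn[OF sg] f, of n] i[OF square_integrable_Tn[OF sa] sg, of n]
          i[OF square_integrable_Tn[OF sa] sa, of n] by simp
      finally have "\<bar>\<integral>x. f ((T ^^ n) x) * f x \<partial>M\<bar> < \<delta> * F + (F + 1) * \<delta> + 2 * \<delta>"
        using t1[of n] t2[of n] n0[OF that] by linarith
      also have "\<dots> \<le> \<delta> * (2 * F + 4)" using d(1) by (simp add: algebra_simps)
      finally show ?thesis using d(3) by simp
    qed
    then show "\<exists>no. \<forall>n\<ge>no. norm ((\<integral>x. f ((T ^^ n) x) * f x \<partial>M) - 0) < e" by blast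
  qed
qed

end

section \<open>Absolutely continuous functions\<close>

text \<open>The measure \<nu> with density u gives no mass to A = {u = 0}, so A has an open
  neighbourhood V with \<nu>(V) small. Each bad point is the centre of arbitrarily short intervals
  in V that carry much \<nu>-mass relative to their length. By Vitali's theorem disjoint ones cover
  the bad set up to a null set, and their total length is at most (2 / \<epsilon>) \<nu>(V).\<close>

lemma AE_vanishing_average:
  fixes u :: "real \<Rightarrow> real"
  assumes u: "integrable lborel u" "\<And>x. u x \<ge> 0" and e: "\<epsilon> > 0"
  shows "negligible {x. u x = 0 \<and> (\<forall>\<delta>>0. \<exists>r. 0 < r \<and> r < \<delta> \<and> set_lebesgue_integral lborel (cball x r) u > \<epsilon> * r)}"
    (is "negligible ?B")
proof -
  define \<nu> where "\<nu> = density lborel (\<lambda>x. ennreal (u x))"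
  have mu[measurable]: "u \<in> borel_measurable borel" using u(1) by simp
  have \<nu>: "emeasure \<nu> S = ennreal (set_lebesgue_integral lborel S u)" if "S \<in> sets borel" for S
  proof -
    have "emeasure \<nu> S = (\<integral>\<^sup>+x. ennreal (indicator S x * u x) \<partial>lborel)"
      using that by (simp add: \<nu>_def emeasure_density ennreal_mult'' ennreal_indicator mult.commute)
    also have "\<dots> = ennreal (set_lebesgue_integral lborel S u)"
      using that u integrable_mult_indicator[OF _ u(1), of S] unfolding set_lebesgue_integral_def
      by (subst nn_integral_eq_integral) auto
    finally show ?thesis .
  qed
  have sets_\<nu>: "sets \<nu> = sets borel" and space_\<nu>: "space \<nu> = UNIV" by (simp_all add: \<nu>_def)
  have fin: "emeasure \<nu> (space \<nu>) \<noteq> \<infinity>" using \<nu>[of UNIV] by (simp add: space_\<nu>)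
  define A where "A = {x. u x = 0}"
  have A: "A \<in> sets borel" unfolding A_def by measurable
  have \<nu>A: "emeasure \<nu> A = 0"
  proof -
    have "(\<lambda>x. indicator A x *\<^sub>R u x) = (\<lambda>_. 0)" by (auto simp: A_def indicator_def)
    then have "set_lebesgue_integral lborel A u = 0" unfolding set_lebesgue_integral_def by simp
    then show ?thesis using \<nu>[OF A] by simp
  qed
  have "\<exists>T. ?B \<subseteq> T \<and> T \<in> lmeasurable \<and> measure lebesgue T \<le> e" if "e > 0" for e
  proof -
    \<comment> \<open>An interval of radius r has length 2 r and \<nu>-mass above \<epsilon> r; the
      bound \<epsilon> e / 2 cancels the resulting factor 2 / \<epsilon>.\<close>
    have "(INF U\<in>{U. A \<subseteq> U \<and> open U}. emeasure \<nu> U) < ennreal (\<epsilon> * e / 2)"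
      using outer_regular[OF sets_\<nu> fin A] \<nu>A that e by simp
    then obtain V where V: "A \<subseteq> V" "open V" "emeasure \<nu> V < ennreal (\<epsilon> * e / 2)"
      by (auto simp: INF_less_iff)
    define K where "K = {(x, r). x \<in> ?B \<and> 0 < r \<and> cball x r \<subseteq> V \<and>
      set_lebesgue_integral lborel (cball x r) u > \<epsilon> * r}"
    obtain C where C: "countable C" "C \<subseteq> K"
      "pairwise (\<lambda>i j. disjnt (cball (fst i) (snd i)) (cball (fst j) (snd j))) C"
      "negligible (?B - (\<Union>i\<in>C. cball (fst i) (snd i)))"
    proof (rule Vitali_covering_theorem_cballs[of K snd ?B fst])
      show "0 < snd i" if "i \<in> K" for i using that by (auto simp: K_def)
      fix x d :: real assume x: "x \<in> ?B" and d: "0 < d"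
      then have "x \<in> V" using V(1) by (auto simp: A_def)
      then obtain s where s: "s > 0" "cball x s \<subseteq> V" using V(2) open_contains_cball by blast
      have "\<forall>\<delta>>0. \<exists>r. 0 < r \<and> r < \<delta> \<and> set_lebesgue_integral lborel (cball x r) u > \<epsilon> * r"
        using x by simp
      moreover have "min d s > 0" using d s(1) by simp
      ultimately obtain r where r: "0 < r" "r < min d s" "set_lebesgue_integral lborel (cball x r) u > \<epsilon> * r"
        by blast
      have "cball x r \<subseteq> cball x s" using r by (intro subset_cball) auto
      then have "(x, r) \<in> K" using x r s by (auto simp: K_def)
      then show "\<exists>i. i \<in> K \<and> x \<in> cball (fst i) (snd i) \<and> snd i < d"
        using r by (intro exI[of _ "(x, r)"]) auto
    qed blast
    define T where "T = (\<Union>i\<in>C. cball (fst i) (snd i))"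
    have disj: "disjoint_family_on (\<lambda>i. cball (fst i) (snd i)) C"
      using C(3) by (auto simp: disjoint_family_on_def pairwise_def disjnt_def)
    have TV: "T \<subseteq> V" using C(2) by (force simp: T_def K_def)
    have "emeasure lborel T = (\<integral>\<^sup>+i. emeasure lborel (cball (fst i) (snd i)) \<partial>count_space C)"
      unfolding T_def by (rule emeasure_UN_countable[OF _ C(1) disj]) auto
    also have "\<dots> \<le> (\<integral>\<^sup>+i. ennreal (2 / \<epsilon>) * emeasure \<nu> (cball (fst i) (snd i)) \<partial>count_space C)"
    proof (rule nn_integral_mono)
      fix i assume "i \<in> space (count_space C)"
      then have i: "snd i > 0" "\<epsilon> * snd i < set_lebesgue_integral lborel (cball (fst i) (snd i)) u"
        using C(2) by (auto simp: K_def)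
      have "emeasure lborel (cball (fst i) (snd i)) = ennreal (2 * snd i)"
        using i by (simp add: cball_eq_atLeastAtMost)
      also have "\<dots> \<le> ennreal (2 / \<epsilon> * set_lebesgue_integral lborel (cball (fst i) (snd i)) u)"
        using i e by (intro ennreal_leI) (simp add: field_simps)
      also have "\<dots> = ennreal (2 / \<epsilon>) * emeasure \<nu> (cball (fst i) (snd i))"
        unfolding \<nu>[OF borel_closed[OF closed_cball]] using e by (intro ennreal_mult') simp
      finally show "emeasure lborel (cball (fst i) (snd i)) \<le> ennreal (2 / \<epsilon>) * emeasure \<nu> (cball (fst i) (snd i))" .
    qed
    also have "\<dots> = ennreal (2 / \<epsilon>) * (\<integral>\<^sup>+i. emeasure \<nu> (cball (fst i) (snd i)) \<partial>count_space C)"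
      by (rule nn_integral_cmult) auto
    also have "(\<integral>\<^sup>+i. emeasure \<nu> (cball (fst i) (snd i)) \<partial>count_space C) = emeasure \<nu> T"
      unfolding T_def by (rule emeasure_UN_countable[OF _ C(1) disj, symmetric]) (auto simp: sets_\<nu>)
    also have "emeasure \<nu> T \<le> emeasure \<nu> V" using TV V(2) by (intro emeasure_mono) (auto simp: sets_\<nu>)
    also have "\<dots> \<le> ennreal (\<epsilon> * e / 2)" using V(3) by simp
    also have "ennreal (2 / \<epsilon>) * ennreal (\<epsilon> * e / 2) = ennreal e"
      using e that by (simp add: ennreal_mult[symmetric])
    finally have le: "emeasure lborel T \<le> ennreal e" by (simp add: mult_left_mono)
    have Tb: "T \<in> sets borel" unfolding T_def by (intro sets.countable_UN'[OF C(1)]) auto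
    have eT: "emeasure lebesgue T \<le> ennreal e" using le Tb by simp
    then have Tm: "T \<in> lmeasurable" using Tb by (intro fmeasurableI) (auto simp: order_le_less_trans)
    have mT: "measure lebesgue T \<le> e" using eT Tm that
      by (simp add: emeasure_eq_measure2)
    have N: "?B - T \<in> lmeasurable" "measure lebesgue (?B - T) = 0"
      using C(4) unfolding T_def by (auto simp: negligible_imp_measurable negligible_imp_measure0)
    have "measure lebesgue (T \<union> (?B - T)) \<le> e"
      using measure_Un_le[of T lebesgue "?B - T"] Tm N mT by (auto simp: fmeasurable_def)
    moreover have "T \<union> (?B - T) \<in> lmeasurable" using Tm N(1) by (rule fmeasurable.Un)
    moreover have "?B \<subseteq> T \<union> (?B - T)" by blast
    ultimately show ?thesis by blast
  qed
  then show ?thesis by (simp add: negligible_outer_le)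
qed

text \<open>At a point with \<open>g x < q\<close>, \<open>q\<close> rational, the averages of \<open>g\<close> exceed \<open>q\<close> by at most those of the
  positive part of \<open>g - q\<close>, which vanishes at \<open>x\<close>.\<close>

lemma AE_upper_derivative_integral:
  fixes g :: "real \<Rightarrow> real"
  assumes g: "integrable lborel g"
  shows "AE x in lebesgue. x \<in> {0<..<1} \<longrightarrow> (\<forall>\<epsilon>>0. \<exists>\<delta>>0. \<forall>a b. a \<le> x \<and> x \<le> b \<and> a < b \<and> b - a < \<delta> \<longrightarrow>
    set_lebesgue_integral lborel {a..b} g \<le> (g x + \<epsilon>) * (b - a))"
proof -
  have mg[measurable]: "g \<in> borel_measurable borel" using g by simp
  have ind: "integrable lborel (\<lambda>x. indicator {a..b} x *\<^sub>R q)" for a b q :: real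
  proof -
    have "integrable lborel (indicator {a..b} :: real \<Rightarrow> real)" 
      by (rule integrable_real_indicator) (auto simp: emeasure_lborel_Icc_eq)
    then show ?thesis by simp
  qed
  \<comment> \<open>The window [-1, 2] makes the constant q integrable; it contains each [a, b] of
    length below 1 that meets (0, 1).\<close>
  define u where "u q x = indicator {-1..2} x * max 0 (g x - q)" for q x :: real
  have u: "integrable lborel (u q)" "u q x \<ge> 0" for q x
  proof -
    have "integrable lborel (\<lambda>x. max 0 (indicator {-1..2} x *\<^sub>R g x - indicator {-1..2} x *\<^sub>R q))"
      by (intro integrable_max integrable_zero Bochner_Integration.integrable_diff ind integrable_mult_indicator[OF _ g])
        auto
    moreover have "max 0 (indicator {-1..2} x *\<^sub>R g x - indicator {-1..2} x *\<^sub>R q) = u q x" for x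
      by (auto simp: u_def indicator_def)
    ultimately show "integrable lborel (u q)" by (simp cong: Bochner_Integration.integrable_cong)
    show "u q x \<ge> 0" by (simp add: u_def)
  qed
  have ae: "AE x in lebesgue. u q x = 0 \<longrightarrow> (\<exists>\<delta>>0. \<forall>r. 0 < r \<and> r < \<delta> \<longrightarrow> set_lebesgue_integral lborel (cball x r) (u q) \<le> \<epsilon> * r)"
    if "\<epsilon> > 0" for \<epsilon> q
  proof (rule AE_I')
    show "{x. u q x = 0 \<and> (\<forall>\<delta>>0. \<exists>r. 0 < r \<and> r < \<delta> \<and> set_lebesgue_integral lborel (cball x r) (u q) > \<epsilon> * r)} \<in> null_sets lebesgue"
      using AE_vanishing_average[OF u that] by (simp add: negligible_iff_null_sets)
  qed (auto simp: not_le)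
  \<comment> \<open>Restricting to rational q and tolerances 1 / (n + 1) leaves countably many
    exceptional null sets.\<close>
  have "AE x in lebesgue. \<forall>(n::nat) (q::rat). u (of_rat q) x = 0 \<longrightarrow> (\<exists>\<delta>>0. \<forall>r. 0 < r \<and> r < \<delta> \<longrightarrow> set_lebesgue_integral lborel (cball x r) (u (of_rat q)) \<le> inverse (real (Suc n)) * r)"
    unfolding AE_all_countable by (intro allI ae) simp
  then show ?thesis
  proof (eventually_elim, intro impI allI)
    fix x \<epsilon> :: real
    assume H: "\<forall>(n::nat) (q::rat). u (of_rat q) x = 0 \<longrightarrow> (\<exists>\<delta>>0. \<forall>r. 0 < r \<and> r < \<delta> \<longrightarrow> set_lebesgue_integral lborel (cball x r) (u (of_rat q)) \<le> inverse (real (Suc n)) * r)"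
      and x: "x \<in> {0<..<1}" and e: "\<epsilon> > 0"
    obtain n :: nat where n: "inverse (real (Suc n)) < \<epsilon> / 2" using reals_Archimedean[of "\<epsilon>/2"] e by auto
    obtain q :: rat where q: "g x < of_rat q" "of_rat q < g x + \<epsilon> / 2"
      using of_rat_dense[of "g x" "g x + \<epsilon>/2"] e by auto
    have "u (of_rat q) x = 0" using q by (simp add: u_def)
    with H obtain \<delta> where \<delta>: "\<delta> > 0" "\<And>r. 0 < r \<Longrightarrow> r < \<delta> \<Longrightarrow> set_lebesgue_integral lborel (cball x r) (u (of_rat q)) \<le> inverse (real (Suc n)) * r"
      by blast
    show "\<exists>\<delta>>0. \<forall>a b. a \<le> x \<and> x \<le> b \<and> a < b \<and> b - a < \<delta> \<longrightarrow>
      set_lebesgue_integral lborel {a..b} g \<le> (g x + \<epsilon>) * (b - a)"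
    proof (intro exI[of _ "min \<delta> 1"] conjI allI impI)
      show "min \<delta> 1 > 0" using \<delta>(1) by simp
      fix a b assume ab: "a \<le> x \<and> x \<le> b \<and> a < b \<and> b - a < min \<delta> 1"
      have sub: "{a..b} \<subseteq> cball x (b - a)" using ab by (auto simp: cball_eq_atLeastAtMost)
      have sub2: "{a..b} \<subseteq> {-1..2}" using ab x by auto
      have "set_lebesgue_integral lborel {a..b} g \<le> set_lebesgue_integral lborel {a..b} (\<lambda>y. of_rat q + u (of_rat q) y)"
        unfolding set_lebesgue_integral_def
      proof (rule integral_mono)
        show "integrable lborel (\<lambda>y. indicator {a..b} y *\<^sub>R g y)" by (intro integrable_mult_indicator g) auto
        have "integrable lborel (\<lambda>y. indicator {a..b} y *\<^sub>R of_rat q + indicator {a..b} y *\<^sub>R u (of_rat q) y)"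
          by (intro Bochner_Integration.integrable_add ind integrable_mult_indicator[OF _ u(1)]) auto
        then show "integrable lborel (\<lambda>y. indicator {a..b} y *\<^sub>R (of_rat q + u (of_rat q) y))"
          by (simp add: distrib_left)
        show "indicator {a..b} y *\<^sub>R g y \<le> indicator {a..b} y *\<^sub>R (of_rat q + u (of_rat q) y)" for y
          using sub2 by (auto simp: u_def indicator_def)
      qed
      also have "\<dots> = of_rat q * (b - a) + set_lebesgue_integral lborel {a..b} (u (of_rat q))"
      proof -
        have "set_lebesgue_integral lborel {a..b} (\<lambda>y. of_rat q + u (of_rat q) y)
          = set_lebesgue_integral lborel {a..b} (\<lambda>y. of_rat q) + set_lebesgue_integral lborel {a..b} (u (of_rat q))"
          by (rule set_integral_add, unfold set_integrable_def, rule ind,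
              rule integrable_mult_indicator[OF _ u(1)], simp)
        moreover have "set_lebesgue_integral lborel {a..b} (\<lambda>y. of_rat q) = of_rat q * (b - a)"
          using ab by (simp add: set_lebesgue_integral_def)
        ultimately show ?thesis by simp
      qed
      also have "set_lebesgue_integral lborel {a..b} (u (of_rat q)) \<le> set_lebesgue_integral lborel (cball x (b - a)) (u (of_rat q))"
        using sub u unfolding set_lebesgue_integral_def
        by (intro integral_mono integrable_mult_indicator) (auto simp: indicator_def)
      also have "\<dots> \<le> inverse (real (Suc n)) * (b - a)" using ab by (intro \<delta>(2)) auto
      also have "\<dots> \<le> (\<epsilon> / 2) * (b - a)" using n ab by (intro mult_right_mono) auto
      also have "of_rat q * (b - a) \<le> (g x + \<epsilon> / 2) * (b - a)" using q ab by (intro mult_right_mono) auto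
      finally show "set_lebesgue_integral lborel {a..b} g \<le> (g x + \<epsilon>) * (b - a)"
        by (simp add: algebra_simps)
    qed
  qed
qed

text \<open>The upper estimate, applied to g and to - g, bounds the averages from both sides. As it
  allows x to be either end point of [a, b], it covers left and right difference quotients.\<close>

lemma AE_has_derivative_integral:
  fixes g :: "real \<Rightarrow> real"
  assumes g: "integrable lborel g"
  shows "AE x in lebesgue. x \<in> {0<..<1} \<longrightarrow>
    ((\<lambda>t. set_lebesgue_integral lborel {0..t} g) has_real_derivative g x) (at x)"
proof -
  have "integrable lborel (\<lambda>x. - g x)" using g by simp
  from AE_upper_derivative_integral[OF this] AE_upper_derivative_integral[OF g]
  show ?thesis
  proof (eventually_elim, intro impI)
    fix x :: real
    assume 1: "x \<in> {0<..<1} \<longrightarrow> (\<forall>\<epsilon>>0. \<exists>\<delta>>0. \<forall>a b. a \<le> x \<and> x \<le> b \<and> a < b \<and> b - a < \<delta> \<longrightarrow>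
        set_lebesgue_integral lborel {a..b} (\<lambda>x. - g x) \<le> (- g x + \<epsilon>) * (b - a))"
      and 2: "x \<in> {0<..<1} \<longrightarrow> (\<forall>\<epsilon>>0. \<exists>\<delta>>0. \<forall>a b. a \<le> x \<and> x \<le> b \<and> a < b \<and> b - a < \<delta> \<longrightarrow>
        set_lebesgue_integral lborel {a..b} g \<le> (g x + \<epsilon>) * (b - a))"
      and x: "x \<in> {0<..<1}"
    define G where "G t = set_lebesgue_integral lborel {0..t} g" for t
    have neg: "set_lebesgue_integral lborel {a..b} (\<lambda>x. - g x) = - set_lebesgue_integral lborel {a..b} g" for a b
      by (simp add: set_lebesgue_integral_def)
    have G: "G b - G a = set_lebesgue_integral lborel {a..b} g" if "0 \<le> a" "a \<le> b" for a b
    proof -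
      have "set_lebesgue_integral lborel ({0..a} \<union> {a<..b}) g
        = set_lebesgue_integral lborel {0..a} g + set_lebesgue_integral lborel {a<..b} g"
        by (intro set_integral_Un, unfold set_integrable_def) (auto intro!: integrable_mult_indicator[OF _ g] simp del: real_scaleR_def)
      moreover have "{0..a} \<union> {a<..b} = {0..b}" using that by auto
      moreover have "set_lebesgue_integral lborel {a<..b} g = set_lebesgue_integral lborel {a..b} g"
        unfolding set_lebesgue_integral_def
      proof (rule integral_cong_AE)
        show "AE y in lborel. indicator {a<..b} y *\<^sub>R g y = indicator {a..b} y *\<^sub>R g y"
          using AE_lborel_singleton[of a] by eventually_elim (auto simp: indicator_def)
      qed (use g in auto)
      ultimately show ?thesis by (simp add: G_def)
    qed
    have "(G has_real_derivative g x) (at x)"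
      unfolding has_field_derivative_iff LIM_eq
    proof (intro allI impI)
      fix r :: real assume r: "r > 0"
      obtain d1 where d1: "d1 > 0" "\<And>a b. a \<le> x \<Longrightarrow> x \<le> b \<Longrightarrow> a < b \<Longrightarrow> b - a < d1 \<Longrightarrow>
        - set_lebesgue_integral lborel {a..b} g \<le> (- g x + r/2) * (b - a)"
        using 1[rule_format, OF x, of "r/2"] r unfolding neg by auto
      obtain d2 where d2: "d2 > 0" "\<And>a b. a \<le> x \<Longrightarrow> x \<le> b \<Longrightarrow> a < b \<Longrightarrow> b - a < d2 \<Longrightarrow>
        set_lebesgue_integral lborel {a..b} g \<le> (g x + r/2) * (b - a)"
        using 2[rule_format, OF x, of "r/2"] r by auto
      \<comment> \<open>The bound x keeps the interval to the right of 0, where increments of G are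
        integrals.\<close>
      define d where "d = min (min d1 d2) x"
      have main: "\<bar>(G b - G a) / (b - a) - g x\<bar> < r" if "0 \<le> a" "a \<le> x" "x \<le> b" "a < b" "b - a < d" for a b
      proof -
        have "G b - G a \<le> (g x + r/2) * (b - a)" "- (G b - G a) \<le> (- g x + r/2) * (b - a)"
          using d1(2)[of a b] d2(2)[of a b] that G[of a b] by (auto simp: d_def)
        then have *: "G b - G a \<le> (g x + r/2) * (b - a)" "(g x - r/2) * (b - a) \<le> G b - G a"
          by (simp_all add: algebra_simps)
        have "(G b - G a) / (b - a) \<le> g x + r/2" "g x - r/2 \<le> (G b - G a) / (b - a)"
          using * that(4) by (simp_all only: pos_divide_le_eq pos_le_divide_eq diff_gt_0_iff_gt)
        then show ?thesis using r by (simp add: abs_less_iff)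
      qed
      show "\<exists>s>0. \<forall>y. y \<noteq> x \<and> norm (y - x) < s \<longrightarrow> norm ((G y - G x) / (y - x) - g x) < r"
      proof (intro exI[of _ d] conjI allI impI)
        show "d > 0" using d1 d2 x by (simp add: d_def)
        fix y assume y: "y \<noteq> x \<and> norm (y - x) < d"
        then have "0 \<le> y" using x by (auto simp: d_def)
        show "norm ((G y - G x) / (y - x) - g x) < r"
        proof (cases "x < y")
          case True then show ?thesis using main[of x y] y x by simp
        next
          case False
          have "(G y - G x) / (y - x) = (G x - G y) / (x - y)" by (metis minus_diff_eq minus_divide_divide)
          then show ?thesis using False main[of y x] y \<open>0 \<le> y\<close> by simp
        qed
      qed
    qed
    then show "((\<lambda>t. set_lebesgue_integral lborel {0..t} g) has_real_derivative g x) (at x)"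
      by (simp add: G_def[abs_def])
  qed
qed

section \<open>Absolute continuity on the dyadic grid\<close>

abbreviation dyadic :: "nat \<Rightarrow> nat \<Rightarrow> real" where
  "dyadic k i \<equiv> real i / 2 ^ k"

lemma dyadic_mono: "i \<le> j \<Longrightarrow> dyadic k i \<le> dyadic k j"
  by (intro divide_right_mono) auto

lemma dyadic_le_1:
  assumes "i \<le> 2 ^ k"
  shows "dyadic k i \<le> 1"
proof -
  have "real i \<le> real (2 ^ k)" using assms by (simp only: of_nat_le_iff)
  then show ?thesis by simp
qed

lemma dyadic_interval_disjoint:
  assumes "i \<noteq> j"
  shows "{dyadic k i<..dyadic k (Suc i)} \<inter> {dyadic k j<..dyadic k (Suc j)} = {}"
proof -
  have *: "{dyadic k i<..dyadic k (Suc i)} \<inter> {dyadic k j<..dyadic k (Suc j)} = {}" if "i < j" for i j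
    using dyadic_mono[of "Suc i" j k] that by (auto simp del: of_nat_Suc)
  from assms *[of i j] *[of j i] show ?thesis by (cases i j rule: linorder_cases) blast+
qed

definition dyadic_increment :: "(real \<Rightarrow> real) \<Rightarrow> nat \<Rightarrow> nat \<Rightarrow> real" where
  "dyadic_increment h n i = h (dyadic n (Suc i)) - h (dyadic n i)"

text \<open>Absolute continuity tested only on unions of dyadic intervals of one level, so that
  length is a matter of counting: card S / 2^n. Unlike the general condition it passes to the limit
  of the dyadic variations by counting alone, and for monotone continuous functions it still yields
  a density.\<close>

definition dyadic_ac :: "(real \<Rightarrow> real) \<Rightarrow> bool" where
  "dyadic_ac h \<longleftrightarrow> (\<forall>\<epsilon>>0. \<exists>\<eta>>0. \<forall>n. \<forall>S\<subseteq>{..<2 ^ n}. real (card S) / 2 ^ n < \<eta> \<longrightarrow>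
    (\<Sum>i\<in>S. \<bar>dyadic_increment h n i\<bar>) < \<epsilon>)"

lemma absolutely_continuous_dyadic_ac:
  assumes "absolutely_continuous_01 h"
  shows "dyadic_ac h"
  unfolding dyadic_ac_def
proof (intro allI impI)
  fix \<epsilon> :: real assume "\<epsilon> > 0"
  then obtain \<eta> where \<eta>: "\<eta> > 0" "\<And>n a b. \<lbrakk>\<forall>i<n. 0 \<le> a i \<and> a i \<le> b i \<and> b i \<le> 1;
      disjoint_family_on (\<lambda>i. {a i<..<b i}) {..<n}; (\<Sum>i<n. b i - a i) < \<eta>\<rbrakk> \<Longrightarrow>
      (\<Sum>i<(n::nat). \<bar>h (b i) - h (a i)\<bar>) < \<epsilon>"
    using assms unfolding absolutely_continuous_01_def by meson
  show "\<exists>\<eta>>0. \<forall>n. \<forall>S\<subseteq>{..<2 ^ n}. real (card S) / 2 ^ n < \<eta> \<longrightarrow> (\<Sum>i\<in>S. \<bar>dyadic_increment h n i\<bar>) < \<epsilon>"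
  proof (intro exI[of _ \<eta>] conjI allI impI \<eta>(1))
    fix n :: nat and S :: "nat set" assume S: "S \<subseteq> {..<2 ^ n}" "real (card S) / 2 ^ n < \<eta>"
    \<comment> \<open>Indices outside S receive an empty interval, so that the family can be indexed
      by all i < 2^n.\<close>
    define a b where "a i = dyadic n i" and "b i = (if i \<in> S then dyadic n (Suc i) else dyadic n i)"
      for i :: nat
    have sub: "{a i<..<b i} \<subseteq> {dyadic n i<..dyadic n (Suc i)}" for i
      by (auto simp: a_def b_def)
    have "{a i<..<b i} \<inter> {a j<..<b j} = {}" if "i \<noteq> j" for i j
      using dyadic_interval_disjoint[OF that, of n] sub[of i] sub[of j] by blast
    then have "disjoint_family_on (\<lambda>i. {a i<..<b i}) {..<2 ^ n}"
      by (simp add: disjoint_family_on_def)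
    moreover have "\<forall>i<2 ^ n. 0 \<le> a i \<and> a i \<le> b i \<and> b i \<le> 1"
      using dyadic_le_1 by (auto simp: a_def b_def divide_right_mono Suc_leI simp del: of_nat_Suc)
    moreover have "(\<Sum>i<2 ^ n. b i - a i) < \<eta>"
    proof -
      have "(\<Sum>i<2 ^ n. b i - a i) = (\<Sum>i<2^n. if i \<in> S then 1 / 2 ^ n else 0)"
        by (intro sum.cong) (auto simp: a_def b_def add_divide_distrib)
      also have "\<dots> = (\<Sum>i\<in>S. 1 / 2 ^ n)" using S(1) by (simp add: sum.If_cases Int_absorb1)
      finally show ?thesis using S(2) by simp
    qed
    ultimately have "(\<Sum>i<2 ^ n. \<bar>h (b i) - h (a i)\<bar>) < \<epsilon>" by (intro \<eta>(2))
    also have "(\<Sum>i<2 ^ n. \<bar>h (b i) - h (a i)\<bar>) = (\<Sum>i<2^n. if i \<in> S then \<bar>dyadic_increment h n i\<bar> else 0)"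
      by (intro sum.cong) (auto simp: a_def b_def dyadic_increment_def)
    also have "\<dots> = (\<Sum>i\<in>S. \<bar>dyadic_increment h n i\<bar>)" using S(1) by (simp add: sum.If_cases Int_absorb1)
    finally show "(\<Sum>i\<in>S. \<bar>dyadic_increment h n i\<bar>) < \<epsilon>" .
  qed
qed

lemma absolutely_continuous_continuous:
  assumes "absolutely_continuous_01 h"
  shows "continuous_on {0..1} h"
  unfolding continuous_on_iff
proof (intro ballI allI impI)
  fix x \<epsilon> :: real assume x: "x \<in> {0..1}" and e: "\<epsilon> > 0"
  obtain \<eta> where \<eta>: "\<eta> > 0" "\<And>n a b. \<lbrakk>\<forall>i<n. 0 \<le> a i \<and> a i \<le> b i \<and> b i \<le> 1;
      disjoint_family_on (\<lambda>i. {a i<..<b i}) {..<n}; (\<Sum>i<n. b i - a i) < \<eta>\<rbrakk> \<Longrightarrow>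
      (\<Sum>i<(n::nat). \<bar>h (b i) - h (a i)\<bar>) < \<epsilon>"
    using assms e unfolding absolutely_continuous_01_def by meson
  show "\<exists>d>0. \<forall>y\<in>{0..1}. dist y x < d \<longrightarrow> dist (h y) (h x) < \<epsilon>"
  proof (intro exI[of _ \<eta>] conjI ballI impI \<eta>(1))
    fix y :: real assume y: "y \<in> {0..1}" "dist y x < \<eta>"
    have "(\<Sum>i<(1::nat). \<bar>h (max x y) - h (min x y)\<bar>) < \<epsilon>"
      by (rule \<eta>(2)) (use x y in \<open>auto simp: disjoint_family_on_def dist_real_def\<close>)
    then show "dist (h y) (h x) < \<epsilon>" by (auto simp: dist_real_def max_def min_def split: if_splits)
  qed
qed

lemma dyadic_ac_add:
  assumes "dyadic_ac h" "dyadic_ac k"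
  shows "dyadic_ac (\<lambda>x. h x + k x)"
  unfolding dyadic_ac_def
proof (intro allI impI)
  fix \<epsilon> :: real assume "\<epsilon> > 0"
  then have e2: "\<epsilon> / 2 > 0" by simp
  obtain \<eta> where \<eta>: "\<eta> > 0" "\<And>n S. S \<subseteq> {..<2 ^ n} \<Longrightarrow> real (card S) / 2 ^ n < \<eta> \<Longrightarrow> (\<Sum>i\<in>S. \<bar>dyadic_increment h n i\<bar>) < \<epsilon> / 2"
    using assms(1) e2 unfolding dyadic_ac_def by meson
  obtain \<eta>' where \<eta>': "\<eta>' > 0" "\<And>n S. S \<subseteq> {..<2 ^ n} \<Longrightarrow> real (card S) / 2 ^ n < \<eta>' \<Longrightarrow> (\<Sum>i\<in>S. \<bar>dyadic_increment k n i\<bar>) < \<epsilon> / 2"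
    using assms(2) e2 unfolding dyadic_ac_def by meson
  show "\<exists>\<eta>>0. \<forall>n. \<forall>S\<subseteq>{..<2 ^ n}. real (card S) / 2 ^ n < \<eta> \<longrightarrow> (\<Sum>i\<in>S. \<bar>dyadic_increment (\<lambda>x. h x + k x) n i\<bar>) < \<epsilon>"
  proof (intro exI[of _ "min \<eta> \<eta>'"] conjI allI impI)
    show "min \<eta> \<eta>' > 0" using \<eta>(1) \<eta>'(1) by simp
    fix n :: nat and S :: "nat set" assume S: "S \<subseteq> {..<2 ^ n}" "real (card S) / 2 ^ n < min \<eta> \<eta>'"
    have "(\<Sum>i\<in>S. \<bar>dyadic_increment (\<lambda>x. h x + k x) n i\<bar>) \<le> (\<Sum>i\<in>S. \<bar>dyadic_increment h n i\<bar> + \<bar>dyadic_increment k n i\<bar>)"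
      by (intro sum_mono) (simp add: dyadic_increment_def)
    also have "\<dots> < \<epsilon>" using \<eta>(2)[OF S(1)] \<eta>'(2)[OF S(1)] S(2) by (simp add: sum.distrib)
    finally show "(\<Sum>i\<in>S. \<bar>dyadic_increment (\<lambda>x. h x + k x) n i\<bar>) < \<epsilon>" .
  qed
qed

lemma interval_dyadic_member:
  assumes "0 < x" "x \<le> 1"
  shows "\<exists>i<2 ^ n. x \<in> {dyadic n i<..dyadic n (Suc i)}"
proof -
  \<comment> \<open>The ceiling is used because the intervals are open on the left; x lies in the
    interval with index j - 1.\<close>
  define j where "j = nat \<lceil>x * 2 ^ n\<rceil>"
  have p: "0 < x * 2 ^ n" "x * 2 ^ n \<le> 2 ^ n" using assms by auto
  have "\<lceil>x * 2 ^ n\<rceil> \<le> 2 ^ n" using p(2) by (simp add: ceiling_le_iff)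
  then have j: "j \<ge> 1" "j \<le> 2 ^ n" "real j \<ge> x * 2 ^ n" "real j < x * 2 ^ n + 1"
    using p(1) unfolding j_def by (auto simp: nat_le_iff le_nat_iff) linarith+
  have "x \<in> {real (j - 1) / 2 ^ n<..real (Suc (j - 1)) / 2 ^ n}"
    using j by (simp add: of_nat_diff pos_divide_less_eq pos_le_divide_eq)
  moreover have "j - 1 < 2 ^ n" using j by simp
  ultimately show ?thesis by blast
qed

section \<open>Densities of monotone functions\<close>

text \<open>Enclose N in an open V of Lebesgue measure below \<eta>. The level-n dyadic intervals
  contained in V have total length below \<eta>, hence F-mass at most \<epsilon>. Their unions U n
  increase and cover N \<inter> (0, 1], so the bound survives the limit.\<close>

lemma dyadic_ac_null:
  fixes F :: "real \<Rightarrow> real"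
  assumes mono: "\<And>x y. x \<le> y \<Longrightarrow> F x \<le> F y" and cont: "continuous_on UNIV F"
    and ac: "dyadic_ac F" and N: "N \<in> null_sets lborel"
  shows "emeasure (interval_measure F) (N \<inter> {0<..1}) = 0"
proof -
  have rc: "\<And>a. continuous (at_right a) F"
    using cont by (auto simp: continuous_on_eq_continuous_within intro: continuous_within_subset)
  note Ioc = emeasure_interval_measure_Ioc[OF _ mono rc]
  have Nb: "N \<in> sets borel" using N by auto
  have "emeasure (interval_measure F) (N \<inter> {0<..1}) \<le> ennreal \<epsilon>" if e: "\<epsilon> > 0" for \<epsilon>
  proof -
    obtain \<eta> where \<eta>: "\<eta> > 0" "\<And>n S. S \<subseteq> {..<2 ^ n} \<Longrightarrow> real (card S) / 2 ^ n < \<eta> \<Longrightarrow> (\<Sum>i\<in>S. \<bar>dyadic_increment F n i\<bar>) < \<epsilon>"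
      using ac e unfolding dyadic_ac_def by meson
    obtain V where V: "open V" "N \<subseteq> V" "emeasure lborel (V - N) < \<eta>"
      using outer_regular_lborel[OF Nb \<eta>(1)] by blast
    have lV: "emeasure lborel V < \<eta>"
    proof -
      have "V - N \<in> sets lborel" using V(1) Nb by auto
      from emeasure_Un_null_set[OF this N] V show ?thesis by (simp add: Un_absorb2)
    qed
    define I where "I n i = {dyadic n i<..dyadic n (Suc i)}" for n i :: nat
    define S where "S n = {i\<in>{..<2 ^ n}. I n i \<subseteq> V}" for n :: nat
    define U where "U n = (\<Union>i\<in>S n. I n i)" for n
    have finS: "finite (S n)" for n by (simp add: S_def)
    have disj: "disjoint_family_on (I n) (S n)" for n
      using dyadic_interval_disjoint by (simp add: disjoint_family_on_def I_def)
    have UV: "U n \<subseteq> V" for n by (auto simp: U_def S_def)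
    have le: "dyadic n i \<le> dyadic n (Suc i)" for i n by (rule dyadic_mono) simp
    have lI: "emeasure lborel (I n i) = ennreal (1 / 2 ^ n)" for n i
      using le[of i n] by (simp add: I_def add_divide_distrib)
    have mU: "emeasure (interval_measure F) (U n) \<le> ennreal \<epsilon>" for n
    proof -
      have "emeasure lborel (U n) = (\<Sum>i\<in>S n. emeasure lborel (I n i))"
        unfolding U_def by (intro sum_emeasure[symmetric] disj finS) (auto simp: I_def)
      also have "\<dots> = ennreal (real (card (S n)) / 2 ^ n)"
        by (simp add: lI ennreal_of_nat_eq_real_of_nat ennreal_mult[symmetric] del: ennreal_mult)
      finally have "ennreal (real (card (S n)) / 2 ^ n) < \<eta>"
        using emeasure_mono[OF UV[of n], of lborel] V(1) lV by simp
      then have "real (card (S n)) / 2 ^ n < \<eta>" by (simp add: ennreal_less_iff)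
      then have lt: "(\<Sum>i\<in>S n. \<bar>dyadic_increment F n i\<bar>) < \<epsilon>"
        by (intro \<eta>(2)) (auto simp: S_def)
      have "emeasure (interval_measure F) (U n) = (\<Sum>i\<in>S n. emeasure (interval_measure F) (I n i))"
        unfolding U_def by (intro sum_emeasure[symmetric] disj finS) (auto simp: I_def)
      also have "\<dots> = (\<Sum>i\<in>S n. ennreal (F (dyadic n (Suc i)) - F (dyadic n i)))"
        unfolding I_def by (intro sum.cong refl Ioc le)
      also have "\<dots> = ennreal (\<Sum>i\<in>S n. F (dyadic n (Suc i)) - F (dyadic n i))"
        using mono[OF le] by (intro sum_ennreal) simp
      also have "\<dots> \<le> ennreal (\<Sum>i\<in>S n. \<bar>dyadic_increment F n i\<bar>)"
        by (intro ennreal_leI sum_mono) (simp add: dyadic_increment_def)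
      also have "\<dots> \<le> ennreal \<epsilon>" using lt by (intro ennreal_leI) simp
      finally show ?thesis .
    qed
    have incU: "incseq U"
    proof (rule incseq_SucI)
      fix n show "U n \<subseteq> U (Suc n)"
      proof
        fix x assume "x \<in> U n"
        then obtain i where i: "i < 2 ^ n" "I n i \<subseteq> V" "x \<in> I n i" by (auto simp: U_def S_def)
        have e0: "real (2 * i) / 2 ^ Suc n = dyadic n i" by simp
        have e2: "real (Suc (Suc (2 * i))) / 2 ^ Suc n = dyadic n (Suc i)" by (simp add: field_simps)
        have sub: "I (Suc n) (2 * i) \<subseteq> I n i" "I (Suc n) (Suc (2 * i)) \<subseteq> I n i"
          using le[of "2*i" "Suc n"] le[of "Suc (2 * i)" "Suc n"] unfolding I_def e0 e2 by auto
        have "I n i \<subseteq> I (Suc n) (2 * i) \<union> I (Suc n) (Suc (2 * i))"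
          unfolding I_def e0 e2 by auto
        with i(3) consider "x \<in> I (Suc n) (2 * i)" | "x \<in> I (Suc n) (Suc (2 * i))" by blast
        then show "x \<in> U (Suc n)"
        proof cases
          case 1 then show ?thesis using i sub unfolding U_def S_def by (intro UN_I[of "2 * i"]) auto
        next
          case 2 then show ?thesis using i sub unfolding U_def S_def by (intro UN_I[of "Suc (2 * i)"]) auto
        qed
      qed
    qed
    have cover: "N \<inter> {0<..1} \<subseteq> (\<Union>n. U n)"
    proof
      fix x assume x: "x \<in> N \<inter> {0<..1}"
      then obtain d where d: "d > 0" "ball x d \<subseteq> V" using V openE by blast
      obtain n where n: "(1/2) ^ n < d" using real_arch_pow_inv[of d "1/2"] d by auto
      obtain i where i: "i < 2 ^ n" "x \<in> I n i" using interval_dyadic_member[of x n] x by (auto simp: I_def)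
      have "I n i \<subseteq> ball x d"
      proof
        fix y assume "y \<in> I n i"
        then have "\<bar>y - x\<bar> < dyadic n (Suc i) - dyadic n i" using i(2) by (auto simp: I_def)
        also have "\<dots> = (1/2) ^ n" by (simp add: diff_divide_distrib[symmetric] power_divide)
        finally show "y \<in> ball x d" using n by (simp add: dist_real_def abs_minus_commute)
      qed
      then have "i \<in> S n" using i d by (auto simp: S_def)
      then show "x \<in> (\<Union>n. U n)" using i by (auto simp: U_def)
    qed
    have Us: "U n \<in> sets (interval_measure F)" for n
      unfolding U_def using finS by (intro sets.finite_UN) (auto simp: I_def)
    have "emeasure (interval_measure F) (N \<inter> {0<..1}) \<le> emeasure (interval_measure F) (\<Union>n. U n)"
      using cover Us by (intro emeasure_mono) auto
    also have "\<dots> = (SUP n. emeasure (interval_measure F) (U n))"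
      using Us incU by (intro SUP_emeasure_incseq[symmetric]) auto
    also have "\<dots> \<le> ennreal \<epsilon>" by (intro SUP_least mU)
    finally show ?thesis .
  qed
  then show ?thesis using ennreal_le_epsilon[of 0 "emeasure (interval_measure F) (N \<inter> {0<..1})"]
    by (metis add_0 ennreal_le_epsilon le_zero_eq)
qed

lemma dyadic_ac_mono_density:
  fixes F :: "real \<Rightarrow> real"
  assumes mono: "\<And>x y. x \<le> y \<Longrightarrow> F x \<le> F y" and cont: "continuous_on UNIV F"
    and ac: "dyadic_ac F"
  shows "\<exists>f. integrable lborel f \<and> (\<forall>t\<in>{0..1}. F t = F 0 + set_lebesgue_integral lborel {0..t} f)"
proof -
  have rc: "\<And>a. continuous (at_right a) F"
    using cont by (auto simp: continuous_on_eq_continuous_within intro: continuous_within_subset)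
  note Ioc = emeasure_interval_measure_Ioc[OF _ mono rc]
  \<comment> \<open>Null sets are controlled on (0, 1] alone, so the Stieltjes measure is cut off
    there; F t - F 0 is the mass of (0, t].\<close>
  define P where "P = density (interval_measure F) (indicator {0<..1})"
  have eP: "emeasure P S = emeasure (interval_measure F) (S \<inter> {0<..1})" if "S \<in> sets borel" for S
    using that by (simp add: P_def emeasure_density indicator_inter_arith[symmetric] Int_commute
        nn_integral_indicator mult.commute)
  have setsP: "sets P = sets lborel" by (simp add: P_def)
  have "absolutely_continuous lborel P"
    unfolding absolutely_continuous_def
  proof
    fix N :: "real set" assume N: "N \<in> null_sets lborel"
    then show "N \<in> null_sets P"
      using dyadic_ac_null[OF mono cont ac N] eP[of N] by (auto simp: null_sets_def setsP)
  qed
  from sigma_finite_measure.Radon_Nikodym[OF sigma_finite_lborel this setsP] obtain g where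
    g[measurable]: "g \<in> borel_measurable lborel" and dg: "density lborel g = P" by blast
  have gI: "(\<integral>\<^sup>+x. g x * indicator S x \<partial>lborel) = emeasure P S" if "S \<in> sets borel" for S
    using that by (simp add: dg[symmetric] emeasure_density)
  have tot: "(\<integral>\<^sup>+x. g x \<partial>lborel) = ennreal (F 1 - F 0)"
    using gI[of UNIV] eP[of UNIV] Ioc[of 0 1] by simp
  have "AE x in lborel. g x \<noteq> \<infinity>"
    using tot by (intro nn_integral_PInf_AE) auto
  then have fin: "AE x in lborel. ennreal (enn2real (g x)) = g x"
    by eventually_elim (simp add: top.not_eq_extremum)
  \<comment> \<open>The total mass F 1 - F 0 is finite, so g is finite almost everywhere and turning
    infinity into 0 alters it only on a null set.\<close>
  define f where "f x = enn2real (g x)" for x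
  have mf[measurable]: "f \<in> borel_measurable lborel" unfolding f_def by measurable
  have f0: "f x \<ge> 0" for x by (simp add: f_def)
  have intf: "integrable lborel f"
  proof (rule integrableI_nonneg)
    have "(\<integral>\<^sup>+x. ennreal (f x) \<partial>lborel) = (\<integral>\<^sup>+x. g x \<partial>lborel)"
      using fin by (intro nn_integral_cong_AE) (auto simp: f_def)
    then show "(\<integral>\<^sup>+x. ennreal (f x) \<partial>lborel) < \<infinity>" using tot by simp
  qed (use f0 in auto)
  have "F t = F 0 + set_lebesgue_integral lborel {0..t} f" if t: "t \<in> {0..1}" for t
  proof -
    have "ennreal (set_lebesgue_integral lborel {0..t} f) = (\<integral>\<^sup>+x. ennreal (indicator {0..t} x * f x) \<partial>lborel)"
      unfolding set_lebesgue_integral_def using intf f0 integrable_mult_indicator[OF _ intf, of "{0..t}"]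
      by (subst nn_integral_eq_integral) auto
    also have "\<dots> = (\<integral>\<^sup>+x. g x * indicator {0..t} x \<partial>lborel)"
      using fin by (intro nn_integral_cong_AE) (auto simp: f_def indicator_def elim!: eventually_mono)
    also have "\<dots> = emeasure (interval_measure F) ({0..t} \<inter> {0<..1})" using gI[of "{0..t}"] eP[of "{0..t}"] by simp
    also have "{0..t} \<inter> {0<..1} = {0<..t}" using t by auto
    also have "emeasure (interval_measure F) {0<..t} = ennreal (F t - F 0)" using t by (intro Ioc) auto
    finally have "ennreal (set_lebesgue_integral lborel {0..t} f) = ennreal (F t - F 0)" .
    moreover have "set_lebesgue_integral lborel {0..t} f \<ge> 0"
      unfolding set_lebesgue_integral_def using f0 by (intro Bochner_Integration.integral_nonneg) (auto simp: indicator_def)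
    moreover have "F t - F 0 \<ge> 0" using mono[of 0 t] t by simp
    ultimately show ?thesis by simp
  qed
  with intf show ?thesis by blast
qed

section \<open>The variation along dyadic partitions\<close>

definition dyadic_floor :: "nat \<Rightarrow> real \<Rightarrow> nat" where
  "dyadic_floor n x = nat \<lfloor>2 ^ n * x\<rfloor>"

text \<open>Only level-n intervals lying entirely in [0, x] are counted. Dropping the incomplete
  last one makes the sum monotone both in x and in n.\<close>

definition dyadic_variation :: "(real \<Rightarrow> real) \<Rightarrow> nat \<Rightarrow> real \<Rightarrow> real" where
  "dyadic_variation h n x = (\<Sum>i<dyadic_floor n x. \<bar>dyadic_increment h n i\<bar>)"

lemma dyadic_floor_bounds:
  assumes "x \<ge> 0"
  shows "real (dyadic_floor n x) \<le> 2 ^ n * x" "2 ^ n * x < real (dyadic_floor n x) + 1"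
  using assms by (simp_all add: dyadic_floor_def)

lemma dyadic_floor_mono: "x \<le> y \<Longrightarrow> dyadic_floor n x \<le> dyadic_floor n y"
  unfolding dyadic_floor_def by (intro nat_mono floor_mono mult_left_mono) auto

lemma dyadic_floor_le:
  assumes "0 \<le> x" "x \<le> 1"
  shows "dyadic_floor n x \<le> 2 ^ n"
proof -
  have "real (dyadic_floor n x) \<le> 2 ^ n * 1"
  proof -
    have "2 ^ n * x \<le> 2 ^ n * 1" using assms(2) by (rule mult_left_mono) simp
    then show ?thesis using dyadic_floor_bounds(1)[OF assms(1), of n] by linarith
  qed
  then have "real (dyadic_floor n x) \<le> real (2 ^ n)" by simp
  then show ?thesis by (simp only: of_nat_le_iff)
qed

lemma dyadic_floor_dyadic:
  assumes "m \<le> n"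
  shows "dyadic_floor n (dyadic m i) = i * 2 ^ (n - m)"
proof -
  have "(2::real) ^ n = 2 ^ m * 2 ^ (n - m)" using assms by (simp add: power_add[symmetric])
  then have "2 ^ n * (dyadic m i) = real (i * 2 ^ (n - m))" by simp
  then show ?thesis by (simp only: dyadic_floor_def floor_of_nat nat_int)
qed

lemma sum_pairs: "(\<Sum>i<2 * n. f i) = (\<Sum>i<n. f (2 * i) + f (Suc (2 * i)) :: real)" for n :: nat
  by (induction n) (simp_all add: algebra_simps)

lemma dyadic_increment_split:
  "dyadic_increment h n i = dyadic_increment h (Suc n) (2 * i) + dyadic_increment h (Suc n) (Suc (2 * i))"
proof -
  have "real (2 * i) / 2 ^ Suc n = dyadic n i" by simp
  moreover have "real (Suc (Suc (2 * i))) / 2 ^ Suc n = dyadic n (Suc i)" by (simp add: field_simps)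
  ultimately show ?thesis by (simp only: dyadic_increment_def)
qed

text \<open>Halving an interval does not decrease the sum, by the triangle inequality, and the finer
  level may count one more interval at the right end.\<close>

lemma dyadic_variation_Suc:
  assumes "x \<ge> 0"
  shows "dyadic_variation h n x \<le> dyadic_variation h (Suc n) x"
proof -
  have "2 * real (dyadic_floor n x) \<le> 2 ^ Suc n * x" using dyadic_floor_bounds(1)[OF assms, of n] by simp
  then have "real (2 * dyadic_floor n x) < real (dyadic_floor (Suc n) x) + 1"
    using dyadic_floor_bounds(2)[OF assms, of "Suc n"] by simp
  then have le: "2 * dyadic_floor n x \<le> dyadic_floor (Suc n) x" by linarith
  have "dyadic_variation h n x \<le> (\<Sum>i<dyadic_floor n x. \<bar>dyadic_increment h (Suc n) (2 * i)\<bar> + \<bar>dyadic_increment h (Suc n) (Suc (2 * i))\<bar>)"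
    unfolding dyadic_variation_def by (intro sum_mono) (simp only: dyadic_increment_split[of h n] abs_triangle_ineq)
  also have "\<dots> = (\<Sum>i<2 * dyadic_floor n x. \<bar>dyadic_increment h (Suc n) i\<bar>)" by (rule sum_pairs[symmetric])
  also have "\<dots> \<le> dyadic_variation h (Suc n) x"
    unfolding dyadic_variation_def using le by (intro sum_mono2) auto
  finally show ?thesis .
qed

lemma dyadic_variation_diff:
  assumes "x \<le> y"
  shows "dyadic_variation h n y - dyadic_variation h n x
    = (\<Sum>i\<in>{dyadic_floor n x..<dyadic_floor n y}. \<bar>dyadic_increment h n i\<bar>)"
  using sum_diff_nat_ivl[of 0 "dyadic_floor n x" "dyadic_floor n y" "\<lambda>i. \<bar>dyadic_increment h n i\<bar>"]
    dyadic_floor_mono[OF assms, of n]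
  by (simp add: dyadic_variation_def atLeast0LessThan)

lemma dyadic_variation_mono: "x \<le> y \<Longrightarrow> dyadic_variation h n x \<le> dyadic_variation h n y"
proof -
  assume "x \<le> y"
  moreover have "0 \<le> (\<Sum>i\<in>{dyadic_floor n x..<dyadic_floor n y}. \<bar>dyadic_increment h n i\<bar>)"
    by (intro sum_nonneg) simp
  ultimately show ?thesis using dyadic_variation_diff[of x y h n] by linarith
qed

lemma dyadic_variation_ge:
  assumes "x \<le> y"
  shows "\<bar>h (dyadic n (dyadic_floor n y)) - h (dyadic n (dyadic_floor n x))\<bar>
    \<le> dyadic_variation h n y - dyadic_variation h n x"
proof -
  have "(\<Sum>i\<in>{dyadic_floor n x..<dyadic_floor n y}. dyadic_increment h n i)
    = h (dyadic n (dyadic_floor n y)) - h (dyadic n (dyadic_floor n x))"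
    unfolding dyadic_increment_def
    using sum_Suc_diff'[OF dyadic_floor_mono[OF assms, of n], of "\<lambda>i. h (dyadic n i)"] by simp
  then show ?thesis unfolding dyadic_variation_diff[OF assms] by (metis sum_abs)
qed

lemma dyadic_floor_tendsto:
  assumes "x \<ge> 0"
  shows "(\<lambda>n. dyadic n (dyadic_floor n x)) \<longlonglongrightarrow> x"
proof (rule tendsto_sandwich)
  show "(\<lambda>n. x - (1/2) ^ n) \<longlonglongrightarrow> x"
    using tendsto_diff[OF tendsto_const[of x] LIMSEQ_realpow_zero[of "1/2"]] by simp
  show "\<forall>\<^sub>F n in sequentially. x - (1/2) ^ n \<le> dyadic n (dyadic_floor n x)"
  proof (intro always_eventually allI)
    fix n
    have "(2 ^ n * x - 1) / 2 ^ n \<le> dyadic n (dyadic_floor n x)"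
      using dyadic_floor_bounds(2)[OF assms, of n] by (intro divide_right_mono) auto
    then show "x - (1/2) ^ n \<le> dyadic n (dyadic_floor n x)" by (simp add: diff_divide_distrib power_divide)
  qed
  show "\<forall>\<^sub>F n in sequentially. dyadic n (dyadic_floor n x) \<le> x"
    using dyadic_floor_bounds(1)[OF assms] by (intro always_eventually allI) (simp add: pos_divide_le_eq mult.commute)
qed auto

text \<open>For n \<ge> m, [0, 1] splits into 2^m blocks of k level-n intervals each. A block has
  length (1/2)^m < \<eta> and contributes less than 1, which gives the bound 2^m; smaller n follow
  by monotonicity in n.\<close>

lemma dyadic_variation_bounded:
  assumes "dyadic_ac h"
  shows "\<exists>B. \<forall>n. \<forall>x\<in>{0..1}. dyadic_variation h n x \<le> B"
proof -
  obtain \<eta> where \<eta>: "\<eta> > 0" "\<And>n S. S \<subseteq> {..<2 ^ n} \<Longrightarrow> real (card S) / 2 ^ n < \<eta> \<Longrightarrow> (\<Sum>i\<in>S. \<bar>dyadic_increment h n i\<bar>) < 1"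
    using assms unfolding dyadic_ac_def by (meson zero_less_one)
  obtain m where m: "(1/2) ^ m < \<eta>" using real_arch_pow_inv[of \<eta> "1/2"] \<eta>(1) by auto
  have big: "dyadic_variation h n 1 \<le> 2 ^ m" if "n \<ge> m" for n
  proof -
    define k :: nat where "k = 2 ^ (n - m)"
    have k: "(2::nat) ^ n = 2 ^ m * k" using that by (simp add: k_def power_add[symmetric])
    have "dyadic_variation h n 1 = (\<Sum>i<2 ^ m * k. \<bar>dyadic_increment h n i\<bar>)"
      using dyadic_floor_dyadic[of 0 n 1] by (simp add: dyadic_variation_def k)
    also have "\<dots> = (\<Sum>j<2 ^ m. \<Sum>i\<in>{j * k..<j * k + k}. \<bar>dyadic_increment h n i\<bar>)"
      by (rule sum.nat_group[symmetric])
    also have "\<dots> \<le> (\<Sum>j<(2::nat) ^ m. 1)"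
    proof (rule sum_mono, rule less_imp_le, rule \<eta>(2))
      fix j :: nat assume j: "j \<in> {..<2 ^ m}"
      then have "j * k + k \<le> 2 ^ m * k"
      proof -
        have "Suc j * k \<le> 2 ^ m * k" using j by (intro mult_le_mono1) simp
        then show ?thesis by simp
      qed
      then show "{j * k..<j * k + k} \<subseteq> {..<2 ^ n}" unfolding k by auto
      have "(2::real) ^ n = 2 ^ m * real k" using arg_cong[OF k, of real] by simp
      then have "real (card {j * k..<j * k + k}) / 2 ^ n = (1/2) ^ m" by (simp add: k_def power_divide)
      then show "real (card {j * k..<j * k + k}) / 2 ^ n < \<eta>" using m by simp
    qed
    finally show ?thesis by simp
  qed
  have "dyadic_variation h n x \<le> 2 ^ m" if x: "x \<in> {0..1}" for n x
  proof -
    have "incseq (\<lambda>n. dyadic_variation h n 1)" by (intro incseq_SucI dyadic_variation_Suc) simp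
    then have "dyadic_variation h n 1 \<le> dyadic_variation h (max n m) 1" by (rule incseqD) simp
    then show ?thesis using big[of "max n m"] dyadic_variation_mono[of x 1 h n] x by simp
  qed
  then show ?thesis by blast
qed

text \<open>With \<open>F\<close> the limit of the dyadic variations, both \<open>F\<close> and \<open>F + h\<close> are monotone and absolutely
  continuous, so that their Stieltjes measures have Radon-Nikodym densities.\<close>

theorem absolutely_continuous_density:
  assumes "absolutely_continuous_01 h"
  shows "\<exists>g. integrable lborel g \<and> (\<forall>t\<in>{0..1}. h t = h 0 + set_lebesgue_integral lborel {0..t} g)"
proof -
  have ac: "dyadic_ac h" by (rule absolutely_continuous_dyadic_ac[OF assms])
  have cont: "continuous_on {0..1} h" by (rule absolutely_continuous_continuous[OF assms])
  \<comment> \<open>Stieltjes measures need functions on the whole line; clamping extends F and h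
    constantly beyond [0, 1].\<close>
  define c where "c x = max 0 (min 1 x)" for x :: real
  have c01: "c x \<in> {0..1}" and c_id: "x \<in> {0..1} \<Longrightarrow> c x = x" and c_mono: "x \<le> y \<Longrightarrow> c x \<le> c y"
    and c_lip: "\<bar>c x - c y\<bar> \<le> \<bar>x - y\<bar>" for x y
    by (auto simp: c_def)
  have c_cont: "continuous_on UNIV c" unfolding c_def[abs_def] by (intro continuous_intros)
  define F where "F x = (SUP n. dyadic_variation h n (c x))" for x
  obtain B where B: "\<And>n x. x \<in> {0..1} \<Longrightarrow> dyadic_variation h n x \<le> B"
    using dyadic_variation_bounded[OF ac] by blast
  have lim: "(\<lambda>n. dyadic_variation h n (c x)) \<longlonglongrightarrow> F x" for x
    unfolding F_def using B[OF c01] c01[of x]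
    by (intro LIMSEQ_incseq_SUP bdd_aboveI[of _ B] incseq_SucI dyadic_variation_Suc) auto
  have mono: "F x \<le> F y" if "x \<le> y" for x y
    by (rule LIMSEQ_le[OF lim lim]) (use dyadic_variation_mono[OF c_mono[OF that]] in blast)
  \<comment> \<open>This makes F + h monotone; h is then recovered as the difference of the monotone
    functions F + h and F.\<close>
  have hF: "\<bar>h (c y) - h (c x)\<bar> \<le> F y - F x" if "x \<le> y" for x y
  proof (rule LIMSEQ_le)
    show "(\<lambda>n. dyadic_variation h n (c y) - dyadic_variation h n (c x)) \<longlonglongrightarrow> F y - F x"
      by (intro tendsto_diff lim)
    have t: "(\<lambda>n. h (dyadic n (dyadic_floor n (c z)))) \<longlonglongrightarrow> h (c z)" for z
    proof (rule continuous_on_tendsto_compose[OF cont dyadic_floor_tendsto])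
      show "c z \<ge> 0" "c z \<in> {0..1}" using c01[of z] by auto
      show "\<forall>\<^sub>F n in sequentially. dyadic n (dyadic_floor n (c z)) \<in> {0..1}"
      proof (intro always_eventually allI)
        fix n
        have "dyadic_floor n (c z) \<le> 2 ^ n" using c01[of z] by (intro dyadic_floor_le) auto
        then have "real (dyadic_floor n (c z)) \<le> real (2 ^ n)" by (simp only: of_nat_le_iff)
        then show "dyadic n (dyadic_floor n (c z)) \<in> {0..1}" by simp
      qed
    qed
    show "(\<lambda>n. \<bar>h (dyadic n (dyadic_floor n (c y))) - h (dyadic n (dyadic_floor n (c x)))\<bar>)
        \<longlonglongrightarrow> \<bar>h (c y) - h (c x)\<bar>"
      by (intro tendsto_rabs tendsto_diff t)
    show "\<exists>N. \<forall>n\<ge>N. \<bar>h (dyadic n (dyadic_floor n (c y))) - h (dyadic n (dyadic_floor n (c x)))\<bar>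
        \<le> dyadic_variation h n (c y) - dyadic_variation h n (c x)"
      using dyadic_variation_ge[OF c_mono[OF that]] by blast
  qed
  have contF: "continuous_on UNIV F"
    unfolding continuous_on_iff
  proof (intro ballI allI impI)
    fix x \<epsilon> :: real assume e: "\<epsilon> > 0"
    then have "\<epsilon> / 2 > 0" by simp
    then obtain \<eta> where \<eta>: "\<eta> > 0" "\<And>n S. S \<subseteq> {..<2 ^ n} \<Longrightarrow> real (card S) / 2 ^ n < \<eta> \<Longrightarrow> (\<Sum>i\<in>S. \<bar>dyadic_increment h n i\<bar>) < \<epsilon> / 2"
      using ac unfolding dyadic_ac_def by meson
    have main: "F z - F y \<le> \<epsilon> / 2" if yz: "y \<le> z" "z - y < \<eta> / 2" for y z
    proof (rule LIMSEQ_le_const2)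
      show "(\<lambda>n. dyadic_variation h n (c z) - dyadic_variation h n (c y)) \<longlonglongrightarrow> F z - F y"
        by (intro tendsto_diff lim)
      obtain m where m: "(1/2) ^ m < \<eta> / 2" using real_arch_pow_inv[of "\<eta>/2" "1/2"] \<eta>(1) by auto
      show "\<exists>N. \<forall>n\<ge>N. dyadic_variation h n (c z) - dyadic_variation h n (c y) \<le> \<epsilon> / 2"
      proof (intro exI[of _ m] allI impI)
        fix n assume n: "n \<ge> m"
        let ?S = "{dyadic_floor n (c y)..<dyadic_floor n (c z)}"
        have "dyadic_floor n (c z) \<le> 2 ^ n" using c01[of z] by (intro dyadic_floor_le) auto
        then have S: "?S \<subseteq> {..<2 ^ n}" by auto
        \<comment> \<open>Rounding the end points costs at most one interval, of length (1/2)^n; for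
          n \<ge> m this is below \<eta> / 2.\<close>
        have "real (card ?S) \<le> 2 ^ n * (c z - c y) + 1"
        proof -
          have "real (card ?S) = real (dyadic_floor n (c z)) - real (dyadic_floor n (c y))"
            using dyadic_floor_mono[OF c_mono[OF yz(1)], of n] by (simp add: of_nat_diff)
          then show ?thesis
            using dyadic_floor_bounds(1)[of "c z" n] dyadic_floor_bounds(2)[of "c y" n] c01[of z] c01[of y]
            by (simp add: right_diff_distrib)
        qed
        then have "real (card ?S) / 2 ^ n \<le> (2 ^ n * (c z - c y) + 1) / 2 ^ n" by (rule divide_right_mono) simp
        also have "\<dots> = (c z - c y) + (1/2) ^ n" by (simp add: add_divide_distrib power_divide)
        also have "(1/2::real) ^ n \<le> (1/2) ^ m" using n by (intro power_decreasing) auto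
        also have "c z - c y + (1/2) ^ m < \<eta>" using m c_lip[of z y] yz by simp
        finally have "(\<Sum>i\<in>?S. \<bar>dyadic_increment h n i\<bar>) < \<epsilon> / 2" by (intro \<eta>(2) S) simp
        then show "dyadic_variation h n (c z) - dyadic_variation h n (c y) \<le> \<epsilon> / 2"
          unfolding dyadic_variation_diff[OF c_mono[OF yz(1)]] by simp
      qed
    qed
    show "\<exists>d>0. \<forall>y\<in>UNIV. dist y x < d \<longrightarrow> dist (F y) (F x) < \<epsilon>"
    proof (intro exI[of _ "\<eta> / 2"] conjI ballI impI)
      fix y assume "dist y x < \<eta> / 2"
      then show "dist (F y) (F x) < \<epsilon>"
        using main[of x y] main[of y x] mono[of x y] mono[of y x] e
        by (cases "x \<le> y") (auto simp: dist_real_def abs_if)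
    qed (use \<eta> in simp)
  qed
  \<comment> \<open>Increments of F at level m are limits of variations at levels n \<ge> m. There
    each interval of S splits into k pieces, so the refined index set has the same total length and
    the \<eta> for h works for F; the limit costs strictness, hence \<epsilon> / 2.\<close>
  have acF: "dyadic_ac F"
    unfolding dyadic_ac_def
  proof (intro allI impI)
    fix \<epsilon> :: real assume e: "\<epsilon> > 0"
    then have "\<epsilon> / 2 > 0" by simp
    then obtain \<eta> where \<eta>: "\<eta> > 0" "\<And>n S. S \<subseteq> {..<2 ^ n} \<Longrightarrow> real (card S) / 2 ^ n < \<eta> \<Longrightarrow> (\<Sum>i\<in>S. \<bar>dyadic_increment h n i\<bar>) < \<epsilon> / 2"
      using ac unfolding dyadic_ac_def by meson
    show "\<exists>\<eta>>0. \<forall>n. \<forall>S\<subseteq>{..<2 ^ n}. real (card S) / 2 ^ n < \<eta> \<longrightarrow> (\<Sum>i\<in>S. \<bar>dyadic_increment F n i\<bar>) < \<epsilon>"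
    proof (intro exI[of _ \<eta>] conjI allI impI \<eta>(1))
      fix m :: nat and S :: "nat set" assume S: "S \<subseteq> {..<2 ^ m}" "real (card S) / 2 ^ m < \<eta>"
      have finS: "finite S" using S(1) finite_subset by blast
      have cS: "c (dyadic m i) = dyadic m i" if "i \<le> 2 ^ m" for i
      proof -
        have "real i \<le> real (2 ^ m)" using that by (simp only: of_nat_le_iff)
        then show ?thesis by (intro c_id) simp
      qed
      have le: "dyadic m i \<le> dyadic m (Suc i)" for i by (simp add: divide_right_mono)
      have "(\<Sum>i\<in>S. \<bar>dyadic_increment F m i\<bar>) = (\<Sum>i\<in>S. F (dyadic m (Suc i)) - F (dyadic m i))"
        unfolding dyadic_increment_def using mono[OF le] by (intro sum.cong) auto
      also have "\<dots> \<le> \<epsilon> / 2"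
      proof (rule LIMSEQ_le_const2)
        let ?V = "\<lambda>n i. dyadic_variation h n (c (dyadic m (Suc i))) - dyadic_variation h n (c (dyadic m i))"
        show "(\<lambda>n. \<Sum>i\<in>S. ?V n i) \<longlonglongrightarrow> (\<Sum>i\<in>S. F (dyadic m (Suc i)) - F (dyadic m i))"
          by (intro tendsto_sum tendsto_diff lim)
        show "\<exists>N. \<forall>n\<ge>N. (\<Sum>i\<in>S. ?V n i) \<le> \<epsilon> / 2"
        proof (intro exI[of _ m] allI impI)
          fix n assume n: "n \<ge> m"
          define k :: nat where "k = 2 ^ (n - m)"
          have k: "(2::nat) ^ n = 2 ^ m * k" using n by (simp add: k_def power_add[symmetric])
          have V: "?V n i = (\<Sum>j\<in>{i * k..<Suc i * k}. \<bar>dyadic_increment h n j\<bar>)" if "i \<in> S" for i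
          proof -
            have "i < 2 ^ m" using that S(1) by auto
            show ?thesis
              unfolding cS[OF less_imp_le[OF \<open>i < 2 ^ m\<close>]] cS[OF Suc_leI[OF \<open>i < 2 ^ m\<close>]]
                dyadic_variation_diff[OF le] dyadic_floor_dyadic[OF n] k_def
              by (rule refl)
          qed
          have disj: "{i * k..<Suc i * k} \<inter> {j * k..<Suc j * k} = {}" if "i \<noteq> j" for i j
          proof -
            have *: "{i * k..<Suc i * k} \<inter> {j * k..<Suc j * k} = {}" if "i < j" for i j
            proof -
              have "Suc i * k \<le> j * k" using that by (intro mult_le_mono1) simp
              then show ?thesis by auto
            qed
            show ?thesis using that *[of i j] *[of j i] by (cases i j rule: linorder_cases) blast+
          qed
          have "(\<Sum>i\<in>S. ?V n i) = (\<Sum>i\<in>S. \<Sum>j\<in>{i * k..<Suc i * k}. \<bar>dyadic_increment h n j\<bar>)"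
            by (intro sum.cong refl V)
          also have "\<dots> = (\<Sum>j\<in>(\<Union>i\<in>S. {i * k..<Suc i * k}). \<bar>dyadic_increment h n j\<bar>)"
            using finS disj by (intro sum.UNION_disjoint[symmetric]) auto
          also have "\<dots> < \<epsilon> / 2"
          proof (rule \<eta>(2))
            show "(\<Union>i\<in>S. {i * k..<Suc i * k}) \<subseteq> {..<2 ^ n}"
            proof (intro UN_least)
              fix i assume "i \<in> S"
              then have "Suc i * k \<le> 2 ^ n" unfolding k using S(1) by (intro mult_le_mono1) auto
              then show "{i * k..<Suc i * k} \<subseteq> {..<2 ^ n}" by auto
            qed
            have "card (\<Union>i\<in>S. {i * k..<Suc i * k}) = (\<Sum>i\<in>S. card {i * k..<Suc i * k})"
              using finS disj by (intro card_UN_disjoint) auto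
            then have "card (\<Union>i\<in>S. {i * k..<Suc i * k}) = card S * k" by simp
            moreover have "(2::real) ^ n = 2 ^ m * real k" using arg_cong[OF k, of real] by simp
            ultimately show "real (card (\<Union>i\<in>S. {i * k..<Suc i * k})) / 2 ^ n < \<eta>"
              using S(2) by (simp add: k_def)
          qed
          finally show "(\<Sum>i\<in>S. ?V n i) \<le> \<epsilon> / 2" by simp
        qed
      qed
      finally show "(\<Sum>i\<in>S. \<bar>dyadic_increment F m i\<bar>) < \<epsilon>" using e by simp
    qed
  qed
  define H where "H x = F x + h (c x)" for x
  have monoH: "H x \<le> H y" if "x \<le> y" for x y using hF[OF that] by (simp add: H_def abs_le_iff)
  have contH: "continuous_on UNIV H"
    unfolding H_def[abs_def] using c01
    by (intro continuous_intros contF continuous_on_compose2[OF cont c_cont]) auto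
  have "dyadic_ac (\<lambda>x. h (c x))"
    unfolding dyadic_ac_def
  proof (intro allI impI)
    fix \<epsilon> :: real assume "\<epsilon> > 0"
    then obtain \<eta> where \<eta>: "\<eta> > 0" "\<And>n S. S \<subseteq> {..<2 ^ n} \<Longrightarrow> real (card S) / 2 ^ n < \<eta> \<Longrightarrow> (\<Sum>i\<in>S. \<bar>dyadic_increment h n i\<bar>) < \<epsilon>"
      using ac unfolding dyadic_ac_def by meson
    have eq: "dyadic_increment (\<lambda>x. h (c x)) n i = dyadic_increment h n i" if "i < 2 ^ n" for n i
    proof -
      have "real (Suc i) \<le> real (2 ^ n)" using that by (simp only: of_nat_le_iff Suc_le_eq)
      moreover have "real i \<le> real (2 ^ n)" using that by (simp only: of_nat_le_iff less_imp_le)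
      ultimately have "dyadic n (Suc i) \<in> {0..1}" "dyadic n i \<in> {0..1}" by simp_all
      then show ?thesis by (simp only: dyadic_increment_def c_id)
    qed
    have "(\<Sum>i\<in>S. \<bar>dyadic_increment (\<lambda>x. h (c x)) n i\<bar>) = (\<Sum>i\<in>S. \<bar>dyadic_increment h n i\<bar>)"
      if "S \<subseteq> {..<2 ^ n}" for S n
      using that eq by (intro sum.cong) auto
    then show "\<exists>\<eta>>0. \<forall>n. \<forall>S\<subseteq>{..<2 ^ n}. real (card S) / 2 ^ n < \<eta> \<longrightarrow> (\<Sum>i\<in>S. \<bar>dyadic_increment (\<lambda>x. h (c x)) n i\<bar>) < \<epsilon>"
      using \<eta> by (intro exI[of _ \<eta>]) auto
  qed
  then have acH: "dyadic_ac H" unfolding H_def[abs_def] by (rule dyadic_ac_add[OF acF])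
  obtain f where f: "integrable lborel f" "\<And>t. t \<in> {0..1} \<Longrightarrow> F t = F 0 + set_lebesgue_integral lborel {0..t} f"
    using dyadic_ac_mono_density[OF mono contF acF] by blast
  obtain f' where f': "integrable lborel f'" "\<And>t. t \<in> {0..1} \<Longrightarrow> H t = H 0 + set_lebesgue_integral lborel {0..t} f'"
    using dyadic_ac_mono_density[OF monoH contH acH] by blast
  have "h t = h 0 + set_lebesgue_integral lborel {0..t} (\<lambda>x. f' x - f x)" if t: "t \<in> {0..1}" for t
  proof -
    have "h t = H t - F t" "h 0 = H 0 - F 0" using t by (simp_all add: H_def c_id)
    moreover have "set_lebesgue_integral lborel {0..t} (\<lambda>x. f' x - f x)
      = set_lebesgue_integral lborel {0..t} f' - set_lebesgue_integral lborel {0..t} f"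
      by (rule set_integral_diff; unfold set_integrable_def; intro integrable_mult_indicator f f'; simp)
    ultimately show ?thesis using f(2)[OF t] f'(2)[OF t] by simp
  qed
  moreover have "integrable lborel (\<lambda>x. f' x - f x)" using f f' by simp
  ultimately show ?thesis by blast
qed

text \<open>One and the same g is the density and, almost everywhere, the derivative; thus
  \<open>deriv h\<close> may replace it under integrals.\<close>

theorem absolutely_continuous_AE_derivative:
  assumes "absolutely_continuous_01 h"
  obtains g where "integrable lborel g"
    "\<And>t. t \<in> {0..1} \<Longrightarrow> h t = h 0 + set_lebesgue_integral lborel {0..t} g"
    "AE x in lebesgue. x \<in> {0<..<1} \<longrightarrow> (h has_real_derivative g x) (at x)"
proof -
  obtain g where g: "integrable lborel g" "\<And>t. t \<in> {0..1} \<Longrightarrow> h t = h 0 + set_lebesgue_integral lborel {0..t} g"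
    using absolutely_continuous_density[OF assms] by blast
  have "AE x in lebesgue. x \<in> {0<..<1} \<longrightarrow> (h has_real_derivative g x) (at x)"
    using AE_has_derivative_integral[OF g(1)]
  proof (eventually_elim, intro impI)
    fix x :: real
    assume "x \<in> {0<..<1} \<longrightarrow> ((\<lambda>t. set_lebesgue_integral lborel {0..t} g) has_real_derivative g x) (at x)"
      and x: "x \<in> {0<..<1}"
    then have "((\<lambda>t. h 0 + set_lebesgue_integral lborel {0..t} g) has_real_derivative g x) (at x)"
      by (auto intro!: derivative_eq_intros)
    then show "(h has_real_derivative g x) (at x)"
    proof (rule has_field_derivative_transform_within_open)
      show "h 0 + set_lebesgue_integral lborel {0..t} g = h t" if "t \<in> {0<..<1}" for t
        using that by (intro g(2)[symmetric]) simp
    qed (use x in simp_all)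
  qed
  then show thesis using g that by blast
qed

section \<open>The Cameron-Martin space\<close>

abbreviation leb01 :: "real measure" where
  "leb01 \<equiv> lebesgue_on {0..1}"

lemma finite_measure_leb01: "finite_measure leb01"
  by (rule finite_measure_lebesgue_on) simp

lemma AE_leb01I:
  assumes "AE x in lebesgue. x \<in> {0<..<1} \<longrightarrow> P x"
  shows "AE x in leb01. P x"
proof -
  have "AE x in lebesgue. x \<noteq> 0 \<and> x \<noteq> (1::real)"
    by (intro AE_completion AE_conjI AE_lborel_singleton)
  with assms have "AE x in lebesgue. x \<in> {0..1} \<longrightarrow> P x"
    by eventually_elim (auto simp: less_le)
  then show ?thesis by (simp add: AE_restrict_space_iff)
qed

text \<open>A consequence of the completeness of Lebesgue measure. It gives \<open>deriv\<close> of
  a linear combination, and of the kernel, their measurability, since these are known only up to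
  null sets.\<close>

lemma measurable_leb01_AE:
  fixes f g :: "real \<Rightarrow> real"
  assumes "f \<in> borel_measurable leb01" "AE x in leb01. f x = g x"
  shows "g \<in> borel_measurable leb01"
proof -
  have "(\<lambda>x. if x \<in> {0..1} then f x else 0) \<in> borel_measurable lebesgue"
    using assms(1) by (subst borel_measurable_if) auto
  moreover have "AE x in lebesgue. (if x \<in> {0..1} then f x else 0) = (if x \<in> {0..1} then g x else 0)"
    using assms(2) by (auto simp: AE_restrict_space_iff elim!: eventually_mono)
  ultimately have "(\<lambda>x. if x \<in> {0..1} then g x else 0) \<in> borel_measurable lebesgue"
    by (rule borel_measurable_AE)
  then show ?thesis by (subst (asm) borel_measurable_if) auto
qed

lemma borel_measurable_leb01: "f \<in> borel_measurable borel \<Longrightarrow> f \<in> borel_measurable leb01"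
  by (intro measurable_restrict_space1 measurable_completion) simp

lemma integral_leb01:
  fixes f :: "real \<Rightarrow> real"
  assumes "f \<in> borel_measurable borel"
  shows "(\<integral>x. f x \<partial>leb01) = set_lebesgue_integral lborel {0..1} f"
  using assms by (simp add: integral_restrict_space set_lebesgue_integral_def integral_completion)

lemma cameron_martinD:
  assumes "h \<in> cameron_martin"
  shows "absolutely_continuous_01 h" "h 0 = 0" "t \<notin> {0..1} \<Longrightarrow> h t = 0"
    "square_integrable leb01 (deriv h)"
  using assms by (auto simp: cameron_martin_def)

lemma absolutely_continuous_AE_deriv:
  assumes "absolutely_continuous_01 h"
  shows "AE x in leb01. (h has_real_derivative deriv h x) (at x)"
proof -
  obtain g where "AE x in lebesgue. x \<in> {0<..<1} \<longrightarrow> (h has_real_derivative g x) (at x)"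
    using absolutely_continuous_AE_derivative[OF assms] by blast
  then have "AE x in leb01. (h has_real_derivative g x) (at x)" by (rule AE_leb01I)
  then show ?thesis by eventually_elim (simp add: DERIV_imp_deriv)
qed

lemma cameron_martin_integral:
  assumes h: "h \<in> cameron_martin" and t: "t \<in> {0..1}"
  shows "h t = (\<integral>s. deriv h s * indicator {0<..t} s \<partial>leb01)"
proof -
  obtain g where g: "integrable lborel g" "\<And>t. t \<in> {0..1} \<Longrightarrow> h t = h 0 + set_lebesgue_integral lborel {0..t} g"
    "AE x in lebesgue. x \<in> {0<..<1} \<longrightarrow> (h has_real_derivative g x) (at x)"
    using absolutely_continuous_AE_derivative[OF cameron_martinD(1)[OF h]] by blast
  have mg: "g \<in> borel_measurable borel" using g(1) by simp
  have "AE x in leb01. (h has_real_derivative g x) (at x)" by (rule AE_leb01I[OF g(3)])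
  then have ae: "AE x in leb01. deriv h x = g x" by eventually_elim (rule DERIV_imp_deriv)
  have ind: "(indicator {0<..t} :: real \<Rightarrow> real) \<in> borel_measurable borel" by measurable
  have "(\<integral>s. deriv h s * indicator {0<..t} s \<partial>leb01) = (\<integral>s. g s * indicator {0<..t} s \<partial>leb01)"
  proof (rule integral_cong_AE)
    show "AE s in leb01. deriv h s * indicator {0<..t} s = g s * indicator {0<..t} s"
      using ae by eventually_elim simp
  qed (intro borel_measurable_times borel_measurable_leb01[OF mg] borel_measurable_leb01[OF ind]
      square_integrableD(1)[OF cameron_martinD(4)[OF h]])+
  also have "\<dots> = set_lebesgue_integral lborel {0..1} (\<lambda>s. g s * indicator {0<..t} s)"
    by (intro integral_leb01 borel_measurable_times mg ind)
  also have "\<dots> = set_lebesgue_integral lborel {0..t} g"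
    unfolding set_lebesgue_integral_def
  proof (rule integral_cong_AE)
    show "AE x in lborel. indicator {0..1} x *\<^sub>R (g x * indicator {0<..t} x) = indicator {0..t} x *\<^sub>R g x"
      using AE_lborel_singleton[of 0] by eventually_elim (use t in \<open>auto simp: indicator_def\<close>)
  qed (use mg in measurable)
  finally show ?thesis using g(2)[OF t] cameron_martinD(2)[OF h] by simp
qed

lemma absolutely_continuous_01_lincomb:
  assumes h: "absolutely_continuous_01 h" and k: "absolutely_continuous_01 k"
  shows "absolutely_continuous_01 (\<lambda>t. a * h t + b * k t)"
  unfolding absolutely_continuous_01_def
proof (intro allI impI)
  fix \<epsilon> :: real assume e: "\<epsilon> > 0"
  \<comment> \<open>The summand 1 covers vanishing coefficients and makes the two estimates
    strict.\<close>
  define e1 e2 where "e1 = \<epsilon> / 2 / (\<bar>a\<bar> + 1)" and "e2 = \<epsilon> / 2 / (\<bar>b\<bar> + 1)"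
  have pos: "e1 > 0" "e2 > 0" using e by (simp_all add: e1_def e2_def add_nonneg_pos)
  have ae: "\<bar>a\<bar> * e1 < \<epsilon> / 2" "\<bar>b\<bar> * e2 < \<epsilon> / 2"
  proof -
    have "c * (x / c) = x" if "c \<noteq> 0" for c x :: real using that by simp
    moreover have "\<bar>a\<bar> + 1 \<noteq> 0" "\<bar>b\<bar> + 1 \<noteq> 0" by linarith+
    ultimately have "(\<bar>a\<bar> + 1) * e1 = \<epsilon> / 2" "(\<bar>b\<bar> + 1) * e2 = \<epsilon> / 2"
      unfolding e1_def e2_def by blast+
    then show "\<bar>a\<bar> * e1 < \<epsilon> / 2" "\<bar>b\<bar> * e2 < \<epsilon> / 2" using pos by (simp_all add: distrib_right)
  qed
  obtain d1 where d1: "d1 > 0" "\<And>n u v. \<lbrakk>\<forall>i<n. 0 \<le> u i \<and> u i \<le> v i \<and> v i \<le> 1;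
      disjoint_family_on (\<lambda>i. {u i<..<v i}) {..<n}; (\<Sum>i<n. v i - u i) < d1\<rbrakk> \<Longrightarrow>
      (\<Sum>i<(n::nat). \<bar>h (v i) - h (u i)\<bar>) < e1"
    using h pos(1) unfolding absolutely_continuous_01_def by meson
  obtain d2 where d2: "d2 > 0" "\<And>n u v. \<lbrakk>\<forall>i<n. 0 \<le> u i \<and> u i \<le> v i \<and> v i \<le> 1;
      disjoint_family_on (\<lambda>i. {u i<..<v i}) {..<n}; (\<Sum>i<n. v i - u i) < d2\<rbrakk> \<Longrightarrow>
      (\<Sum>i<(n::nat). \<bar>k (v i) - k (u i)\<bar>) < e2"
    using k pos(2) unfolding absolutely_continuous_01_def by meson
  show "\<exists>\<eta>>0. \<forall>(n::nat) u v. (\<forall>i<n. 0 \<le> u i \<and> u i \<le> v i \<and> v i \<le> 1) \<and>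
      disjoint_family_on (\<lambda>i. {u i<..<v i}) {..<n} \<and> (\<Sum>i<n. v i - u i) < \<eta> \<longrightarrow>
      (\<Sum>i<n. \<bar>a * h (v i) + b * k (v i) - (a * h (u i) + b * k (u i))\<bar>) < \<epsilon>"
  proof (intro exI[of _ "min d1 d2"] conjI allI impI)
    show "min d1 d2 > 0" using d1(1) d2(1) by simp
    fix n :: nat and u v :: "nat \<Rightarrow> real"
    assume A: "(\<forall>i<n. 0 \<le> u i \<and> u i \<le> v i \<and> v i \<le> 1) \<and>
      disjoint_family_on (\<lambda>i. {u i<..<v i}) {..<n} \<and> (\<Sum>i<n. v i - u i) < min d1 d2"
    have "(\<Sum>i<n. \<bar>a * h (v i) + b * k (v i) - (a * h (u i) + b * k (u i))\<bar>)
      \<le> (\<Sum>i<n. \<bar>a\<bar> * \<bar>h (v i) - h (u i)\<bar> + \<bar>b\<bar> * \<bar>k (v i) - k (u i)\<bar>)"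
    proof (rule sum_mono)
      fix i
      have "a * h (v i) + b * k (v i) - (a * h (u i) + b * k (u i)) = a * (h (v i) - h (u i)) + b * (k (v i) - k (u i))"
        by (simp add: algebra_simps)
      then show "\<bar>a * h (v i) + b * k (v i) - (a * h (u i) + b * k (u i))\<bar>
        \<le> \<bar>a\<bar> * \<bar>h (v i) - h (u i)\<bar> + \<bar>b\<bar> * \<bar>k (v i) - k (u i)\<bar>"
        by (metis abs_mult abs_triangle_ineq)
    qed
    also have "\<dots> = \<bar>a\<bar> * (\<Sum>i<n. \<bar>h (v i) - h (u i)\<bar>) + \<bar>b\<bar> * (\<Sum>i<n. \<bar>k (v i) - k (u i)\<bar>)"
      by (simp add: sum.distrib sum_distrib_left)
    also have "\<dots> \<le> \<bar>a\<bar> * e1 + \<bar>b\<bar> * e2"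
      using d1(2)[of n u v] d2(2)[of n u v] A by (intro add_mono mult_left_mono) auto
    also have "\<dots> < \<epsilon>" using ae by simp
    finally show "(\<Sum>i<n. \<bar>a * h (v i) + b * k (v i) - (a * h (u i) + b * k (u i))\<bar>) < \<epsilon>" .
  qed
qed

lemma AE_deriv_lincomb:
  assumes h: "h \<in> cameron_martin" and k: "k \<in> cameron_martin"
  shows "AE x in leb01. a * deriv h x + b * deriv k x = deriv (\<lambda>t. a * h t + b * k t) x"
  using absolutely_continuous_AE_deriv[OF cameron_martinD(1)[OF h]]
    absolutely_continuous_AE_deriv[OF cameron_martinD(1)[OF k]]
proof eventually_elim
  case (elim x)
  then have "((\<lambda>t. a * h t + b * k t) has_real_derivative a * deriv h x + b * deriv k x) (at x)"
    by (intro DERIV_add DERIV_cmult)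
  then show ?case by (rule DERIV_imp_deriv[symmetric])
qed

lemma cameron_martin_lincomb:
  assumes h: "h \<in> cameron_martin" and k: "k \<in> cameron_martin"
  shows "(\<lambda>t. a * h t + b * k t) \<in> cameron_martin"
proof -
  have sq: "square_integrable leb01 (\<lambda>x. a * deriv h x + b * deriv k x)"
    using h k by (intro square_integrable_add square_integrable_cmult cameron_martinD(4))
  then have "square_integrable leb01 (deriv (\<lambda>t. a * h t + b * k t))"
    using AE_deriv_lincomb[OF h k]
    by (intro square_integrable_cong_AE[OF sq] measurable_leb01_AE[OF square_integrableD(1)[OF sq]])
  then show ?thesis
    using cameron_martinD[OF h] cameron_martinD[OF k]
    by (auto simp: cameron_martin_def intro!: absolutely_continuous_01_lincomb)
qed

section \<open>The reproducing kernel of the Cameron-Martin space\<close>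

text \<open>Its derivative is almost everywhere the indicator of (0, t], the integrand whose Wiener
  integral is the evaluation at t. The value 0 outside [0, 1] follows the convention for members of
  H.\<close>

definition cm_kernel :: "real \<Rightarrow> real \<Rightarrow> real" where
  "cm_kernel t s = (if s \<in> {0..1} then min s t else 0)"

lemma cm_kernel_AE_deriv:
  "AE x in leb01. indicator {0<..t} x = deriv (cm_kernel t) x"
proof (rule AE_leb01I)
  have "AE x in lebesgue. x \<noteq> t" by (intro AE_completion AE_lborel_singleton)
  then show "AE x in lebesgue. x \<in> {0<..<1} \<longrightarrow> indicator {0<..t} x = deriv (cm_kernel t) x"
  proof (eventually_elim, intro impI)
    fix x :: real assume xt: "x \<noteq> t" and x: "x \<in> {0<..<1}"
    show "indicator {0<..t} x = deriv (cm_kernel t) x"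
    proof (cases "x < t")
      case True
      have "(cm_kernel t has_real_derivative 1) (at x)"
      proof (rule has_field_derivative_transform_within_open[of "\<lambda>s. s" _ _ "{0<..<min 1 t}"])
        show "((\<lambda>s. s) has_real_derivative 1) (at x)" by (rule DERIV_ident)
      qed (use True x in \<open>auto simp: cm_kernel_def\<close>)
      then show ?thesis using True x by (simp add: DERIV_imp_deriv)
    next
      case False
      have "(cm_kernel t has_real_derivative 0) (at x)"
      proof (rule has_field_derivative_transform_within_open[of "\<lambda>s. t" _ _ "{max 0 t<..<1}"])
        show "((\<lambda>s. t) has_real_derivative 0) (at x)" by (rule DERIV_const)
      qed (use False xt x in \<open>auto simp: cm_kernel_def\<close>)
      then show ?thesis using False xt x by (simp add: DERIV_imp_deriv)
    qed
  qed
qed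

lemma square_integrable_indicator_leb01:
  "S \<in> sets borel \<Longrightarrow> square_integrable leb01 (indicator S)"
  by (rule square_integrable_bounded[OF finite_measure_leb01, of _ 1])
    (auto intro: borel_measurable_leb01 simp: indicator_def)

lemma cm_kernel_cameron_martin:
  assumes t: "t \<in> {0..1}"
  shows "cm_kernel t \<in> cameron_martin"
proof -
  have sq: "square_integrable leb01 (indicator {0<..t})"
    by (rule square_integrable_indicator_leb01) simp
  have "square_integrable leb01 (deriv (cm_kernel t))"
    using cm_kernel_AE_deriv
    by (intro square_integrable_cong_AE[OF sq] measurable_leb01_AE[OF square_integrableD(1)[OF sq]])
  moreover have "absolutely_continuous_01 (cm_kernel t)"
    unfolding absolutely_continuous_01_def
  proof (intro allI impI)
    fix \<epsilon> :: real assume e: "\<epsilon> > 0"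
    show "\<exists>\<eta>>0. \<forall>(n::nat) u v. (\<forall>i<n. 0 \<le> u i \<and> u i \<le> v i \<and> v i \<le> 1) \<and>
      disjoint_family_on (\<lambda>i. {u i<..<v i}) {..<n} \<and> (\<Sum>i<n. v i - u i) < \<eta> \<longrightarrow>
      (\<Sum>i<n. \<bar>cm_kernel t (v i) - cm_kernel t (u i)\<bar>) < \<epsilon>"
    \<comment> \<open>The kernel is 1-Lipschitz on [0, 1], so \<eta> = \<epsilon> works.\<close>
    proof (intro exI[of _ \<epsilon>] conjI allI impI e)
      fix n :: nat and u v :: "nat \<Rightarrow> real"
      assume A: "(\<forall>i<n. 0 \<le> u i \<and> u i \<le> v i \<and> v i \<le> 1) \<and>
        disjoint_family_on (\<lambda>i. {u i<..<v i}) {..<n} \<and> (\<Sum>i<n. v i - u i) < \<epsilon>"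
      have "(\<Sum>i<n. \<bar>cm_kernel t (v i) - cm_kernel t (u i)\<bar>) \<le> (\<Sum>i<n. v i - u i)"
      proof (rule sum_mono)
        fix i assume "i \<in> {..<n}"
        then have "0 \<le> u i" "u i \<le> v i" "v i \<le> 1" using A by auto
        then show "\<bar>cm_kernel t (v i) - cm_kernel t (u i)\<bar> \<le> v i - u i"
          by (auto simp: cm_kernel_def)
      qed
      then show "(\<Sum>i<n. \<bar>cm_kernel t (v i) - cm_kernel t (u i)\<bar>) < \<epsilon>" using A by simp
    qed
  qed
  ultimately show ?thesis using t by (auto simp: cameron_martin_def cm_kernel_def)
qed

lemma cm_inner_kernel:
  assumes "h \<in> cameron_martin" "t \<in> {0..1}"
  shows "cm_inner h (cm_kernel t) = h t"
proof -
  have "cm_inner h (cm_kernel t) = (\<integral>s. deriv h s * indicator {0<..t} s \<partial>leb01)"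
    unfolding cm_inner_def using cm_kernel_AE_deriv[of t]
      square_integrableD(1)[OF cameron_martinD(4)[OF assms(1)]]
      square_integrableD(1)[OF cameron_martinD(4)[OF cm_kernel_cameron_martin[OF assms(2)]]]
      square_integrableD(1)[OF square_integrable_indicator_leb01[of "{0<..t}"]]
    by (intro integral_cong_AE borel_measurable_times) (auto elim!: eventually_mono)
  then show ?thesis using cameron_martin_integral[OF assms] by simp
qed

lemma cm_inner_commute: "cm_inner h k = cm_inner k h"
  by (simp add: cm_inner_def mult.commute)

section \<open>The Wiener integral as an isometry\<close>

lemma abs_cos_diff_le: "\<bar>cos x - cos y\<bar> \<le> \<bar>x - y\<bar>" for x y :: real
proof -
  have "\<bar>cos x - cos y\<bar> = 2 * (\<bar>sin ((x + y) / 2)\<bar> * \<bar>sin ((y - x) / 2)\<bar>)"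
    by (simp add: cos_diff_cos abs_mult)
  also have "\<dots> \<le> 2 * (1 * \<bar>(y - x) / 2\<bar>)"
    by (intro mult_left_mono mult_mono abs_sin_x_le_abs_x) auto
  finally show ?thesis by (simp add: abs_minus_commute)
qed

context prob_space
begin

text \<open>For the last claim, cos (X + c) is the real part of exp (i c) exp (i X), and the
  expectation of exp (i X) is the characteristic function of the standard normal X / \<sigma> at
  \<sigma>.\<close>

lemma normal_moments:
  assumes \<sigma>: "\<sigma> > 0" and D: "distributed M lborel X (\<lambda>x. ennreal (normal_density 0 \<sigma> x))"
  shows "square_integrable M X" "expectation X = 0" "(\<integral>w. (X w)\<^sup>2 \<partial>M) = \<sigma>\<^sup>2"
    "(\<integral>w. cos (X w + c) \<partial>M) = cos c * exp (- \<sigma>\<^sup>2 / 2)"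
proof -
  have mX: "X \<in> borel_measurable M" using distributed_measurable[OF D] by simp
  have "integrable lborel (\<lambda>x. normal_density 0 \<sigma> x * x\<^sup>2)"
    using integrable_normal_moment[OF \<sigma>, of 0 2] by simp
  then have "integrable M (\<lambda>w. (X w)\<^sup>2)"
    using distributed_integrable[OF D, of "\<lambda>x. x\<^sup>2"] by simp
  then show "square_integrable M X" using mX by (simp add: square_integrable_def)
  show E: "expectation X = 0" by (rule normal_distributed_expectation[OF \<sigma> D])
  show "(\<integral>w. (X w)\<^sup>2 \<partial>M) = \<sigma>\<^sup>2" using normal_distributed_variance[OF \<sigma> D] E by simp
  have "distributed M lborel (\<lambda>w. X w / \<sigma>) (\<lambda>x. ennreal (std_normal_density x))"
    using normal_standard_normal_convert[OF \<sigma>, of X 0] D by simp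
  then have "distr M lborel (\<lambda>w. X w / \<sigma>) = std_normal_distribution"
    by (rule distributed_distr_eq_density)
  then have "char (distr M lborel (\<lambda>w. X w / \<sigma>)) \<sigma> = complex_of_real (exp (- \<sigma>\<^sup>2 / 2))"
    by (simp add: char_std_normal_distribution)
  moreover have "char (distr M lborel (\<lambda>w. X w / \<sigma>)) \<sigma> = (\<integral>w. iexp (X w) \<partial>M)"
    unfolding char_def using mX \<sigma> by (subst integral_distr) auto
  ultimately have ch: "(\<integral>w. iexp (X w) \<partial>M) = complex_of_real (exp (- \<sigma>\<^sup>2 / 2))" by simp
  have int: "complex_integrable M (\<lambda>w. iexp (X w))"
    using mX by (intro integrable_const_bound[where B=1]) auto
  have eq: "cos (X w + c) = Re (iexp c * iexp (X w))" for w
    by (simp add: exp_add[symmetric] distrib_left[symmetric] Re_exp add.commute)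
  have "(\<integral>w. cos (X w + c) \<partial>M) = Re (\<integral>w. iexp c * iexp (X w) \<partial>M)"
    unfolding eq using int by (intro integral_Re) simp
  also have "(\<integral>w. iexp c * iexp (X w) \<partial>M) = iexp c * (\<integral>w. iexp (X w) \<partial>M)"
    by (rule integral_mult_right_zero)
  finally show "(\<integral>w. cos (X w + c) \<partial>M) = cos c * exp (- \<sigma>\<^sup>2 / 2)"
    by (simp add: ch Re_exp)
qed

end

section \<open>Dyadic step functions and their integrals\<close>

text \<open>A relation, because a step function is represented at many levels: no choice of
  representation has to be made and none proved irrelevant.\<close>

definition dyadic_pair :: "(real \<Rightarrow> real) \<Rightarrow> ((real \<Rightarrow> real) \<Rightarrow> real) \<Rightarrow> bool" where
  "dyadic_pair \<phi> Y \<longleftrightarrow> (\<exists>k a. \<phi> = step_function (2 ^ k) (dyadic k) a \<and> Y = step_integral (2 ^ k) (dyadic k) a)"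

lemma dyadic_in_01: "i \<le> 2 ^ k \<Longrightarrow> dyadic k i \<in> {0..1}"
  using dyadic_le_1[of i k] by simp

lemma partition_dyadic: "partition_01 (2 ^ k) (dyadic k)"
  by (auto simp: partition_01_def divide_strict_right_mono)

lemma step_function_mult:
  "step_function (2 ^ k) (dyadic k) a s * step_function (2 ^ k) (dyadic k) b s
    = step_function (2 ^ k) (dyadic k) (\<lambda>i. a i * b i) s"
proof -
  let ?J = "\<lambda>i. indicator {dyadic k i<..dyadic k (Suc i)} s :: real"
  have J: "?J i * ?J j = (if i = j then ?J i else 0)" for i j
    using dyadic_interval_disjoint[of i j k] by (auto simp: indicator_def)
  have "step_function (2 ^ k) (dyadic k) a s * step_function (2 ^ k) (dyadic k) b s
    = (\<Sum>i<2 ^ k. \<Sum>j<2 ^ k. a i * b j * (?J i * ?J j))"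
    unfolding step_function_def sum_product by (intro sum.cong refl) (simp add: mult_ac)
  also have "\<dots> = (\<Sum>i<2 ^ k. a i * b i * ?J i)"
    unfolding J by (intro sum.cong refl) (simp add: if_distrib[of "\<lambda>x. _ * x"] sum.delta cong: if_cong)
  finally show ?thesis by (simp add: step_function_def)
qed

text \<open>At d levels further down, interval i lies in the former interval i div 2^d and keeps its
  coefficient. Levels k and l therefore meet at k + l, and general partitions need not be
  merged.\<close>

lemma step_refine:
  "step_function (2 ^ k) (dyadic k) a = step_function (2 ^ (k + d)) (dyadic (k + d)) (\<lambda>i. a (i div 2 ^ d))"
  "step_integral (2 ^ k) (dyadic k) a = step_integral (2 ^ (k + d)) (dyadic (k + d)) (\<lambda>i. a (i div 2 ^ d))"
proof (induction d)
  case (Suc d)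
  let ?K = "k + d" and ?a = "\<lambda>i. a (i div 2 ^ d)"
  have e0: "dyadic (Suc ?K) (2 * i) = dyadic ?K i" for i by simp
  have e2: "dyadic (Suc ?K) (Suc (Suc (2 * i))) = dyadic ?K (Suc i)" for i by (simp add: field_simps)
  have pairs: "(\<Sum>i<2 ^ Suc m. f i) = (\<Sum>i<2 ^ m. f (2 * i) + f (Suc (2 * i)) :: real)" for f m
    by (simp add: sum_pairs)
  have d: "(2 * i) div 2 ^ Suc d = i div 2 ^ d" "Suc (2 * i) div 2 ^ Suc d = i div 2 ^ d" for i :: nat
    by (simp_all add: div_mult2_eq)
  have "step_function (2 ^ Suc ?K) (dyadic (Suc ?K)) (\<lambda>i. a (i div 2 ^ Suc d)) s = step_function (2 ^ ?K) (dyadic ?K) ?a s" for s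
  proof -
    have ind: "indicator {dyadic (Suc ?K) (2 * i)<..dyadic (Suc ?K) (Suc (2 * i))} s
      + indicator {dyadic (Suc ?K) (Suc (2 * i))<..dyadic (Suc ?K) (Suc (Suc (2 * i)))} s
      = (indicator {dyadic ?K i<..dyadic ?K (Suc i)} s :: real)" for i
      using dyadic_mono[of "2 * i" "Suc (2 * i)" "Suc ?K"] dyadic_mono[of "Suc (2 * i)" "Suc (Suc (2 * i))" "Suc ?K"]
      unfolding e0 e2 by (auto simp: indicator_def simp del: of_nat_Suc)
    show ?thesis unfolding step_function_def pairs d distrib_left[symmetric] ind ..
  qed
  moreover have "step_integral (2 ^ Suc ?K) (dyadic (Suc ?K)) (\<lambda>i. a (i div 2 ^ Suc d)) w = step_integral (2 ^ ?K) (dyadic ?K) ?a w" for w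
    unfolding step_integral_def pairs d distrib_left[symmetric] e0 e2 by (intro sum.cong refl) simp
  ultimately show
    "step_function (2 ^ k) (dyadic k) a = step_function (2 ^ (k + Suc d)) (dyadic (k + Suc d)) (\<lambda>i. a (i div 2 ^ Suc d))"
    "step_integral (2 ^ k) (dyadic k) a = step_integral (2 ^ (k + Suc d)) (dyadic (k + Suc d)) (\<lambda>i. a (i div 2 ^ Suc d))"
    unfolding Suc.IH add_Suc_right by auto
qed simp_all

lemma step_common_level:
  obtains m a' b' where
    "step_function (2 ^ k) (dyadic k) a = step_function (2 ^ m) (dyadic m) a'"
    "step_integral (2 ^ k) (dyadic k) a = step_integral (2 ^ m) (dyadic m) a'"
    "step_function (2 ^ l) (dyadic l) b = step_function (2 ^ m) (dyadic m) b'"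
    "step_integral (2 ^ l) (dyadic l) b = step_integral (2 ^ m) (dyadic m) b'"
  using step_refine[of k a l] step_refine[of l b k] by (metis add.commute)

lemma dyadic_pair_lincomb:
  assumes "dyadic_pair \<phi> Y" "dyadic_pair \<psi> Z"
  shows "dyadic_pair (\<lambda>s. \<alpha> * \<phi> s + \<beta> * \<psi> s) (\<lambda>w. \<alpha> * Y w + \<beta> * Z w)"
proof -
  obtain k a l b where *: "\<phi> = step_function (2 ^ k) (dyadic k) a" "Y = step_integral (2 ^ k) (dyadic k) a"
    "\<psi> = step_function (2 ^ l) (dyadic l) b" "Z = step_integral (2 ^ l) (dyadic l) b"
    using assms unfolding dyadic_pair_def by blast
  obtain m a' b' where m: "\<phi> = step_function (2 ^ m) (dyadic m) a'" "Y = step_integral (2 ^ m) (dyadic m) a'"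
    "\<psi> = step_function (2 ^ m) (dyadic m) b'" "Z = step_integral (2 ^ m) (dyadic m) b'"
    unfolding * by (rule step_common_level)
  have "(\<lambda>s. \<alpha> * \<phi> s + \<beta> * \<psi> s) = step_function (2 ^ m) (dyadic m) (\<lambda>i. \<alpha> * a' i + \<beta> * b' i)"
    unfolding m step_function_def
    by (rule ext) (simp only: sum_distrib_left sum.distrib[symmetric] distrib_right mult.assoc)
  moreover have "(\<lambda>w. \<alpha> * Y w + \<beta> * Z w) = step_integral (2 ^ m) (dyadic m) (\<lambda>i. \<alpha> * a' i + \<beta> * b' i)"
    unfolding m step_integral_def
    by (rule ext) (simp only: sum_distrib_left sum.distrib[symmetric] distrib_right mult.assoc)
  ultimately show ?thesis unfolding dyadic_pair_def by blast
qed

lemma integral_indicator_leb01: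
  assumes "0 \<le> a" "a \<le> b" "b \<le> 1"
  shows "(\<integral>s. indicator {a<..b} s \<partial>leb01) = b - a"
proof -
  have "(\<integral>s. indicator {a<..b} s \<partial>leb01) = set_lebesgue_integral lborel {0..1} (indicat_real {a<..b})"
    by (rule integral_leb01) measurable
  also have "\<dots> = (\<integral>s. indicator {a<..b} s \<partial>lborel)"
    unfolding set_lebesgue_integral_def using assms
    by (intro Bochner_Integration.integral_cong) (auto simp: indicator_def)
  also have "\<dots> = b - a" using assms by simp
  finally show ?thesis .
qed

lemma step_function_measurable: "step_function n t a \<in> borel_measurable borel"
  unfolding step_function_def[abs_def] by measurable

lemma step_function_square_integrable: "square_integrable leb01 (step_function n t a)"
  unfolding step_function_def[abs_def]
  by (intro square_integrable_sum square_integrable_cmult square_integrable_indicator_leb01) simp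

lemma integral_step_function_square:
  "(\<integral>s. (step_function (2 ^ k) (dyadic k) a s)\<^sup>2 \<partial>leb01) = (\<Sum>i<2 ^ k. (a i)\<^sup>2 / 2 ^ k)"
proof -
  have "(\<integral>s. (step_function (2 ^ k) (dyadic k) a s)\<^sup>2 \<partial>leb01)
    = (\<integral>s. (\<Sum>i<2 ^ k. (a i)\<^sup>2 * indicator {dyadic k i<..dyadic k (Suc i)} s) \<partial>leb01)"
    unfolding power2_eq_square step_function_mult by (simp only: step_function_def)
  also have "\<dots> = (\<Sum>i<2 ^ k. \<integral>s. (a i)\<^sup>2 * indicator {dyadic k i<..dyadic k (Suc i)} s \<partial>leb01)"
    by (intro Bochner_Integration.integral_sum integrable_mult_right
        square_integrable_integrable[OF finite_measure_leb01] square_integrable_indicator_leb01) simp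
  also have "\<dots> = (\<Sum>i<2 ^ k. (a i)\<^sup>2 / 2 ^ k)"
  proof (rule sum.cong[OF refl])
    fix i :: nat assume "i \<in> {..<2 ^ k}"
    then have "(\<integral>s. indicator {dyadic k i<..dyadic k (Suc i)} s \<partial>leb01) = dyadic k (Suc i) - dyadic k i"
      by (intro integral_indicator_leb01 dyadic_mono dyadic_le_1) auto
    also have "\<dots> = 1 / 2 ^ k" by (simp add: diff_divide_distrib[symmetric])
    finally show "(\<integral>s. (a i)\<^sup>2 * indicator {dyadic k i<..dyadic k (Suc i)} s \<partial>leb01) = (a i)\<^sup>2 / 2 ^ k"
      by simp
  qed
  finally show ?thesis .
qed

locale wiener =
  fixes \<mu> :: "(real \<Rightarrow> real) measure"
  assumes wiener: "wiener_measure \<mu>"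
begin

sublocale prob_space \<mu>
  using wiener by (simp add: wiener_measure_def)

lemma space_wiener: "space \<mu> = wiener_paths"
  and sets_wiener: "sets \<mu> = sigma_sets wiener_paths
      {{w \<in> wiener_paths. w t \<in> A} | t A. t \<in> {0..1} \<and> A \<in> sets (borel :: real measure)}"
  and increment_distributed: "0 \<le> s \<Longrightarrow> s < t \<Longrightarrow> t \<le> 1 \<Longrightarrow>
      distributed \<mu> lborel (\<lambda>w. w t - w s) (\<lambda>x. ennreal (normal_density 0 (sqrt (t - s)) x))"
  and increments_indep: "partition_01 n p \<Longrightarrow> indep_vars (\<lambda>_. borel) (\<lambda>i w. w (p (Suc i)) - w (p i)) {..<n}"
  using wiener by (simp_all add: wiener_measure_def partition_01_def)

lemma path_zero: "w \<in> space \<mu> \<Longrightarrow> w 0 = 0"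
  by (simp add: space_wiener wiener_paths_def)

lemma evaluation_measurable:
  assumes "t \<in> {0..1}"
  shows "(\<lambda>w. w t) \<in> borel_measurable \<mu>"
proof (rule measurableI)
  fix A :: "real set" assume "A \<in> sets borel"
  then have "{w \<in> wiener_paths. w t \<in> A} \<in> sets \<mu>" unfolding sets_wiener using assms by blast
  moreover have "(\<lambda>w. w t) -` A \<inter> space \<mu> = {w \<in> wiener_paths. w t \<in> A}" by (auto simp: space_wiener)
  ultimately show "(\<lambda>w. w t) -` A \<inter> space \<mu> \<in> sets \<mu>" by simp
qed simp

lemma increment_square:
  assumes "0 \<le> s" "s \<le> t" "t \<le> 1"
  shows "square_integrable \<mu> (\<lambda>w. w t - w s)" "(\<integral>w. (w t - w s)\<^sup>2 \<partial>\<mu>) = t - s"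
proof -
  have "square_integrable \<mu> (\<lambda>w. w t - w s) \<and> (\<integral>w. (w t - w s)\<^sup>2 \<partial>\<mu>) = t - s"
  proof (cases "s = t")
    case True then show ?thesis by (simp add: square_integrable_def)
  next
    case False
    then have "0 < sqrt (t - s)" using assms by simp
    from normal_moments(1,3)[OF this increment_distributed] show ?thesis using assms False by simp
  qed
  then show "square_integrable \<mu> (\<lambda>w. w t - w s)" "(\<integral>w. (w t - w s)\<^sup>2 \<partial>\<mu>) = t - s" by auto
qed

lemma dyadic_pair_moments:
  assumes "dyadic_pair \<phi> Y"
  shows "square_integrable \<mu> Y" "expectation Y = 0"
    "(\<integral>w. (Y w)\<^sup>2 \<partial>\<mu>) = (\<integral>s. (\<phi> s)\<^sup>2 \<partial>leb01)"
    "(\<integral>w. cos (Y w + c) \<partial>\<mu>) = cos c * exp (- (\<integral>s. (\<phi> s)\<^sup>2 \<partial>leb01) / 2)"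
proof -
  obtain k a where ka: "\<phi> = step_function (2 ^ k) (dyadic k) a" "Y = step_integral (2 ^ k) (dyadic k) a"
    using assms unfolding dyadic_pair_def by blast
  \<comment> \<open>A normal density needs a positive deviation, so zero coefficients are dropped;
    if none is left, Y = 0.\<close>
  define I where "I = {i\<in>{..<2 ^ k}. a i \<noteq> 0}"
  define v where "v = (\<Sum>i\<in>I. (a i)\<^sup>2 / 2 ^ k)"
  have Q: "(\<integral>s. (\<phi> s)\<^sup>2 \<partial>leb01) = v"
    unfolding ka integral_step_function_square v_def I_def by (rule sum.mono_neutral_right) auto
  have Y: "Y w = (\<Sum>i\<in>I. a i * (w (dyadic k (Suc i)) - w (dyadic k i)))" for w
    unfolding ka step_integral_def I_def by (rule sum.mono_neutral_right) auto
  have "square_integrable \<mu> Y \<and> expectation Y = 0 \<and> (\<integral>w. (Y w)\<^sup>2 \<partial>\<mu>) = v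
    \<and> (\<integral>w. cos (Y w + c) \<partial>\<mu>) = cos c * exp (- v / 2)"
  proof (cases "I = {}")
    case True
    then have "Y = (\<lambda>_. 0)" "v = 0" by (auto simp: Y v_def)
    then show ?thesis by (simp add: square_integrable_def prob_space)
  next
    case False
    have fin: "finite I" by (simp add: I_def)
    have "indep_vars (\<lambda>_. borel) (\<lambda>i w. w (dyadic k (Suc i)) - w (dyadic k i)) {..<2 ^ k}"
      by (rule increments_indep[OF partition_dyadic])
    then have "indep_vars (\<lambda>_. borel) (\<lambda>i w. w (dyadic k (Suc i)) - w (dyadic k i)) I"
      by (rule indep_vars_subset) (auto simp: I_def)
    then have ind: "indep_vars (\<lambda>_. borel) (\<lambda>i w. a i * (w (dyadic k (Suc i)) - w (dyadic k i))) I"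
      by (rule indep_vars_compose2[where Y="\<lambda>i x. a i * x"]) auto
    have nrm: "distributed \<mu> lborel (\<lambda>w. a i * (w (dyadic k (Suc i)) - w (dyadic k i)))
      (\<lambda>x. ennreal (normal_density 0 (\<bar>a i\<bar> * sqrt (1 / 2 ^ k)) x))" if "i \<in> I" for i
    proof -
      have i: "i < 2 ^ k" "a i \<noteq> 0" using that by (auto simp: I_def)
      have eq: "dyadic k (Suc i) - dyadic k i = 1 / 2 ^ k" by (simp add: diff_divide_distrib[symmetric])
      have "dyadic k i < dyadic k (Suc i)" by (simp add: divide_strict_right_mono)
      then have "distributed \<mu> lborel (\<lambda>w. w (dyadic k (Suc i)) - w (dyadic k i))
         (\<lambda>x. ennreal (normal_density 0 (sqrt (1 / 2 ^ k)) x))"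
        using increment_distributed[of "dyadic k i" "dyadic k (Suc i)"] dyadic_le_1[of "Suc i" k] i(1)
        unfolding eq by (simp del: of_nat_Suc)
      from normal_density_affine[OF this _ i(2), of 0] show ?thesis by simp
    qed
    have "distributed \<mu> lborel (\<lambda>w. \<Sum>i\<in>I. a i * (w (dyadic k (Suc i)) - w (dyadic k i)))
      (\<lambda>x. ennreal (normal_density (\<Sum>i\<in>I. 0) (sqrt (\<Sum>i\<in>I. (\<bar>a i\<bar> * sqrt (1 / 2 ^ k))\<^sup>2)) x))"
      by (rule sum_indep_normal[OF fin False ind _ nrm]) (auto simp: I_def)
    moreover have "(\<Sum>i\<in>I. (\<bar>a i\<bar> * sqrt (1 / 2 ^ k))\<^sup>2) = v"
      unfolding v_def by (intro sum.cong refl) (simp add: power_mult_distrib)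
    ultimately have D: "distributed \<mu> lborel Y (\<lambda>x. ennreal (normal_density 0 (sqrt v) x))"
      unfolding Y[abs_def] by simp
    have v: "v > 0" unfolding v_def by (intro sum_pos fin False) (auto simp: I_def)
    from normal_moments(1-3)[OF _ D] normal_moments(4)[OF _ D, of c] v show ?thesis by simp
  qed
  then show "square_integrable \<mu> Y" "expectation Y = 0"
    "(\<integral>w. (Y w)\<^sup>2 \<partial>\<mu>) = (\<integral>s. (\<phi> s)\<^sup>2 \<partial>leb01)"
    "(\<integral>w. cos (Y w + c) \<partial>\<mu>) = cos c * exp (- (\<integral>s. (\<phi> s)\<^sup>2 \<partial>leb01) / 2)"
    unfolding Q by auto
qed

lemma dyadic_pair_square_integrable: "dyadic_pair \<phi> Y \<Longrightarrow> square_integrable leb01 \<phi>"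
  unfolding dyadic_pair_def using step_function_square_integrable by blast

end

lemma step_function_initial:
  assumes "m \<le> 2 ^ k"
  shows "step_function (2 ^ k) (dyadic k) (\<lambda>i. if i < m then 1 else 0) = indicator {0<..dyadic k m}"
    "step_integral (2 ^ k) (dyadic k) (\<lambda>i. if i < m then 1 else 0) w = w (dyadic k m) - w 0"
proof -
  have sub: "(\<Sum>i<2 ^ k. (if i < m then 1 else 0) * f i) = (\<Sum>i<m. f i :: real)" for f
  proof -
    have "(\<Sum>i<2 ^ k. (if i < m then 1 else 0) * f i) = (\<Sum>i<2^k. if i \<in> {..<m} then f i else 0)"
      by (intro sum.cong) auto
    also have "\<dots> = (\<Sum>i\<in>{..<2^k} \<inter> {..<m}. f i)" by (subst sum.inter_restrict) auto
    also have "{..<2^k} \<inter> {..<m} = {..<m}" using assms by auto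
    finally show ?thesis .
  qed
  show "step_integral (2 ^ k) (dyadic k) (\<lambda>i. if i < m then 1 else 0) w = w (dyadic k m) - w 0"
    unfolding step_integral_def sub using sum_lessThan_telescope[of "\<lambda>i. w (dyadic k i)" m] by simp
  have "(\<Sum>i<m. indicator {dyadic k i<..dyadic k (Suc i)} s :: real) = indicator {0<..dyadic k m} s" for s
  proof (induction m)
    case (Suc m)
    have "indicator {0<..a} s + indicator {a<..b} s = indicat_real {0<..b} s" if "0 \<le> a" "a \<le> b" for a b
      using that by (auto simp: indicator_def)
    from this[OF _ dyadic_mono[of m "Suc m" k]] show ?case using Suc by simp
  qed simp
  then show "step_function (2 ^ k) (dyadic k) (\<lambda>i. if i < m then 1 else 0) = indicator {0<..dyadic k m}"
    unfolding step_function_def sub by (rule ext)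
qed

lemma partition_in_01:
  assumes "partition_01 n t" "i \<le> n"
  shows "t i \<in> {0..1}"
proof -
  have mono: "t j \<le> t k" if "j \<le> k" "k \<le> n" for j k
    using that by (induction k rule: dec_induct)
      (use assms(1) in \<open>auto simp: partition_01_def intro: order_trans[OF _ less_imp_le]\<close>)
  show ?thesis using mono[of 0 i] mono[of i n] assms by (auto simp: partition_01_def)
qed

section \<open>The graph of the Wiener integral\<close>

context wiener
begin

text \<open>The closure in L2 x L2 of the graph formed by the dyadic pairs. As a relation it
  contains all versions of g and of its integral, and its closedness reduces every property to
  dyadic step functions.\<close>

definition wiener_pair :: "(real \<Rightarrow> real) \<Rightarrow> ((real \<Rightarrow> real) \<Rightarrow> real) \<Rightarrow> bool" where
  "wiener_pair g X \<longleftrightarrow> square_integrable leb01 g \<and> square_integrable \<mu> X \<and>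
    (\<forall>\<epsilon>>0. \<exists>\<phi> Y. dyadic_pair \<phi> Y \<and> (\<integral>s. (\<phi> s - g s)\<^sup>2 \<partial>leb01) < \<epsilon> \<and> (\<integral>w. (Y w - X w)\<^sup>2 \<partial>\<mu>) < \<epsilon>)"

lemma wiener_pair_square_integrable:
  assumes "wiener_pair g X"
  shows "square_integrable leb01 g" "square_integrable \<mu> X"
  using assms by (auto simp: wiener_pair_def)

lemma wiener_pair_sequence:
  assumes "wiener_pair g X"
  obtains \<phi> Y where "\<And>n. dyadic_pair (\<phi> n) (Y n)" "L2_tendsto leb01 \<phi> g" "L2_tendsto \<mu> Y X"
proof -
  have "\<forall>n. \<exists>\<phi> Y. dyadic_pair \<phi> Y \<and> (\<integral>s. (\<phi> s - g s)\<^sup>2 \<partial>leb01) < inverse (real (Suc n))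
      \<and> (\<integral>w. (Y w - X w)\<^sup>2 \<partial>\<mu>) < inverse (real (Suc n))"
    using assms unfolding wiener_pair_def by simp
  from choice[OF this] obtain \<phi> where "\<forall>n. \<exists>Y. dyadic_pair (\<phi> n) Y
      \<and> (\<integral>s. (\<phi> n s - g s)\<^sup>2 \<partial>leb01) < inverse (real (Suc n))
      \<and> (\<integral>w. (Y w - X w)\<^sup>2 \<partial>\<mu>) < inverse (real (Suc n))" ..
  from choice[OF this] obtain Y where Y: "\<forall>n. dyadic_pair (\<phi> n) (Y n)
      \<and> (\<integral>s. (\<phi> n s - g s)\<^sup>2 \<partial>leb01) < inverse (real (Suc n))
      \<and> (\<integral>w. (Y n w - X w)\<^sup>2 \<partial>\<mu>) < inverse (real (Suc n))" ..
  then have *: "dyadic_pair (\<phi> n) (Y n)" "(\<integral>s. (\<phi> n s - g s)\<^sup>2 \<partial>leb01) < inverse (real (Suc n))"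
    "(\<integral>w. (Y n w - X w)\<^sup>2 \<partial>\<mu>) < inverse (real (Suc n))" for n by blast+
  have "(\<lambda>n. \<integral>s. (\<phi> n s - g s)\<^sup>2 \<partial>leb01) \<longlonglongrightarrow> 0"
    by (rule Lim_null_comparison[OF _ LIMSEQ_inverse_real_of_nat])
      (intro always_eventually allI, use *(2) in \<open>simp add: less_imp_le del: of_nat_Suc\<close>)
  moreover have "(\<lambda>n. \<integral>w. (Y n w - X w)\<^sup>2 \<partial>\<mu>) \<longlonglongrightarrow> 0"
    by (rule Lim_null_comparison[OF _ LIMSEQ_inverse_real_of_nat])
      (intro always_eventually allI, use *(3) in \<open>simp add: less_imp_le del: of_nat_Suc\<close>)
  ultimately have "L2_tendsto leb01 \<phi> g" "L2_tendsto \<mu> Y X"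
    using dyadic_pair_square_integrable[OF *(1)] dyadic_pair_moments(1)[OF *(1)]
      wiener_pair_square_integrable[OF assms] by (auto simp: L2_tendsto_def)
  with *(1) show thesis by (rule that)
qed

lemma wiener_pair_limit:
  assumes pair: "\<And>n. wiener_pair (g n) (X n)"
    and g: "L2_tendsto leb01 g g'" and X: "L2_tendsto \<mu> X X'"
  shows "wiener_pair g' X'"
  unfolding wiener_pair_def
proof (intro conjI allI impI)
  show sg: "square_integrable leb01 g'" and sX: "square_integrable \<mu> X'"
    using g X by (auto simp: L2_tendsto_def)
  fix \<epsilon> :: real assume e: "\<epsilon> > 0"
  \<comment> \<open>Two errors below \<epsilon> / 4 combine to one below \<epsilon>, since the
    inequality for sums doubles each of them.\<close>
  then have e4: "\<epsilon> / 4 > 0" by simp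
  have "\<forall>\<^sub>F n in sequentially. (\<integral>s. (g n s - g' s)\<^sup>2 \<partial>leb01) < \<epsilon> / 4 \<and> (\<integral>w. (X n w - X' w)\<^sup>2 \<partial>\<mu>) < \<epsilon> / 4"
    using g X e4 unfolding L2_tendsto_def by (intro eventually_conj order_tendstoD(2)) auto
  then obtain n where n: "(\<integral>s. (g n s - g' s)\<^sup>2 \<partial>leb01) < \<epsilon> / 4" "(\<integral>w. (X n w - X' w)\<^sup>2 \<partial>\<mu>) < \<epsilon> / 4"
    by (auto simp: eventually_sequentially)
  obtain \<phi> Y where p: "dyadic_pair \<phi> Y" "(\<integral>s. (\<phi> s - g n s)\<^sup>2 \<partial>leb01) < \<epsilon> / 4" "(\<integral>w. (Y w - X n w)\<^sup>2 \<partial>\<mu>) < \<epsilon> / 4"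
    using pair[of n] e4 unfolding wiener_pair_def by blast
  have "(\<integral>s. (\<phi> s - g' s)\<^sup>2 \<partial>leb01) < \<epsilon>"
    using integral_power2_add_le[OF square_integrable_diff[OF dyadic_pair_square_integrable[OF p(1)] wiener_pair_square_integrable(1)[OF pair]]
      square_integrable_diff[OF wiener_pair_square_integrable(1)[OF pair] sg], of n n] n(1) p(2) by simp
  moreover have "(\<integral>w. (Y w - X' w)\<^sup>2 \<partial>\<mu>) < \<epsilon>"
    using integral_power2_add_le[OF square_integrable_diff[OF dyadic_pair_moments(1)[OF p(1)] wiener_pair_square_integrable(2)[OF pair]]
      square_integrable_diff[OF wiener_pair_square_integrable(2)[OF pair] sX], of n n] n(2) p(3) by simp
  ultimately show "\<exists>\<phi> Y. dyadic_pair \<phi> Y \<and> (\<integral>s. (\<phi> s - g' s)\<^sup>2 \<partial>leb01) < \<epsilon> \<and> (\<integral>w. (Y w - X' w)\<^sup>2 \<partial>\<mu>) < \<epsilon>"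
    using p(1) by blast
qed

lemma dyadic_wiener_pair:
  assumes "dyadic_pair \<phi> Y"
  shows "wiener_pair \<phi> Y"
proof -
  have "(\<integral>s. (\<phi> s - \<phi> s)\<^sup>2 \<partial>leb01) < \<epsilon>" "(\<integral>w. (Y w - Y w)\<^sup>2 \<partial>\<mu>) < \<epsilon>" if "\<epsilon> > 0" for \<epsilon>
    using that by simp_all
  then show ?thesis
    unfolding wiener_pair_def
    using assms dyadic_pair_square_integrable[OF assms] dyadic_pair_moments(1)[OF assms] by blast
qed

lemma wiener_pair_lincomb:
  assumes "wiener_pair g X" "wiener_pair h Z"
  shows "wiener_pair (\<lambda>s. \<alpha> * g s + \<beta> * h s) (\<lambda>w. \<alpha> * X w + \<beta> * Z w)"
proof -
  obtain \<phi> Y where 1: "\<And>n. dyadic_pair (\<phi> n) (Y n)" "L2_tendsto leb01 \<phi> g" "L2_tendsto \<mu> Y X"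
    using wiener_pair_sequence[OF assms(1)] by blast
  obtain \<psi> Y' where 2: "\<And>n. dyadic_pair (\<psi> n) (Y' n)" "L2_tendsto leb01 \<psi> h" "L2_tendsto \<mu> Y' Z"
    using wiener_pair_sequence[OF assms(2)] by blast
  show ?thesis
  proof (rule wiener_pair_limit[where g="\<lambda>n s. \<alpha> * \<phi> n s + \<beta> * \<psi> n s"
        and X="\<lambda>n w. \<alpha> * Y n w + \<beta> * Y' n w"])
    show "wiener_pair (\<lambda>s. \<alpha> * \<phi> n s + \<beta> * \<psi> n s) (\<lambda>w. \<alpha> * Y n w + \<beta> * Y' n w)" for n
      by (rule dyadic_wiener_pair[OF dyadic_pair_lincomb[OF 1(1) 2(1)]])
  qed (intro L2_tendsto_add L2_tendsto_cmult 1 2)+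
qed

text \<open>Limits of the dyadic case; L2-convergence passes to the cosines because cos is
  1-Lipschitz.\<close>

lemma wiener_pair_moments:
  assumes "wiener_pair g X"
  shows "expectation X = 0"
    "(\<integral>w. (X w)\<^sup>2 \<partial>\<mu>) = (\<integral>s. (g s)\<^sup>2 \<partial>leb01)"
    "(\<integral>w. cos (X w + c) \<partial>\<mu>) = cos c * exp (- (\<integral>s. (g s)\<^sup>2 \<partial>leb01) / 2)"
proof -
  obtain \<phi> Y where 1: "\<And>n. dyadic_pair (\<phi> n) (Y n)" "L2_tendsto leb01 \<phi> g" "L2_tendsto \<mu> Y X"
    using wiener_pair_sequence[OF assms] by blast
  note mom = dyadic_pair_moments[OF 1(1)]
  show "expectation X = 0"
    by (rule LIMSEQ_unique[OF L2_tendsto_integral[OF 1(3) finite_measure_axioms]]) (simp add: mom)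
  show "(\<integral>w. (X w)\<^sup>2 \<partial>\<mu>) = (\<integral>s. (g s)\<^sup>2 \<partial>leb01)"
    by (rule LIMSEQ_unique[OF L2_tendsto_norm[OF 1(3)]]) (use L2_tendsto_norm[OF 1(2)] in \<open>simp add: mom(3)\<close>)
  have sqX: "square_integrable \<mu> X" using wiener_pair_square_integrable[OF assms] by simp
  have sc: "square_integrable \<mu> (\<lambda>w. cos (Z w + c))" if "square_integrable \<mu> Z" for Z
    by (rule square_integrable_bounded[OF finite_measure_axioms, of _ 1])
      (use square_integrableD(1)[OF that] in auto)
  have le: "(\<integral>w. (cos (Y n w + c) - cos (X w + c))\<^sup>2 \<partial>\<mu>) \<le> (\<integral>w. (Y n w - X w)\<^sup>2 \<partial>\<mu>)" for n
  proof (rule integral_mono)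
    show "integrable \<mu> (\<lambda>w. (cos (Y n w + c) - cos (X w + c))\<^sup>2)"
      by (rule square_integrableD(2)[OF square_integrable_diff[OF sc[OF mom(1)] sc[OF sqX]]])
    show "integrable \<mu> (\<lambda>w. (Y n w - X w)\<^sup>2)"
      by (rule square_integrableD(2)[OF square_integrable_diff[OF mom(1) sqX]])
    show "(cos (Y n w + c) - cos (X w + c))\<^sup>2 \<le> (Y n w - X w)\<^sup>2" for w
      using abs_cos_diff_le[of "Y n w + c" "X w + c"] by (simp add: abs_le_square_iff)
  qed
  have "L2_tendsto \<mu> (\<lambda>n w. cos (Y n w + c)) (\<lambda>w. cos (X w + c))"
    unfolding L2_tendsto_def
  proof (intro conjI allI sc mom(1) sqX)
    show "(\<lambda>n. \<integral>w. (cos (Y n w + c) - cos (X w + c))\<^sup>2 \<partial>\<mu>) \<longlonglongrightarrow> 0"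
    proof (rule Lim_null_comparison)
      show "(\<lambda>n. \<integral>w. (Y n w - X w)\<^sup>2 \<partial>\<mu>) \<longlonglongrightarrow> 0"
        using 1(3) by (simp add: L2_tendsto_def)
      show "\<forall>\<^sub>F n in sequentially. norm (\<integral>w. (cos (Y n w + c) - cos (X w + c))\<^sup>2 \<partial>\<mu>) \<le> (\<integral>w. (Y n w - X w)\<^sup>2 \<partial>\<mu>)"
        using le by (intro always_eventually allI) simp
    qed
  qed
  from L2_tendsto_integral[OF this finite_measure_axioms]
  have "(\<lambda>n. cos c * exp (- (\<integral>s. (\<phi> n s)\<^sup>2 \<partial>leb01) / 2)) \<longlonglongrightarrow> (\<integral>w. cos (X w + c) \<partial>\<mu>)"
    by (simp add: mom(4))
  moreover have "(\<lambda>n. cos c * exp (- (\<integral>s. (\<phi> n s)\<^sup>2 \<partial>leb01) / 2)) \<longlonglongrightarrow> cos c * exp (- (\<integral>s. (g s)\<^sup>2 \<partial>leb01) / 2)"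
    by (intro tendsto_intros L2_tendsto_norm[OF 1(2)]) simp
  ultimately show "(\<integral>w. cos (X w + c) \<partial>\<mu>) = cos c * exp (- (\<integral>s. (g s)\<^sup>2 \<partial>leb01) / 2)"
    by (rule LIMSEQ_unique)
qed

text \<open>Polarization of the equality of norms, applied to the pair of sums.\<close>

lemma wiener_pair_isometry:
  assumes "wiener_pair g X" "wiener_pair h Z"
  shows "(\<integral>w. X w * Z w \<partial>\<mu>) = (\<integral>s. g s * h s \<partial>leb01)"
proof -
  have "(\<integral>w. (X w + Z w)\<^sup>2 \<partial>\<mu>) = (\<integral>s. (g s + h s)\<^sup>2 \<partial>leb01)"
    using wiener_pair_moments(2)[OF wiener_pair_lincomb[OF assms, of 1 1]] by simp
  then show ?thesis
    using integral_power2_add[OF wiener_pair_square_integrable(1)[OF assms(1)] wiener_pair_square_integrable(1)[OF assms(2)]]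
      integral_power2_add[OF wiener_pair_square_integrable(2)[OF assms(1)] wiener_pair_square_integrable(2)[OF assms(2)]]
      wiener_pair_moments(2)[OF assms(1)] wiener_pair_moments(2)[OF assms(2)] by simp
qed

lemma wiener_pair_cong_AE:
  assumes "wiener_pair g X" "AE s in leb01. g s = g' s"
    "AE w in \<mu>. X w = X' w" "X' \<in> borel_measurable \<mu>"
  shows "wiener_pair g' X'"
proof -
  note sq = wiener_pair_square_integrable[OF assms(1)]
  have sg': "square_integrable leb01 g'"
    by (rule square_integrable_cong_AE[OF sq(1) measurable_leb01_AE[OF square_integrableD(1)[OF sq(1)] assms(2)] assms(2)])
  have "(\<integral>s. (g s - g' s)\<^sup>2 \<partial>leb01) = 0"
  proof (rule integral_eq_zero_AE)
    show "AE s in leb01. (g s - g' s)\<^sup>2 = 0" using assms(2) by eventually_elim simp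
  qed
  then have 1: "L2_tendsto leb01 (\<lambda>_. g) g'" using sg' sq(1) by (simp add: L2_tendsto_def)
  have sX': "square_integrable \<mu> X'" by (rule square_integrable_cong_AE[OF sq(2) assms(4,3)])
  have "(\<integral>w. (X w - X' w)\<^sup>2 \<partial>\<mu>) = 0"
  proof (rule integral_eq_zero_AE)
    show "AE w in \<mu>. (X w - X' w)\<^sup>2 = 0" using assms(3) by eventually_elim simp
  qed
  then have 2: "L2_tendsto \<mu> (\<lambda>_. X) X'" using sX' sq(2) by (simp add: L2_tendsto_def)
  show ?thesis by (rule wiener_pair_limit[OF assms(1) 1 2])
qed

text \<open>With d the dyadic point of level n just below t, both squared distances equal t - d: one
  as the length of (d, t], the other as the variance of the increment over it.\<close>

lemma wiener_pair_evaluation: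
  assumes t: "t \<in> {0..1}"
  shows "wiener_pair (indicator {0<..t}) (\<lambda>w. w t)"
proof -
  define m where "m n = dyadic_floor n t" for n
  have m: "m n \<le> 2 ^ n" for n unfolding m_def using t by (intro dyadic_floor_le) auto
  have le: "dyadic n (m n) \<le> t" for n
    using dyadic_floor_bounds(1)[of t n] t by (simp add: m_def pos_divide_le_eq mult.commute)
  have ge: "0 \<le> dyadic n (m n)" for n by simp
  have lim: "(\<lambda>n. t - dyadic n (m n)) \<longlonglongrightarrow> 0"
    using tendsto_diff[OF tendsto_const dyadic_floor_tendsto[of t], of t] t by (simp add: m_def)
  have pair: "wiener_pair (indicator {0<..dyadic n (m n)}) (\<lambda>w. w (dyadic n (m n)) - w 0)" for n
    by (rule dyadic_wiener_pair) (auto simp: dyadic_pair_def step_function_initial[OF m, symmetric]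
        intro!: exI[of _ n] exI[of _ "\<lambda>i. if i < m n then 1 else 0"])
  have sqt: "square_integrable \<mu> (\<lambda>w. w t)"
    by (rule square_integrable_cong_AE[OF increment_square(1)[of 0 t]])
      (use t in \<open>auto intro!: evaluation_measurable AE_I2 simp: path_zero\<close>)
  show ?thesis
  proof (rule wiener_pair_limit[OF pair])
    show "L2_tendsto leb01 (\<lambda>n. indicator {0<..dyadic n (m n)}) (indicator {0<..t})"
      unfolding L2_tendsto_def
    proof (intro conjI allI square_integrable_indicator_leb01)
      have eq: "(\<integral>s. (indicat_real {0<..dyadic n (m n)} s - indicator {0<..t} s)\<^sup>2 \<partial>leb01) = t - dyadic n (m n)" for n
      proof -
        have "(indicator {0<..d} s - indicator {0<..t} s)\<^sup>2 = indicat_real {d<..t} s"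
          if "0 \<le> d" "d \<le> t" for d s
          using that by (auto simp: indicator_def)
        from this[OF ge le] show ?thesis using integral_indicator_leb01[OF ge le] t by simp
      qed
      show "(\<lambda>n. \<integral>s. (indicat_real {0<..dyadic n (m n)} s - indicator {0<..t} s)\<^sup>2 \<partial>leb01) \<longlonglongrightarrow> 0"
        unfolding eq by (rule lim)
    qed auto
    show "L2_tendsto \<mu> (\<lambda>n w. w (dyadic n (m n)) - w 0) (\<lambda>w. w t)"
      unfolding L2_tendsto_def
    proof (intro conjI allI sqt)
      show "square_integrable \<mu> (\<lambda>w. w (dyadic n (m n)) - w 0)" for n
        by (rule wiener_pair_square_integrable(2)[OF pair])
      have eq: "(\<integral>w. (w (dyadic n (m n)) - w 0 - w t)\<^sup>2 \<partial>\<mu>) = t - dyadic n (m n)" for n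
      proof -
        have "(\<integral>w. (w (dyadic n (m n)) - w 0 - w t)\<^sup>2 \<partial>\<mu>) = (\<integral>w. (w t - w (dyadic n (m n)))\<^sup>2 \<partial>\<mu>)"
          by (intro Bochner_Integration.integral_cong refl) (simp add: path_zero power2_commute)
        then show ?thesis using increment_square(2)[OF ge le] t by simp
      qed
      show "(\<lambda>n. \<integral>w. (w (dyadic n (m n)) - w 0 - w t)\<^sup>2 \<partial>\<mu>) \<longlonglongrightarrow> 0"
        unfolding eq by (rule lim)
    qed
  qed
qed

lemma wiener_pair_zero: "wiener_pair (\<lambda>_. 0) (\<lambda>_. 0)"
  using wiener_pair_lincomb[OF wiener_pair_evaluation wiener_pair_evaluation, of 0 0 0 0] by simp

lemma wiener_pair_sum:
  assumes "\<And>i. i \<in> I \<Longrightarrow> wiener_pair (g i) (X i)"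
  shows "wiener_pair (\<lambda>s. \<Sum>i\<in>I. a i * g i s) (\<lambda>w. \<Sum>i\<in>I. a i * X i w)"
  using assms
proof (induction I rule: infinite_finite_induct)
  case (insert i I)
  have "wiener_pair (\<lambda>s. a i * g i s + 1 * (\<Sum>i\<in>I. a i * g i s)) (\<lambda>w. a i * X i w + 1 * (\<Sum>i\<in>I. a i * X i w))"
    by (intro wiener_pair_lincomb insert) (auto intro: insert.prems insert.IH)
  then show ?case using insert.hyps by simp
qed (simp_all add: wiener_pair_zero)

text \<open>\<open>is_wiener_integral\<close> admits arbitrary partitions; differences of indicators
  of (0, t] bring them back to evaluations.\<close>

lemma wiener_pair_step:
  assumes "partition_01 n t"
  shows "wiener_pair (step_function n t a) (step_integral n t a)"
proof -
  have "wiener_pair (\<lambda>s. \<Sum>i\<in>{..<n}. a i * (1 * indicator {0<..t (Suc i)} s + (-1) * indicator {0<..t i} s))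
    (\<lambda>w. \<Sum>i\<in>{..<n}. a i * (1 * w (t (Suc i)) + (-1) * w (t i)))"
    by (intro wiener_pair_sum wiener_pair_lincomb wiener_pair_evaluation partition_in_01[OF assms]) auto
  moreover have "1 * indicator {0<..t (Suc i)} s + (-1) * indicator {0<..t i} s = indicat_real {t i<..t (Suc i)} s"
    if "i < n" for i s
    using that assms partition_in_01[OF assms, of i] by (auto simp: indicator_def partition_01_def)
  ultimately show ?thesis
    unfolding step_function_def[abs_def] step_integral_def[abs_def] by (simp cong: sum.cong_simp)
qed

lemma is_wiener_integral_pair:
  assumes "is_wiener_integral \<mu> g X"
  shows "wiener_pair g X"
proof -
  obtain n t a where *: "\<And>k. partition_01 (n k) (t k)"
    "(\<lambda>k. \<integral>s. (step_function (n k) (t k) (a k) s - g s)\<^sup>2 \<partial>leb01) \<longlonglongrightarrow> 0"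
    "(\<lambda>k. \<integral>w. (step_integral (n k) (t k) (a k) w - X w)\<^sup>2 \<partial>\<mu>) \<longlonglongrightarrow> 0"
    using assms unfolding is_wiener_integral_def by blast
  have p: "wiener_pair (step_function (n k) (t k) (a k)) (step_integral (n k) (t k) (a k))" for k
    by (rule wiener_pair_step[OF *(1)])
  note sqp = wiener_pair_square_integrable[OF p]
  have sq: "square_integrable leb01 g" "square_integrable \<mu> X"
    using assms by (auto simp: is_wiener_integral_def)
  show ?thesis
  proof (rule wiener_pair_limit)
    show "wiener_pair (step_function (n k) (t k) (a k)) (step_integral (n k) (t k) (a k))" for k
      by (rule p)
  qed (use sq sqp * in \<open>simp_all add: L2_tendsto_def\<close>)
qed

end

section \<open>Density of step functions and existence of the Wiener integral\<close>

lemma restrict_lborel_leb01: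
  fixes u :: "real \<Rightarrow> real"
  assumes "u \<in> borel_measurable borel"
  shows "integrable (restrict_space lborel {0<..1}) u \<longleftrightarrow> integrable leb01 u"
    "(\<integral>x. u x \<partial>restrict_space lborel {0<..1}) = (\<integral>x. u x \<partial>leb01)"
proof -
  have ae: "AE x in lborel. indicator {0<..1} x *\<^sub>R u x = indicator {0..1} x *\<^sub>R u x"
    using AE_lborel_singleton[of 0] by eventually_elim (auto simp: indicator_def)
  have m: "(\<lambda>x. indicator {0<..1} x *\<^sub>R u x) \<in> borel_measurable lborel"
    "(\<lambda>x. indicator {0..1} x *\<^sub>R u x) \<in> borel_measurable lborel" using assms by measurable
  show "integrable (restrict_space lborel {0<..1}) u \<longleftrightarrow> integrable leb01 u"
    using integrable_cong_AE[OF m ae] integrable_completion[OF m(2)]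
    by (simp add: integrable_restrict_space)
  show "(\<integral>x. u x \<partial>restrict_space lborel {0<..1}) = (\<integral>x. u x \<partial>leb01)"
    using integral_cong_AE[OF m ae] integral_completion[OF m(2)]
    by (simp add: integral_restrict_space)
qed

text \<open>Dyadic step functions form an algebra, so the density theorem applies with both measures
  equal to Lebesgue measure on the Borel sets of (0, 1]. There the intervals (0, c] generate the
  \<sigma>-algebra, which they do not for the completed one; hence g is first replaced by a Borel
  version.\<close>

lemma step_functions_dense:
  assumes g: "square_integrable leb01 g" and e: "\<epsilon> > 0"
  shows "\<exists>k a. (\<integral>s. (step_function (2 ^ k) (dyadic k) a s - g s)\<^sup>2 \<partial>leb01) < \<epsilon>"
proof -
  define P :: "real measure" where "P = restrict_space lborel {0<..1}"
  \<comment> \<open>Agreement is demanded on (0, 1] only, since a step function vanishes outside and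
    the constant 1 has to belong to A.\<close>
  define A where "A = {f. \<exists>k a. \<forall>x\<in>{0<..1}. f x = step_function (2 ^ k) (dyadic k) a x}"
  have space_P: "space P = {0<..1}" by (simp add: P_def space_restrict_space)
  have fin: "finite_measure P"
    by (rule finite_measureI) (simp add: P_def space_restrict_space emeasure_restrict_space)
  have A_comb: "(\<lambda>x. F (f x) (h x)) \<in> A"
    if fA: "f \<in> A" and hA: "h \<in> A" and F: "\<And>m a b. \<exists>c. \<forall>x\<in>{0<..1}. F (step_function (2 ^ m) (dyadic m) a x) (step_function (2 ^ m) (dyadic m) b x)
      = step_function (2 ^ m) (dyadic m) c x" for f h F
  proof -
    obtain k a l b where 1: "\<forall>x\<in>{0<..1}. f x = step_function (2 ^ k) (dyadic k) a x"
      "\<forall>x\<in>{0<..1}. h x = step_function (2 ^ l) (dyadic l) b x"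
      using fA hA unfolding A_def by blast
    obtain m a' b' where 2: "step_function (2 ^ k) (dyadic k) a = step_function (2 ^ m) (dyadic m) a'"
      "step_function (2 ^ l) (dyadic l) b = step_function (2 ^ m) (dyadic m) b'"
      by (rule step_common_level)
    obtain c where "\<forall>x\<in>{0<..1}. F (step_function (2 ^ m) (dyadic m) a' x) (step_function (2 ^ m) (dyadic m) b' x)
      = step_function (2 ^ m) (dyadic m) c x" using F by blast
    then have "\<forall>x\<in>{0<..1}. F (f x) (h x) = step_function (2 ^ m) (dyadic m) c x" using 1 2 by simp
    then show ?thesis unfolding A_def by blast
  qed
  have A_init: "indicator {0<..dyadic k m} \<in> A" if "m \<le> 2 ^ k" for k m
    unfolding A_def step_function_initial(1)[OF that, symmetric] by blast
  interpret L2_dense_algebra P P A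
  proof (rule L2_dense_algebra.intro)
    show "(\<lambda>_. 1) \<in> A"
    proof -
      have "\<forall>x\<in>{0<..1}. 1 = step_function (2 ^ 0) (dyadic 0) (\<lambda>i. if i < 1 then 1 else 0) x"
        by (subst step_function_initial) auto
      then show ?thesis unfolding A_def by blast
    qed
    fix a assume a: "a \<in> A"
    then obtain k b where kb: "\<And>x. x \<in> {0<..1} \<Longrightarrow> a x = step_function (2 ^ k) (dyadic k) b x"
      unfolding A_def by blast
    show "a \<in> borel_measurable P"
    proof (subst measurable_cong)
      show "a w = step_function (2 ^ k) (dyadic k) b w" if "w \<in> space P" for w
        using that kb by (simp add: space_P)
      show "step_function (2 ^ k) (dyadic k) b \<in> borel_measurable P"
        unfolding P_def by (intro measurable_restrict_space1) (simp add: step_function_measurable)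
    qed
    have "\<bar>a x\<bar> \<le> (\<Sum>i<2 ^ k. \<bar>b i\<bar>)" if "x \<in> space P" for x
    proof -
      have "\<bar>a x\<bar> \<le> (\<Sum>i<2 ^ k. \<bar>b i * indicator {dyadic k i<..dyadic k (Suc i)} x\<bar>)"
        unfolding kb[OF that[unfolded space_P]] step_function_def by (rule sum_abs)
      also have "\<dots> \<le> (\<Sum>i<2 ^ k. \<bar>b i\<bar>)" by (intro sum_mono) (auto simp: indicator_def)
      finally show ?thesis .
    qed
    then show "\<exists>C. \<forall>x\<in>space P. \<bar>a x\<bar> \<le> C" by blast
    show "(\<lambda>x. c * a x) \<in> A" for c
    proof (rule A_comb[OF a a, of "\<lambda>u v. c * u"])
      show "\<exists>d. \<forall>x\<in>{0<..1}. c * step_function (2 ^ m) (dyadic m) u x = step_function (2 ^ m) (dyadic m) d x" for m u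
        by (rule exI[of _ "\<lambda>i. c * u i"], rule ballI) (simp only: step_function_def sum_distrib_left mult.assoc)
    qed
    fix b assume b: "b \<in> A"
    show "(\<lambda>x. a x + b x) \<in> A"
    proof (rule A_comb[OF a b, of "(+)"])
      show "\<exists>d. \<forall>x\<in>{0<..1}. step_function (2 ^ m) (dyadic m) u x + step_function (2 ^ m) (dyadic m) v x = step_function (2 ^ m) (dyadic m) d x" for m u v
        by (rule exI[of _ "\<lambda>i. u i + v i"], rule ballI) (simp only: step_function_def sum.distrib distrib_right)
    qed
    show "(\<lambda>x. a x * b x) \<in> A"
    proof (rule A_comb[OF a b, of "(*)"])
      show "\<exists>d. \<forall>x\<in>{0<..1}. step_function (2 ^ m) (dyadic m) u x * step_function (2 ^ m) (dyadic m) v x = step_function (2 ^ m) (dyadic m) d x" for m u v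
        by (rule exI[of _ "\<lambda>i. u i * v i"], rule ballI) (simp only: step_function_mult)
    qed
  qed (fact fin refl)+
  have approx_init: "approx (indicator {0<..c})" if c: "c \<in> {0..1}" for c
  proof -
    \<comment> \<open>The dyadic neighbour above c, capped at 1. Approximation from below would miss
      the point x = c, which belongs to (0, c].\<close>
    define m where "m n = min (2 ^ n) (Suc (dyadic_floor n c))" for n
    have mle: "m n \<le> 2 ^ n" for n by (simp add: m_def)
    have ge: "c \<le> dyadic n (m n)" for n
    proof (cases "Suc (dyadic_floor n c) \<le> 2 ^ n")
      case True
      then show ?thesis using dyadic_floor_bounds(2)[of c n] c
        by (simp add: m_def min_def pos_le_divide_eq mult.commute add.commute)
    next
      case False then show ?thesis using c by (simp add: m_def min_def)
    qed
    have le: "dyadic n (m n) \<le> dyadic n (dyadic_floor n c) + (1/2) ^ n" for n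
    proof -
      have "dyadic n (m n) \<le> dyadic n (Suc (dyadic_floor n c))" by (rule dyadic_mono) (simp add: m_def)
      then show ?thesis by (simp add: add_divide_distrib power_divide)
    qed
    have lim: "(\<lambda>n. dyadic n (m n)) \<longlonglongrightarrow> c"
    proof (rule tendsto_sandwich[where f="\<lambda>_. c" and h="\<lambda>n. dyadic n (dyadic_floor n c) + (1/2) ^ n"])
      have "(\<lambda>n. dyadic n (dyadic_floor n c) + (1/2) ^ n) \<longlonglongrightarrow> c + 0"
        using c by (intro tendsto_add dyadic_floor_tendsto LIMSEQ_realpow_zero) auto
      then show "(\<lambda>n. dyadic n (dyadic_floor n c) + (1/2) ^ n) \<longlonglongrightarrow> c" by simp
    qed (use ge le in \<open>auto intro!: always_eventually\<close>)
    show ?thesis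
    proof (rule approx_dominated(1)[where h="\<lambda>_. 1" and g="\<lambda>n. indicator {0<..dyadic n (m n)}"])
      show "sq (\<lambda>_. 1)" by (rule sq_A[OF A_one])
      show "(indicator {0<..dyadic n (m n)} :: real \<Rightarrow> real) \<in> borel_measurable P" for n
        by (rule A_measurable[OF A_init[OF mle]])
      show "approx (indicator {0<..dyadic n (m n)})" for n
        by (rule approx_A[OF A_init[OF mle]])
      show "\<bar>indicat_real {0<..dyadic n (m n)} x\<bar> \<le> 1" for n x by (simp add: indicator_def)
      show "(\<lambda>n. indicat_real {0<..dyadic n (m n)} x) \<longlonglongrightarrow> indicator {0<..c} x" for x
      proof (cases "x \<le> c")
        case True
        then have "indicat_real {0<..dyadic n (m n)} x = indicator {0<..c} x" for n
          using ge[of n] by (auto simp: indicator_def)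
        then show ?thesis by simp
      next
        case False
        then have "\<forall>\<^sub>F n in sequentially. dyadic n (m n) < x" by (intro order_tendstoD(2)[OF lim]) simp
        then have "\<forall>\<^sub>F n in sequentially. indicat_real {0<..dyadic n (m n)} x = indicator {0<..c} x"
          by (rule eventually_mono) (use False in \<open>auto simp: indicator_def\<close>)
        then show ?thesis by (rule tendsto_eventually)
      qed
    qed
  qed
  have sets_P: "sets P = sigma_sets (space P) ((\<inter>) {0<..1} ` range (\<lambda>a. {..a}))"
  proof -
    have b: "sets (borel :: real measure) = sigma_sets UNIV (range (\<lambda>a. {..a}))"
      by (subst borel_eq_atMost) simp
    have "{0<..1::real} \<in> sigma_sets UNIV (range (\<lambda>a. {..a}))" unfolding b[symmetric] by simp
    from sigma_sets_Int[OF this subset_UNIV] show ?thesis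
      by (simp add: P_def sets_restrict_space space_restrict_space b)
  qed
  have "approx (indicator S)" if S: "S \<in> (\<inter>) {0<..1} ` range (\<lambda>a. {..a})" for S :: "real set"
  proof -
    obtain a where "S = {0<..1} \<inter> {..a}" using S by blast
    then have "S = {0<..max 0 (min 1 a)}" by auto
    then show ?thesis by (simp only:) (rule approx_init, simp)
  qed
  note dense = approx_square_integrable[OF sets_P this]
  have "(\<lambda>x. if x \<in> {0..1} then g x else 0) \<in> borel_measurable lebesgue"
    using square_integrableD(1)[OF g] by (subst borel_measurable_if) auto
  from completion_ex_borel_measurable_real[OF this] obtain g' where
    g': "g' \<in> borel_measurable lborel" "AE x in lborel. (if x \<in> {0..1} then g x else 0) = g' x" by blast
  have mg': "g' \<in> borel_measurable borel" using g'(1) by simp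
  have ae: "AE x in leb01. g x = g' x"
    using AE_completion[OF g'(2)] by (auto simp: AE_restrict_space_iff elim!: eventually_mono)
  have sg': "square_integrable leb01 g'"
    by (rule square_integrable_cong_AE[OF g borel_measurable_leb01[OF mg'] ae])
  have "square_integrable P g'"
    unfolding P_def square_integrable_def
    using restrict_lborel_leb01(1)[of "\<lambda>x. (g' x)\<^sup>2"] square_integrableD(2)[OF sg'] mg'
    by (auto intro!: measurable_restrict_space1)
  then have "approx g'" by (intro dense) (simp_all add: sq_def)
  then obtain a where a: "a \<in> A" "Q (\<lambda>x. g' x - a x) < \<epsilon>" using e unfolding approx_def by blast
  obtain k b where kb: "\<And>x. x \<in> {0<..1} \<Longrightarrow> a x = step_function (2 ^ k) (dyadic k) b x"
    using a(1) unfolding A_def by blast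
  let ?\<phi> = "step_function (2 ^ k) (dyadic k) b"
  have "(\<integral>s. (?\<phi> s - g s)\<^sup>2 \<partial>leb01) = (\<integral>s. (?\<phi> s - g' s)\<^sup>2 \<partial>leb01)"
  proof (rule integral_cong_AE)
    show "AE s in leb01. (?\<phi> s - g s)\<^sup>2 = (?\<phi> s - g' s)\<^sup>2" using ae by eventually_elim simp
  qed (use square_integrableD(1)[OF g] square_integrableD(1)[OF sg'] borel_measurable_leb01[OF step_function_measurable] in auto)
  also have "\<dots> = (\<integral>s. (?\<phi> s - g' s)\<^sup>2 \<partial>P)"
    unfolding P_def using mg' step_function_measurable by (intro restrict_lborel_leb01(2)[symmetric]) auto
  also have "\<dots> = (\<integral>s. (g' s - a s)\<^sup>2 \<partial>P)"
    by (intro Bochner_Integration.integral_cong refl) (simp add: space_P kb power2_commute)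
  also have "\<dots> \<le> Q (\<lambda>x. g' x - a x)" by (simp add: Q_def)
  finally show ?thesis using a(2) by (intro exI[of _ k] exI[of _ b]) simp
qed

context wiener
begin

text \<open>By the isometry the integrals of approximating step functions form a Cauchy sequence in
  L2. Existence is what gives meaning to the choice by \<open>SOME\<close> in
  \<open>wiener_integral\<close>.\<close>

lemma wiener_integral_exists:
  assumes g: "square_integrable leb01 g"
  shows "\<exists>X. is_wiener_integral \<mu> g X"
proof -
  have "\<forall>n. \<exists>k a. (\<integral>s. (step_function (2 ^ k) (dyadic k) a s - g s)\<^sup>2 \<partial>leb01) < inverse (real (Suc n))"
    by (intro allI step_functions_dense[OF g]) simp
  from choice[OF this] obtain k where "\<forall>n. \<exists>a. (\<integral>s. (step_function (2 ^ k n) (dyadic (k n)) a s - g s)\<^sup>2 \<partial>leb01) < inverse (real (Suc n))" ..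
  from choice[OF this] obtain a where ka: "\<forall>n. (\<integral>s. (step_function (2 ^ k n) (dyadic (k n)) (a n) s - g s)\<^sup>2 \<partial>leb01) < inverse (real (Suc n))" ..
  define \<phi> Y where "\<phi> n = step_function (2 ^ k n) (dyadic (k n)) (a n)"
    and "Y n = step_integral (2 ^ k n) (dyadic (k n)) (a n)" for n
  have small: "(\<integral>s. (\<phi> n s - g s)\<^sup>2 \<partial>leb01) < inverse (real (Suc n))" for n using ka by (simp add: \<phi>_def)
  have pair: "dyadic_pair (\<phi> n) (Y n)" for n unfolding dyadic_pair_def \<phi>_def Y_def by blast
  have sY: "square_integrable \<mu> (Y n)" for n by (rule dyadic_pair_moments(1)[OF pair])
  have s\<phi>: "square_integrable leb01 (\<phi> n)" for n by (rule dyadic_pair_square_integrable[OF pair])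
  have "\<exists>N. \<forall>m\<ge>N. \<forall>n\<ge>N. (\<integral>w. (Y m w - Y n w)\<^sup>2 \<partial>\<mu>) \<le> e" if e: "e > 0" for e
  proof -
    obtain N :: nat where N: "inverse (real (Suc N)) < e / 4" using reals_Archimedean[of "e/4"] e by auto
    have s: "(\<integral>s. (\<phi> n s - g s)\<^sup>2 \<partial>leb01) < e / 4" if "n \<ge> N" for n
    proof -
      have "inverse (real (Suc n)) \<le> inverse (real (Suc N))" using that by (intro le_imp_inverse_le) auto
      then show ?thesis using small[of n] N by linarith
    qed
    have "(\<integral>w. (Y m w - Y n w)\<^sup>2 \<partial>\<mu>) \<le> e" if mn: "m \<ge> N" "n \<ge> N" for m n
    proof -
      have "(\<integral>w. (Y m w - Y n w)\<^sup>2 \<partial>\<mu>) = (\<integral>s. (\<phi> m s - \<phi> n s)\<^sup>2 \<partial>leb01)"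
        using dyadic_pair_moments(3)[OF dyadic_pair_lincomb[OF pair pair], of 1 m "-1" n] by simp
      also have "\<dots> = (\<integral>s. ((\<phi> m s - g s) + (g s - \<phi> n s))\<^sup>2 \<partial>leb01)" by simp
      also have "\<dots> \<le> 2 * (\<integral>s. (\<phi> m s - g s)\<^sup>2 \<partial>leb01) + 2 * (\<integral>s. (g s - \<phi> n s)\<^sup>2 \<partial>leb01)"
        by (rule integral_power2_add_le[OF square_integrable_diff[OF s\<phi> g] square_integrable_diff[OF g s\<phi>]])
      also have "(\<integral>s. (g s - \<phi> n s)\<^sup>2 \<partial>leb01) = (\<integral>s. (\<phi> n s - g s)\<^sup>2 \<partial>leb01)"
        by (simp add: power2_commute)
      finally show ?thesis using s[OF mn(1)] s[OF mn(2)] by simp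
    qed
    then show ?thesis by blast
  qed
  from L2_complete[OF finite_measure_axioms sY this] obtain X where X: "L2_tendsto \<mu> Y X" by blast
  have "(\<lambda>n. \<integral>s. (\<phi> n s - g s)\<^sup>2 \<partial>leb01) \<longlonglongrightarrow> 0"
    by (rule Lim_null_comparison[OF _ LIMSEQ_inverse_real_of_nat])
      (intro always_eventually allI, use small in \<open>simp add: less_imp_le del: of_nat_Suc\<close>)
  then have "is_wiener_integral \<mu> g X"
    using X g unfolding is_wiener_integral_def L2_tendsto_def \<phi>_def Y_def
    by (intro conjI exI[of _ "\<lambda>n. 2 ^ k n"] exI[of _ "\<lambda>n. dyadic (k n)"] exI[of _ a])
      (auto simp: partition_dyadic)
  then show ?thesis by blast
qed

lemma wiener_delta_pair:
  assumes "h \<in> cameron_martin"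
  shows "wiener_pair (deriv h) (wiener_delta \<mu> h)"
proof -
  have "is_wiener_integral \<mu> (deriv h) (SOME X. is_wiener_integral \<mu> (deriv h) X)"
    by (rule someI_ex[OF wiener_integral_exists[OF cameron_martinD(4)[OF assms]]])
  then show ?thesis
    unfolding wiener_delta_def wiener_integral_def by (rule is_wiener_integral_pair)
qed

end

section \<open>The rotation of the Wiener space\<close>

locale wiener_unitary = wiener +
  fixes R T :: "(real \<Rightarrow> real) \<Rightarrow> (real \<Rightarrow> real)" and e :: "nat \<Rightarrow> real \<Rightarrow> real"
  assumes unitary: "cm_unitary R"
    and basis: "cm_orthonormal_basis e"
    and rotation: "wiener_rotation \<mu> R e T"
begin

lemma R_cameron_martin: "h \<in> cameron_martin \<Longrightarrow> R h \<in> cameron_martin"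
  using unitary by (auto simp: cm_unitary_def bij_betw_def)

lemma R_lincomb:
  "h \<in> cameron_martin \<Longrightarrow> k \<in> cameron_martin \<Longrightarrow>
    R (\<lambda>t. a * h t + b * k t) = (\<lambda>t. a * R h t + b * R k t)"
  using unitary by (simp add: cm_unitary_def)

lemma R_inner: "h \<in> cameron_martin \<Longrightarrow> k \<in> cameron_martin \<Longrightarrow> cm_inner (R h) (R k) = cm_inner h k"
  using unitary by (simp add: cm_unitary_def)

lemma e_cameron_martin: "e i \<in> cameron_martin"
  using basis by (simp add: cm_orthonormal_basis_def)

text \<open>The factors 1 and -1 are kept because linearity of R is given for combinations of this
  shape.\<close>

lemma integral_deriv_diff:
  assumes h: "h \<in> cameron_martin" and k: "k \<in> cameron_martin"
  shows "(\<integral>s. (deriv h s - deriv k s)\<^sup>2 \<partial>leb01)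
    = cm_inner (\<lambda>t. 1 * h t + (-1) * k t) (\<lambda>t. 1 * h t + (-1) * k t)"
  unfolding cm_inner_def
proof (rule integral_cong_AE)
  show "AE s in leb01. (deriv h s - deriv k s)\<^sup>2 = deriv (\<lambda>t. 1 * h t + (-1) * k t) s * deriv (\<lambda>t. 1 * h t + (-1) * k t) s"
    using AE_deriv_lincomb[OF h k, of 1 "-1"]
    by eventually_elim (simp add: power2_eq_square)
  show "(\<lambda>s. (deriv h s - deriv k s)\<^sup>2) \<in> borel_measurable leb01"
    using square_integrableD(1)[OF cameron_martinD(4)[OF h]] square_integrableD(1)[OF cameron_martinD(4)[OF k]]
    by measurable
  show "(\<lambda>s. deriv (\<lambda>t. 1 * h t + (-1) * k t) s * deriv (\<lambda>t. 1 * h t + (-1) * k t) s) \<in> borel_measurable leb01"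
    using square_integrableD(1)[OF cameron_martinD(4)[OF cameron_martin_lincomb[OF h k]]]
    by (intro borel_measurable_times)
qed

lemma R_integral_deriv_diff:
  assumes h: "h \<in> cameron_martin" and k: "k \<in> cameron_martin"
  shows "(\<integral>s. (deriv (R h) s - deriv (R k) s)\<^sup>2 \<partial>leb01) = (\<integral>s. (deriv h s - deriv k s)\<^sup>2 \<partial>leb01)"
  unfolding integral_deriv_diff[OF h k] integral_deriv_diff[OF R_cameron_martin[OF h] R_cameron_martin[OF k]]
    R_lincomb[OF h k, symmetric]
  by (intro R_inner cameron_martin_lincomb h k)

text \<open>X is some version of \<delta> h. The relation is preferred to
  \<open>wiener_delta\<close>, which fixes one version: composing it with T in general yields a
  different version of \<delta> (R h).\<close>

definition cm_pair :: "(real \<Rightarrow> real) \<Rightarrow> ((real \<Rightarrow> real) \<Rightarrow> real) \<Rightarrow> bool" where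
  "cm_pair h X \<longleftrightarrow> h \<in> cameron_martin \<and> wiener_pair (deriv h) X"

lemma cm_pairD:
  assumes "cm_pair h X"
  shows "h \<in> cameron_martin" "wiener_pair (deriv h) X" "square_integrable \<mu> X" "X \<in> borel_measurable \<mu>"
  using assms wiener_pair_square_integrable(2)[of "deriv h" X]
  by (auto simp: cm_pair_def square_integrable_def)

lemma cm_pair_lincomb:
  assumes "cm_pair h X" "cm_pair k Y"
  shows "cm_pair (\<lambda>t. a * h t + b * k t) (\<lambda>w. a * X w + b * Y w)"
  unfolding cm_pair_def
proof
  show "(\<lambda>t. a * h t + b * k t) \<in> cameron_martin"
    using assms by (intro cameron_martin_lincomb) (auto simp: cm_pair_def)
  show "wiener_pair (deriv (\<lambda>t. a * h t + b * k t)) (\<lambda>w. a * X w + b * Y w)"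
  proof (rule wiener_pair_cong_AE)
    show "wiener_pair (\<lambda>s. a * deriv h s + b * deriv k s) (\<lambda>w. a * X w + b * Y w)"
      using assms by (intro wiener_pair_lincomb) (auto simp: cm_pair_def)
    show "AE s in leb01. a * deriv h s + b * deriv k s = deriv (\<lambda>t. a * h t + b * k t) s"
      using assms by (intro AE_deriv_lincomb) (auto simp: cm_pair_def)
    show "(\<lambda>w. a * X w + b * Y w) \<in> borel_measurable \<mu>"
      using cm_pairD(4)[OF assms(1)] cm_pairD(4)[OF assms(2)] by measurable
  qed simp
qed

lemma cm_pair_inner:
  "cm_pair h X \<Longrightarrow> cm_pair k Y \<Longrightarrow> (\<integral>w. X w * Y w \<partial>\<mu>) = cm_inner h k"
  unfolding cm_pair_def cm_inner_def by (auto intro: wiener_pair_isometry)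

lemma cm_pair_diff:
  assumes "cm_pair h X" "cm_pair k Y"
  shows "(\<integral>s. (deriv h s - deriv k s)\<^sup>2 \<partial>leb01) = (\<integral>w. (X w - Y w)\<^sup>2 \<partial>\<mu>)"
  using cm_pair_inner[OF cm_pair_lincomb[OF assms, of 1 "-1"] cm_pair_lincomb[OF assms, of 1 "-1"]]
    integral_deriv_diff[OF cm_pairD(1)[OF assms(1)] cm_pairD(1)[OF assms(2)]]
  by (simp add: power2_eq_square)

lemma cm_pair_evaluation:
  assumes "t \<in> {0..1}"
  shows "cm_pair (cm_kernel t) (\<lambda>w. w t)"
  unfolding cm_pair_def
  by (intro conjI cm_kernel_cameron_martin assms
      wiener_pair_cong_AE[OF wiener_pair_evaluation cm_kernel_AE_deriv] evaluation_measurable) simp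

lemma cm_pair_zero: "cm_pair (\<lambda>_. 0) (\<lambda>_. 0)"
  using cm_pair_lincomb[OF cm_pair_evaluation cm_pair_evaluation, of 0 0 0 0] by simp

lemma R_zero: "R (\<lambda>_. 0) = (\<lambda>_. 0)"
  using R_lincomb[OF e_cameron_martin e_cameron_martin, of 0 0 0 0] by simp

text \<open>R is linear on H only, so membership of the partial sums in H has to travel along in the
  induction.\<close>

lemma R_cm_sum:
  "(\<lambda>s. \<Sum>i<n. c i * e i s) \<in> cameron_martin \<and>
    R (\<lambda>s. \<Sum>i<n. c i * e i s) = (\<lambda>s. \<Sum>i<n. c i * R (e i) s) \<and>
    cm_pair (\<lambda>s. \<Sum>i<n. c i * R (e i) s) (\<lambda>w. \<Sum>i<n. c i * wiener_delta \<mu> (R (e i)) w)"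
proof (induction n)
  case 0
  then show ?case using cm_pairD(1)[OF cm_pair_zero] cm_pair_zero R_zero by simp
next
  case (Suc n)
  have p: "cm_pair (R (e n)) (wiener_delta \<mu> (R (e n)))"
    unfolding cm_pair_def using R_cameron_martin[OF e_cameron_martin] wiener_delta_pair by blast
  have "(\<lambda>s. 1 * (\<Sum>i<n. c i * e i s) + c n * e n s) \<in> cameron_martin"
    using Suc by (intro cameron_martin_lincomb e_cameron_martin) auto
  moreover have "R (\<lambda>s. 1 * (\<Sum>i<n. c i * e i s) + c n * e n s) = (\<lambda>s. 1 * (\<Sum>i<n. c i * R (e i) s) + c n * R (e n) s)"
    using Suc e_cameron_martin by (subst R_lincomb) auto
  moreover have "cm_pair (\<lambda>s. 1 * (\<Sum>i<n. c i * R (e i) s) + c n * R (e n) s)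
      (\<lambda>w. 1 * (\<Sum>i<n. c i * wiener_delta \<mu> (R (e i)) w) + c n * wiener_delta \<mu> (R (e n)) w)"
    using Suc p by (intro cm_pair_lincomb) auto
  ultimately show ?case by simp
qed

lemma T_measurable: "T \<in> measurable \<mu> \<mu>"
  using rotation by (simp add: wiener_rotation_def)

text \<open>By the reproducing property, e i t is the coefficient of the kernel along e i. The
  partial sums of T w t are thus versions of \<delta> (R (h n)) with h n converging to the kernel in
  H. As R is isometric, they are Cauchy in L2, and their L2-limit is the almost sure limit T w
  t.\<close>

lemma cm_pair_evaluation_T:
  assumes t: "t \<in> {0..1}"
  shows "cm_pair (R (cm_kernel t)) (\<lambda>w. T w t)"
proof -
  define h where "h n s = (\<Sum>i<n. e i t * e i s)" for n s
  define X where "X n w = (\<Sum>i<n. e i t * wiener_delta \<mu> (R (e i)) w)" for n w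
  note k = cm_kernel_cameron_martin[OF t]
  have h: "h n \<in> cameron_martin" for n
    using R_cm_sum[where n=n and c="\<lambda>i. e i t"] by (simp add: h_def[abs_def])
  have pair: "cm_pair (R (h n)) (X n)" for n
    using R_cm_sum[where n=n and c="\<lambda>i. e i t"] by (simp add: h_def[abs_def] X_def[abs_def])
  have sqR: "square_integrable leb01 (deriv (R (h n)))" "square_integrable leb01 (deriv (R (cm_kernel t)))" for n
    by (intro cameron_martinD(4) R_cameron_martin h k)+
  have coef: "cm_inner (cm_kernel t) (e i) = e i t" for i
    using cm_inner_kernel[OF e_cameron_martin t] by (simp add: cm_inner_commute)
  have "(\<lambda>n. let r = (\<lambda>s. cm_kernel t s - (\<Sum>i<n. cm_inner (cm_kernel t) (e i) * e i s)) in cm_inner r r) \<longlonglongrightarrow> 0"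
    using basis k unfolding cm_orthonormal_basis_def by blast
  then have "(\<lambda>n. \<integral>s. (deriv (cm_kernel t) s - deriv (h n) s)\<^sup>2 \<partial>leb01) \<longlonglongrightarrow> 0"
    unfolding integral_deriv_diff[OF k h] by (simp add: Let_def coef h_def)
  then have lim: "(\<lambda>n. \<integral>s. (deriv (R (h n)) s - deriv (R (cm_kernel t)) s)\<^sup>2 \<partial>leb01) \<longlonglongrightarrow> 0"
    unfolding R_integral_deriv_diff[OF h k] by (simp add: power2_commute)
  then have L2: "L2_tendsto leb01 (\<lambda>n. deriv (R (h n))) (deriv (R (cm_kernel t)))"
    using sqR by (simp add: L2_tendsto_def)
  have "L2_tendsto \<mu> X (\<lambda>w. T w t)"
  proof (rule L2_tendsto_AE_limit)
    show "square_integrable \<mu> (X n)" for n by (rule cm_pairD(3)[OF pair])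
    show "(\<lambda>w. T w t) \<in> borel_measurable \<mu>"
      using measurable_compose[OF T_measurable evaluation_measurable[OF t]] .
    have "AE w in \<mu>. uniform_limit {0..1} (\<lambda>n t. \<Sum>i<n. wiener_delta \<mu> (R (e i)) w * e i t) (T w) sequentially"
      using rotation by (simp add: wiener_rotation_def)
    then show "AE w in \<mu>. (\<lambda>n. X n w) \<longlonglongrightarrow> T w t"
    proof eventually_elim
      case (elim w)
      from tendsto_uniform_limitI[OF this t] show ?case by (simp add: X_def mult.commute)
    qed
    fix \<epsilon> :: real assume \<epsilon>: "\<epsilon> > 0"
    have "\<forall>\<^sub>F n in sequentially. (\<integral>s. (deriv (R (h n)) s - deriv (R (cm_kernel t)) s)\<^sup>2 \<partial>leb01) < \<epsilon> / 4"
      using \<epsilon> by (intro order_tendstoD(2)[OF lim]) simp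
    then obtain N where N: "\<And>n. n \<ge> N \<Longrightarrow> (\<integral>s. (deriv (R (h n)) s - deriv (R (cm_kernel t)) s)\<^sup>2 \<partial>leb01) < \<epsilon> / 4"
      unfolding eventually_sequentially by blast
    have "(\<integral>w. (X m w - X n w)\<^sup>2 \<partial>\<mu>) \<le> \<epsilon>" if mn: "m \<ge> N" "n \<ge> N" for m n
    proof -
      have "(\<integral>w. (X m w - X n w)\<^sup>2 \<partial>\<mu>) = (\<integral>s. (deriv (R (h m)) s - deriv (R (h n)) s)\<^sup>2 \<partial>leb01)"
        by (rule cm_pair_diff[OF pair pair, symmetric])
      also have "\<dots> = (\<integral>s. ((deriv (R (h m)) s - deriv (R (cm_kernel t)) s) + (deriv (R (cm_kernel t)) s - deriv (R (h n)) s))\<^sup>2 \<partial>leb01)"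
        by simp
      also have "\<dots> \<le> 2 * (\<integral>s. (deriv (R (h m)) s - deriv (R (cm_kernel t)) s)\<^sup>2 \<partial>leb01)
          + 2 * (\<integral>s. (deriv (R (cm_kernel t)) s - deriv (R (h n)) s)\<^sup>2 \<partial>leb01)"
        by (intro integral_power2_add_le square_integrable_diff sqR)
      also have "(\<integral>s. (deriv (R (cm_kernel t)) s - deriv (R (h n)) s)\<^sup>2 \<partial>leb01)
        = (\<integral>s. (deriv (R (h n)) s - deriv (R (cm_kernel t)) s)\<^sup>2 \<partial>leb01)"
        by (simp add: power2_commute)
      finally show ?thesis using N[OF mn(1)] N[OF mn(2)] by simp
    qed
    then show "\<exists>N. \<forall>m\<ge>N. \<forall>n\<ge>N. (\<integral>w. (X m w - X n w)\<^sup>2 \<partial>\<mu>) \<le> \<epsilon>" by blast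
  qed
  then have "wiener_pair (deriv (R (cm_kernel t))) (\<lambda>w. T w t)"
    by (rule wiener_pair_limit[OF cm_pairD(2)[OF pair] L2])
  then show ?thesis by (simp add: cm_pair_def R_cameron_martin k)
qed

text \<open>Until \<open>T\<close> is known to preserve \<open>\<mu>\<close>, composition with \<open>T\<close> is only controlled on
  the following functions, which include the evaluations but not their \<open>L\<^sup>2\<close>-limits.\<close>

definition regular :: "((real \<Rightarrow> real) \<Rightarrow> real) set" where
  "regular = {Y. \<exists>k. cm_pair k Y \<and> cm_pair (R k) (\<lambda>w. Y (T w))}"

lemma regular_lincomb:
  assumes "Y \<in> regular" "Z \<in> regular"
  shows "(\<lambda>w. a * Y w + b * Z w) \<in> regular"
proof -
  obtain k l where k: "cm_pair k Y" "cm_pair (R k) (\<lambda>w. Y (T w))"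
    and l: "cm_pair l Z" "cm_pair (R l) (\<lambda>w. Z (T w))"
    using assms unfolding regular_def by blast
  have "cm_pair (R (\<lambda>t. a * k t + b * l t)) (\<lambda>w. a * Y (T w) + b * Z (T w))"
    unfolding R_lincomb[OF cm_pairD(1)[OF k(1)] cm_pairD(1)[OF l(1)]] by (rule cm_pair_lincomb[OF k(2) l(2)])
  with cm_pair_lincomb[OF k(1) l(1)] show ?thesis unfolding regular_def by blast
qed

lemma regular_evaluation: "t \<in> {0..1} \<Longrightarrow> (\<lambda>w. w t) \<in> regular"
  unfolding regular_def using cm_pair_evaluation cm_pair_evaluation_T by blast

lemma regular_zero: "(\<lambda>_. 0) \<in> regular"
  using regular_lincomb[OF regular_evaluation regular_evaluation, of 0 0 0 0] by simp

lemma regular_sum: "(\<And>i. i \<in> I \<Longrightarrow> Y i \<in> regular) \<Longrightarrow> (\<lambda>w. \<Sum>i\<in>I. a i * Y i w) \<in> regular"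
proof (induction I rule: infinite_finite_induct)
  case (insert i I)
  have "(\<lambda>w. a i * Y i w + 1 * (\<Sum>i\<in>I. a i * Y i w)) \<in> regular"
    using insert by (intro regular_lincomb) auto
  then show ?case using insert.hyps by simp
qed (simp_all add: regular_zero)

lemma regular_dyadic:
  assumes "dyadic_pair \<phi> Y"
  shows "Y \<in> regular"
proof -
  obtain k a where Y: "Y = step_integral (2 ^ k) (dyadic k) a" using assms unfolding dyadic_pair_def by blast
  have "(\<lambda>w. \<Sum>i\<in>{..<2 ^ k}. a i * (1 * w (dyadic k (Suc i)) + (-1) * w (dyadic k i))) \<in> regular"
  proof (intro regular_sum regular_lincomb regular_evaluation dyadic_in_01)
    fix i :: nat assume "i \<in> {..<2 ^ k}"
    then show "Suc i \<le> 2 ^ k" "i \<le> 2 ^ k" by auto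
  qed
  then show ?thesis by (simp add: Y step_integral_def[abs_def])
qed

lemma regular_measurable: "Y \<in> regular \<Longrightarrow> Y \<in> borel_measurable \<mu>"
  unfolding regular_def using cm_pairD(4) by blast

text \<open>Expectations of cosines depend only on the norm in H, which R preserves.\<close>

lemma regular_cos:
  assumes "Y \<in> regular"
  shows "(\<integral>w. cos (Y (T w) + c) \<partial>\<mu>) = (\<integral>w. cos (Y w + c) \<partial>\<mu>)"
proof -
  obtain k where k: "cm_pair k Y" "cm_pair (R k) (\<lambda>w. Y (T w))" using assms unfolding regular_def by blast
  have "(\<integral>s. (deriv (R k) s)\<^sup>2 \<partial>leb01) = (\<integral>s. (deriv k s)\<^sup>2 \<partial>leb01)"
    using R_inner[OF cm_pairD(1)[OF k(1)] cm_pairD(1)[OF k(1)]] by (simp add: cm_inner_def power2_eq_square)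
  then show ?thesis
    using wiener_pair_moments(3)[OF cm_pairD(2)[OF k(1)], of c] wiener_pair_moments(3)[OF cm_pairD(2)[OF k(2)], of c]
    by simp
qed

text \<open>Stated for an arbitrary family V between the evaluations and the measurable functions,
  as it serves both \<open>regular\<close> and the full Gaussian space.\<close>

lemma generated_by:
  assumes V: "\<And>X. X \<in> V \<Longrightarrow> X \<in> borel_measurable \<mu>" and ev: "\<And>t. t \<in> {0..1} \<Longrightarrow> (\<lambda>w. w t) \<in> V"
  shows "sets \<mu> = sigma_sets (space \<mu>) {{w\<in>space \<mu>. X w > a} | X a. X \<in> V}" (is "_ = sigma_sets _ ?G")
proof
  have G: "?G \<subseteq> sets \<mu>"
  proof
    fix S assume "S \<in> ?G"
    then obtain X a where S: "S = {w\<in>space \<mu>. X w > a}" "X \<in> V" by blast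
    have "X \<in> borel_measurable \<mu>" by (rule V[OF S(2)])
    then show "S \<in> sets \<mu>" unfolding S(1) by measurable
  qed
  then show "sigma_sets (space \<mu>) ?G \<subseteq> sets \<mu>" by (rule sets.sigma_sets_subset)
  define P where "P = sigma (space \<mu>) ?G"
  have "?G \<subseteq> Pow (space \<mu>)" by auto
  then have sP: "sets P = sigma_sets (space \<mu>) ?G" and spP: "space P = space \<mu>"
    unfolding P_def by (rule sets_measure_of, rule space_measure_of)
  have evP: "(\<lambda>w. w t) \<in> borel_measurable P" if "t \<in> {0..1}" for t
    unfolding borel_measurable_iff_greater
  proof
    fix a show "{w \<in> space P. a < w t} \<in> sets P"
      unfolding sP spP
      by (intro sigma_sets.Basic CollectI exI[of _ "\<lambda>w. w t"] exI[of _ a] conjI refl ev that)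
  qed
  have "{{w \<in> wiener_paths. w t \<in> A} | t A. t \<in> {0..1} \<and> A \<in> sets (borel :: real measure)} \<subseteq> sets P"
  proof clarify
    fix t :: real and A :: "real set" assume t: "t \<in> {0..1}" and A: "A \<in> sets borel"
    from measurable_sets[OF evP[OF t] A]
    show "{w \<in> wiener_paths. w t \<in> A} \<in> sets P" by (simp add: spP space_wiener vimage_def Int_def conj_commute)
  qed
  then have "sigma_sets (space P) {{w \<in> wiener_paths. w t \<in> A} | t A. t \<in> {0..1} \<and> A \<in> sets (borel :: real measure)} \<subseteq> sets P"
    by (rule sets.sigma_sets_subset)
  then show "sets \<mu> \<subseteq> sigma_sets (space \<mu>) ?G"
    unfolding spP sP space_wiener sets_wiener .
qed

section \<open>Invariance of the Wiener measure and its consequences\<close>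

text \<open>Trigonometric polynomials over \<open>regular\<close> have equal integrals under \<mu>
  and its image. An indicator is approximated by one such function in L2 of both measures
  simultaneously, which carries the equality over to sets.\<close>

lemma T_preserving: "distr \<mu> \<mu> T = \<mu>"
proof -
  let ?N = "distr \<mu> \<mu> T"
  interpret N: prob_space ?N by (rule prob_space_distr[OF T_measurable])
  interpret tr: trig_dense \<mu> ?N regular
  proof (rule trig_dense.intro)
    show "(\<lambda>w. X w + Y w) \<in> regular" if "X \<in> regular" "Y \<in> regular" for X Y
      using regular_lincomb[OF that, of 1 1] by simp
    show "(\<lambda>w. c * X w) \<in> regular" if "X \<in> regular" for X c
      using regular_lincomb[OF that that, of c 0] by simp
  qed (simp_all add: finite_measure_axioms N.finite_measure_axioms regular_measurable regular_zero)
  have same: "(\<integral>w. a w \<partial>?N) = (\<integral>w. a w \<partial>\<mu>)" if "a \<in> trig_span regular" for a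
    using that
  proof induction
    case (cos Y c)
    have "Y \<in> borel_measurable \<mu>" by (rule regular_measurable[OF cos])
    then show ?case using regular_cos[OF cos] by (simp add: integral_distr[OF T_measurable])
  next
    case (add f g)
    have "integrable \<mu> f" "integrable \<mu> g" "integrable ?N f" "integrable ?N g"
      using tr.sq_A[OF add.hyps(1)] tr.sq_A[OF add.hyps(2)]
        square_integrable_integrable[OF finite_measure_axioms] square_integrable_integrable[OF N.finite_measure_axioms]
      by (auto simp: tr.sq_def)
    then show ?case using add.IH by simp
  next
    case (cmult f a) then show ?case by simp
  qed
  show ?thesis
  proof (rule measure_eqI)
    fix S assume "S \<in> sets ?N"
    then have S: "S \<in> sets \<mu>" by simp
    have sqS: "tr.sq (indicator S)" using S by (intro tr.sq_bounded[of _ 1]) (auto simp: indicator_def)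
    have app: "tr.approx (indicator S)"
      by (rule tr.approx_all[OF generated_by sqS]) (auto intro: regular_measurable regular_evaluation)
    have close: "\<bar>measure ?N S - measure \<mu> S\<bar> \<le> \<epsilon>" if \<epsilon>: "\<epsilon> > 0" for \<epsilon>
    proof -
      obtain a where a: "a \<in> trig_span regular" "tr.Q (\<lambda>w. indicator S w - a w) < (\<epsilon> / 2)\<^sup>2"
        using app \<epsilon> unfolding tr.approx_def by (meson half_gt_zero zero_less_power)
      have sqd: "tr.sq (\<lambda>w. indicator S w - a w)" by (rule tr.sq_diff[OF sqS tr.sq_A[OF a(1)]])
      \<comment> \<open>By Cauchy-Schwarz against the constant 1, under a probability measure the
        integral of a function is at most its L2 norm.\<close>
      have bound: "\<bar>measure P S - (\<integral>w. a w \<partial>P)\<bar> \<le> \<epsilon> / 2"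
        if P: "prob_space P" "sets P = sets \<mu>" "square_integrable P (\<lambda>w. indicator S w - a w)" "square_integrable P a"
          "(\<integral>w. (indicator S w - a w)\<^sup>2 \<partial>P) \<le> (\<epsilon> / 2)\<^sup>2" for P
      proof -
        interpret P: prob_space P by fact
        have SP: "S \<in> sets P" using S P(2) by simp
        have ia: "integrable P a" by (rule square_integrable_integrable[OF P.finite_measure_axioms P(4)])
        have "measure P S - (\<integral>w. a w \<partial>P) = (\<integral>w. (indicator S w - a w) * 1 \<partial>P)"
          using SP ia by (simp add: integrable_real_indicator P.emeasure_finite top.not_eq_extremum[symmetric])
        also have "\<bar>\<dots>\<bar> \<le> sqrt (\<integral>w. (indicator S w - a w)\<^sup>2 \<partial>P) * sqrt (\<integral>w. 1\<^sup>2 \<partial>P)"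
          by (rule Cauchy_Schwarz_integral[OF P(3) square_integrable_bounded[OF P.finite_measure_axioms, of _ 1]]) auto
        also have "\<dots> = sqrt (\<integral>w. (indicator S w - a w)\<^sup>2 \<partial>P)" by (simp add: P.prob_space)
        also have "\<dots> \<le> \<epsilon> / 2" using P(5) \<epsilon> by (intro real_le_lsqrt) auto
        finally show ?thesis .
      qed
      have q: "(\<integral>w. (indicator S w - a w)\<^sup>2 \<partial>\<mu>) + (\<integral>w. (indicator S w - a w)\<^sup>2 \<partial>?N) < (\<epsilon> / 2)\<^sup>2"
        using a(2) by (simp only: tr.Q_def)
      have nn: "0 \<le> (\<integral>w. (indicator S w - a w)\<^sup>2 \<partial>\<mu>)" "0 \<le> (\<integral>w. (indicator S w - a w)\<^sup>2 \<partial>?N)"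
        by (intro Bochner_Integration.integral_nonneg zero_le_power2)+
      note sa = tr.sq_A[OF a(1)]
      have "\<bar>measure \<mu> S - (\<integral>w. a w \<partial>\<mu>)\<bar> \<le> \<epsilon> / 2"
      proof (rule bound[OF prob_space_axioms refl])
        show "(\<integral>w. (indicator S w - a w)\<^sup>2 \<partial>\<mu>) \<le> (\<epsilon> / 2)\<^sup>2" using q nn by linarith
      qed (use sqd sa in \<open>simp_all add: tr.sq_def\<close>)
      moreover have "\<bar>measure ?N S - (\<integral>w. a w \<partial>?N)\<bar> \<le> \<epsilon> / 2"
      proof (rule bound[OF N.prob_space_axioms sets_distr])
        show "(\<integral>w. (indicator S w - a w)\<^sup>2 \<partial>?N) \<le> (\<epsilon> / 2)\<^sup>2" using q nn by linarith
      qed (use sqd sa in \<open>simp_all add: tr.sq_def\<close>)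
      ultimately show ?thesis unfolding same[OF a(1)] by linarith
    qed
    have "\<bar>measure ?N S - measure \<mu> S\<bar> \<le> 0" by (rule field_le_epsilon) (simp add: close)
    then show "emeasure ?N S = emeasure \<mu> S" by (simp add: emeasure_eq_measure N.emeasure_eq_measure)
  qed simp
qed

text \<open>Invariance of \<mu> turns Y n \<rightarrow> X in L2 into Y n o T \<rightarrow> X o T,
  and isometry of R turns k n \<rightarrow> h in H into R (k n) \<rightarrow> R h. Closedness of the
  graph then extends the identity from \<open>regular\<close> to all pairs.\<close>

lemma cm_pair_T:
  assumes "cm_pair h X"
  shows "cm_pair (R h) (\<lambda>w. X (T w))"
proof -
  note h = cm_pairD(1)[OF assms]
  obtain \<phi> Y where Y: "\<And>n. dyadic_pair (\<phi> n) (Y n)" "L2_tendsto leb01 \<phi> (deriv h)" "L2_tendsto \<mu> Y X"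
    using wiener_pair_sequence[OF cm_pairD(2)[OF assms]] by blast
  have "\<forall>n. \<exists>k. cm_pair k (Y n) \<and> cm_pair (R k) (\<lambda>w. Y n (T w))"
    using regular_dyadic[OF Y(1)] unfolding regular_def by blast
  from choice[OF this] obtain k where "\<forall>n. cm_pair (k n) (Y n) \<and> cm_pair (R (k n)) (\<lambda>w. Y n (T w))" ..
  then have k: "cm_pair (k n) (Y n)" "cm_pair (R (k n)) (\<lambda>w. Y n (T w))" for n by blast+
  have comp: "(\<integral>w. f (T w) \<partial>\<mu>) = (\<integral>w. f w \<partial>\<mu>)" if "f \<in> borel_measurable \<mu>" for f :: "(real \<Rightarrow> real) \<Rightarrow> real"
    using integral_distr[OF T_measurable that] T_preserving by simp
  have mX: "X \<in> borel_measurable \<mu>" by (rule cm_pairD(4)[OF assms])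
  have sXT: "square_integrable \<mu> (\<lambda>w. X (T w))"
  proof (rule square_integrableI)
    show "(\<lambda>w. X (T w)) \<in> borel_measurable \<mu>" by (rule measurable_compose[OF T_measurable mX])
    show "integrable \<mu> (\<lambda>w. (X (T w))\<^sup>2)"
      using integrable_distr[OF T_measurable, of "\<lambda>w. (X w)\<^sup>2"] T_preserving
        square_integrableD(2)[OF cm_pairD(3)[OF assms]] by simp
  qed
  have lim: "(\<lambda>n. \<integral>w. (Y n w - X w)\<^sup>2 \<partial>\<mu>) \<longlonglongrightarrow> 0" using Y(3) by (simp add: L2_tendsto_def)
  have "(\<integral>w. (Y n (T w) - X (T w))\<^sup>2 \<partial>\<mu>) = (\<integral>w. (Y n w - X w)\<^sup>2 \<partial>\<mu>)" for n
    using cm_pairD(4)[OF k(1)] mX by (intro comp[of "\<lambda>w. (Y n w - X w)\<^sup>2"]) measurable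
  then have 1: "L2_tendsto \<mu> (\<lambda>n w. Y n (T w)) (\<lambda>w. X (T w))"
    using lim sXT cm_pairD(3)[OF k(2)] by (simp add: L2_tendsto_def)
  have "(\<integral>s. (deriv (R (k n)) s - deriv (R h) s)\<^sup>2 \<partial>leb01) = (\<integral>w. (Y n w - X w)\<^sup>2 \<partial>\<mu>)" for n
    using R_integral_deriv_diff[OF cm_pairD(1)[OF k(1)] h] cm_pair_diff[OF k(1) assms] by simp
  then have 2: "L2_tendsto leb01 (\<lambda>n. deriv (R (k n))) (deriv (R h))"
    using lim cameron_martinD(4)[OF cm_pairD(1)[OF k(2)]] cameron_martinD(4)[OF R_cameron_martin[OF h]]
    by (simp add: L2_tendsto_def)
  show ?thesis
    unfolding cm_pair_def using wiener_pair_limit[OF cm_pairD(2)[OF k(2)] 2 1] R_cameron_martin[OF h] by blast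
qed

lemma cm_pair_Tn:
  "cm_pair h X \<Longrightarrow> cm_pair ((R ^^ n) h) (\<lambda>w. X ((T ^^ n) w))"
proof (induction n arbitrary: h X)
  case (Suc n)
  have "cm_pair ((R ^^ n) (R h)) (\<lambda>w. X (T ((T ^^ n) w)))" by (rule Suc.IH[OF cm_pair_T[OF Suc.prems]])
  then show ?case by (simp add: funpow_swap1)
qed simp

sublocale gaussian_transformation \<mu> "{X. \<exists>h. cm_pair h X}" T
proof (unfold_locales, unfold mem_Collect_eq)
  show "\<exists>h. cm_pair h (\<lambda>_. 0)" using cm_pair_zero by blast
  show "distr \<mu> \<mu> T = \<mu>" by (rule T_preserving)
  show "T \<in> measurable \<mu> \<mu>" by (rule T_measurable)
  have "sets \<mu> = sigma_sets (space \<mu>) {{w \<in> space \<mu>. a < X w} |X a. X \<in> {X. \<exists>h. cm_pair h X}}"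
    by (rule generated_by) (use cm_pairD(4) cm_pair_evaluation in blast)+
  then show "sets \<mu> = sigma_sets (space \<mu>) {{w \<in> space \<mu>. a < X w} |X a. \<exists>h. cm_pair h X}"
    by (simp only: mem_Collect_eq)
next
  fix X assume "\<exists>h. cm_pair h X"
  then obtain h where h: "cm_pair h X" by blast
  show "square_integrable \<mu> X" by (rule cm_pairD(3)[OF h])
  show "\<exists>h. cm_pair h (\<lambda>w. X (T w))" using cm_pair_T[OF h] by blast
  show "\<exists>h. cm_pair h (\<lambda>w. c * X w)" for c using cm_pair_lincomb[OF h h, of c 0] by auto
  show "(\<integral>w. cos (X w + c) \<partial>\<mu>) = cos c * exp (- (\<integral>w. (X w)\<^sup>2 \<partial>\<mu>) / 2)" for c
    using wiener_pair_moments(2,3)[OF cm_pairD(2)[OF h]] by simp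
  fix Y assume "\<exists>h. cm_pair h Y"
  then obtain k where k: "cm_pair k Y" by blast
  show "\<exists>h. cm_pair h (\<lambda>w. X w + Y w)" using cm_pair_lincomb[OF h k, of 1 1] by auto
qed

theorem mixing_iff:
  "mixing \<mu> T \<longleftrightarrow> (\<forall>h\<in>cameron_martin. (\<lambda>n. cm_inner ((R ^^ n) h) h) \<longlonglongrightarrow> 0)"
proof
  assume mix: "mixing \<mu> T"
  show "\<forall>h\<in>cameron_martin. (\<lambda>n. cm_inner ((R ^^ n) h) h) \<longlonglongrightarrow> 0"
  proof
    fix h assume h: "h \<in> cameron_martin"
    have p: "cm_pair h (wiener_delta \<mu> h)" using h wiener_delta_pair[OF h] by (simp add: cm_pair_def)
    \<comment> \<open>\<delta> h is centred and square-integrable, hence an admissible test function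
      for mixing; its correlations are the inner products in question.\<close>
    have "(\<lambda>n. \<integral>w. wiener_delta \<mu> h ((T ^^ n) w) * wiener_delta \<mu> h w \<partial>\<mu>) \<longlonglongrightarrow> 0"
      using mix cm_pairD(3)[OF p] wiener_pair_moments(1)[OF cm_pairD(2)[OF p]] unfolding mixing_def by blast
    then show "(\<lambda>n. cm_inner ((R ^^ n) h) h) \<longlonglongrightarrow> 0"
      by (simp add: cm_pair_inner[OF cm_pair_Tn[OF p] p])
  qed
next
  assume lim: "\<forall>h\<in>cameron_martin. (\<lambda>n. cm_inner ((R ^^ n) h) h) \<longlonglongrightarrow> 0"
  show "mixing \<mu> T"
  proof (rule mixing_if_decorrelating)
    fix X assume "X \<in> {X. \<exists>h. cm_pair h X}"
    then obtain h where h: "cm_pair h X" by blast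
    show "(\<lambda>n. \<integral>w. X ((T ^^ n) w) * X w \<partial>\<mu>) \<longlonglongrightarrow> 0"
      using lim cm_pairD(1)[OF h] by (simp add: cm_pair_inner[OF cm_pair_Tn[OF h] h])
  qed
qed

end

theorem theorem3:
  fixes \<mu> :: "(real \<Rightarrow> real) measure"
    and R T :: "(real \<Rightarrow> real) \<Rightarrow> (real \<Rightarrow> real)"
    and e :: "nat \<Rightarrow> real \<Rightarrow> real"
  assumes "wiener_measure \<mu>"
    and "cm_unitary R"
    and "cm_orthonormal_basis e"
    and "wiener_rotation \<mu> R e T"
  shows "mixing \<mu> T \<longleftrightarrow>
    (\<forall>h\<in>cameron_martin. (\<lambda>n. cm_inner ((R ^^ n) h) h) \<longlonglongrightarrow> 0)"
proof -
  interpret wiener_unitary \<mu> R T e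
    using assms by unfold_locales
  show ?thesis by (rule mixing_iff)
qed

end
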